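(* Let $T>0$. There is a constant $c>0$, independent of $n$ (equivalently of $h=T/n$) and of $u$, such that the following holds. Assume $u\in H^s(0,T)$ for some $s\in[0,1]$, and let $u_h\in S_h^0(0,T)$ be the unique solution of the variational formulation $$\langle u_h,\mathcal{H}_Tv_h\rangle_{L^2(0,T)}=\langle u,\mathcal{H}_Tv_h\rangle_{L^2(0,T)}\quad\text{for all }v_h\in S_h^0(0,T).$$ Then the error estimate $$\|u-u_h\|_{L^2(0,T)}\le c\left[h^s\,\|u\|_{H^s(0,T)}+\frac{\|Q_h\mathcal{H}_T^{-1}(u-Q_hu)\|_{L^2(0,T)}}{c_S(u_h-Q_hu)}\right]$$ holds true. Moreover, for $u\in H^2(0,T)$ with $\partial_tu(0)=0$, we have optimal convergence, i.e., $$\|u-u_h\|_{L^2(0,T)}\le c\,h\,\|u\|_{H^2(0,T)} .$$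
   Context: For $T>0$ and $n\in\mathbb{N}=\{1,2,\dots\}$ let $h=T/n$ and $t_i=ih$ for $i=0,\dots,n$. $S_h^0(0,T)\subset L^2(0,T)$ is the space of functions that are constant on each element $(t_{i-1},t_i)$, $i=1,\dots,n$; $Q_h:L^2(0,T)\to S_h^0(0,T)$ is the $L^2(0,T)$-orthogonal projection. $H^s(0,T)$ are the usual Sobolev spaces, with $H^0=L^2$. Modified Hilbert transformation: every $v\in L^2(0,T)$ has the expansion $v(t)=\sum_{k=0}^\infty v_k\sin\big((\frac\pi2+k\pi)\frac tT\big)$ with $v_k=\frac2T\int_0^Tv(t)\sin\big((\frac\pi2+k\pi)\frac tT\big)\,dt$, and $\mathcal{H}_T:L^2(0,T)\to L^2(0,T)$ is defined by $(\mathcal{H}_Tv)(t)=\sum_{k=0}^\infty v_k\cos\big((\frac\pi2+k\pi)\frac tT\big)$. Every $w\in L^2(0,T)$ also has the expansion $w(t)=\sum_{k=0}^\infty\overline{w}_k\cos\big((\frac\pi2+k\pi)\frac tT\big)$ with $\overline{w}_k=\frac2T\int_0^Tw(t)\cos\big((\frac\pi2+k\pi)\frac tT\big)\,dt$, and the inverse is $(\mathcal{H}_T^{-1}w)(t)=\sum_{k=0}^\infty\overline{w}_k\sin\big((\frac\pi2+k\pi)\frac tT\big)$. For $z_h\in S_h^0(0,T)$ with cosine coefficients $\overline{z}_k=\frac2T\int_0^Tz_h(t)\cos\big((\frac\pi2+k\pi)\frac tT\big)\,dt$ define $$c_S(z_h):=\frac{2\sqrt3}{\pi^2}\,\frac{16n^2-8n(2M+1)}{(4n-(2M+1))^2},\qquad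 M:=\min\Big\{m\in\mathbb{N}_0:\ \|z_h\|_{L^2(0,T)}^2\le\frac T2\,\frac{\pi^2}{3}\sum_{k=0}^m\overline{z}_k^2\Big\},$$ where $M\le n-1$ always holds (so $c_S(z_h)>0$). *)

theory Defs
  imports "HOL-Analysis.Analysis"
begin

text \<open>
  Elements of \<open>L\<^sup>2(0,T)\<close> are represented by functions \<open>real \<Rightarrow> real\<close>; their values outside
  \<open>(0,T)\<close> are irrelevant, and everything below depends on them only up to null sets.
\<close>

abbreviation leb :: "real \<Rightarrow> real measure" where
  "leb T \<equiv> lebesgue_on {0<..<T}"

definition L2 :: "real \<Rightarrow> (real \<Rightarrow> real) set" where
  "L2 T = {f \<in> borel_measurable (leb T). integrable (leb T) (\<lambda>t. (f t)\<^sup>2)}"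

definition L2_inner :: "real \<Rightarrow> (real \<Rightarrow> real) \<Rightarrow> (real \<Rightarrow> real) \<Rightarrow> real" where
  "L2_inner T f g = (\<integral>t. f t * g t \<partial>leb T)"

definition L2_norm :: "real \<Rightarrow> (real \<Rightarrow> real) \<Rightarrow> real" where
  "L2_norm T f = sqrt (L2_inner T f f)"

text \<open>Sum of a series in \<open>L\<^sup>2(0,T)\<close>, i.e. convergence in norm; unique up to null sets.\<close>

definition L2_suminf :: "real \<Rightarrow> (nat \<Rightarrow> real \<Rightarrow> real) \<Rightarrow> real \<Rightarrow> real" where
  "L2_suminf T f =
    (SOME g. g \<in> L2 T \<and> (\<lambda>N. L2_norm T (\<lambda>t. g t - (\<Sum>k<N. f k t))) \<longlonglongrightarrow> 0)"

definition sin_mode :: "real \<Rightarrow> nat \<Rightarrow> real \<Rightarrow> real" where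
  "sin_mode T k t = sin ((pi / 2 + real k * pi) * (t / T))"

definition cos_mode :: "real \<Rightarrow> nat \<Rightarrow> real \<Rightarrow> real" where
  "cos_mode T k t = cos ((pi / 2 + real k * pi) * (t / T))"

definition fourier_sin :: "real \<Rightarrow> (real \<Rightarrow> real) \<Rightarrow> nat \<Rightarrow> real" where
  "fourier_sin T v k = 2 / T * (\<integral>t. v t * sin_mode T k t \<partial>leb T)"

definition fourier_cos :: "real \<Rightarrow> (real \<Rightarrow> real) \<Rightarrow> nat \<Rightarrow> real" where
  "fourier_cos T w k = 2 / T * (\<integral>t. w t * cos_mode T k t \<partial>leb T)"

definition modHilbert :: "real \<Rightarrow> (real \<Rightarrow> real) \<Rightarrow> real \<Rightarrow> real" where
  "modHilbert T v = L2_suminf T (\<lambda>k t. fourier_sin T v k * cos_mode T k t)"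

definition modHilbert_inv :: "real \<Rightarrow> (real \<Rightarrow> real) \<Rightarrow> real \<Rightarrow> real" where
  "modHilbert_inv T w = L2_suminf T (\<lambda>k t. fourier_cos T w k * sin_mode T k t)"

text \<open>Piecewise constants on the uniform mesh with \<open>n\<close> elements of length \<open>T / n\<close>; the values
  at the nodes are left free.\<close>

definition pw_const :: "real \<Rightarrow> nat \<Rightarrow> (real \<Rightarrow> real) set" where
  "pw_const T n = {v \<in> L2 T. \<forall>i\<in>{1..n}. \<exists>a. \<forall>t\<in>{(real i - 1) * (T / real n)<..<real i * (T / real n)}. v t = a}"

definition Q_proj :: "real \<Rightarrow> nat \<Rightarrow> (real \<Rightarrow> real) \<Rightarrow> real \<Rightarrow> real" where
  "Q_proj T n u =
    (SOME q. q \<in> pw_const T n \<and> (\<forall>v\<in>pw_const T n. L2_inner T (\<lambda>t. u t - q t) v = 0))"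

definition galerkin_solution :: "real \<Rightarrow> nat \<Rightarrow> (real \<Rightarrow> real) \<Rightarrow> (real \<Rightarrow> real) \<Rightarrow> bool" where
  "galerkin_solution T n u uh \<longleftrightarrow> uh \<in> pw_const T n \<and>
    (\<forall>vh\<in>pw_const T n. L2_inner T uh (modHilbert T vh) = L2_inner T u (modHilbert T vh))"

definition cS_index :: "real \<Rightarrow> (real \<Rightarrow> real) \<Rightarrow> nat" where
  "cS_index T z = (LEAST m. (L2_norm T z)\<^sup>2 \<le> T / 2 * (pi\<^sup>2 / 3) * (\<Sum>k\<le>m. (fourier_cos T z k)\<^sup>2))"

definition cS :: "real \<Rightarrow> nat \<Rightarrow> (real \<Rightarrow> real) \<Rightarrow> real" where
  "cS T n z = (let M = real (cS_index T z) in
    2 * sqrt 3 / pi\<^sup>2 * ((16 * (real n)\<^sup>2 - 8 * real n * (2 * M + 1)) / (4 * real n - (2 * M + 1))\<^sup>2))"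

text \<open>The test functions \<open>C\<^sub>c\<^sup>\<infinity>(0,T)\<close>.\<close>

definition test_fun :: "real \<Rightarrow> (real \<Rightarrow> real) set" where
  "test_fun T = {\<phi>. (\<forall>k. (deriv ^^ k) \<phi> differentiable_on UNIV) \<and>
    (\<exists>K. compact K \<and> K \<subseteq> {0<..<T} \<and> (\<forall>t. t \<notin> K \<longrightarrow> \<phi> t = 0))}"

definition has_weak_deriv :: "real \<Rightarrow> (real \<Rightarrow> real) \<Rightarrow> (real \<Rightarrow> real) \<Rightarrow> bool" where
  "has_weak_deriv T u g \<longleftrightarrow>
    (\<forall>\<phi>\<in>test_fun T. L2_inner T u (deriv \<phi>) = - L2_inner T g \<phi>)"

definition weak_deriv :: "real \<Rightarrow> (real \<Rightarrow> real) \<Rightarrow> real \<Rightarrow> real" where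
  "weak_deriv T u = (SOME g. g \<in> L2 T \<and> has_weak_deriv T u g)"

text \<open>Integrand of the squared Sobolev--Slobodeckij seminorm of order \<open>\<sigma> \<in> (0,1)\<close>; the value on
  the diagonal (\<open>0\<close>, as division by zero gives zero) does not matter.\<close>

definition slob_integrand :: "real \<Rightarrow> (real \<Rightarrow> real) \<Rightarrow> real \<times> real \<Rightarrow> real" where
  "slob_integrand \<sigma> u = (\<lambda>(x, y). (u x - u y)\<^sup>2 / \<bar>x - y\<bar> powr (1 + 2 * \<sigma>))"

text \<open>The Sobolev space \<open>H\<^sup>s(0,T)\<close> for real \<open>s \<ge> 0\<close>, with the Sobolev--Slobodeckij norm.\<close>

definition sobolev :: "real \<Rightarrow> real \<Rightarrow> (real \<Rightarrow> real) set" where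
  "sobolev T s = {u \<in> L2 T.
    (\<forall>j<nat \<lfloor>s\<rfloor>. \<exists>g\<in>L2 T. has_weak_deriv T ((weak_deriv T ^^ j) u) g) \<and>
    (frac s \<noteq> 0 \<longrightarrow>
      integrable (leb T \<Otimes>\<^sub>M leb T) (slob_integrand (frac s) ((weak_deriv T ^^ nat \<lfloor>s\<rfloor>) u)))}"

definition sobolev_norm :: "real \<Rightarrow> real \<Rightarrow> (real \<Rightarrow> real) \<Rightarrow> real" where
  "sobolev_norm T s u = sqrt (
    (\<Sum>j\<le>nat \<lfloor>s\<rfloor>. (L2_norm T ((weak_deriv T ^^ j) u))\<^sup>2) +
    (if frac s = 0 then 0
     else \<integral>p. slob_integrand (frac s) ((weak_deriv T ^^ nat \<lfloor>s\<rfloor>) u) p \<partial>(leb T \<Otimes>\<^sub>M leb T)))"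

text \<open>The value at \<open>0\<close> of the continuous representative of \<open>w\<close>; such a representative exists for
  every \<open>w \<in> H\<^sup>1(0,T)\<close>.\<close>

definition has_initial_value :: "real \<Rightarrow> (real \<Rightarrow> real) \<Rightarrow> real \<Rightarrow> bool" where
  "has_initial_value T w a \<longleftrightarrow>
    (\<exists>g. continuous_on {0..T} g \<and> (AE t in leb T. g t = w t) \<and> g 0 = a)"

end

theory Submission
  imports Defs
begin

text \<open>
  On the uniform mesh the frequencies \<open>2 n j + k\<close> and \<open>2 n (j + 1) - 1 - k\<close> are aliases of \<open>k < n\<close>.
  Hence the form \<open>\<langle>z\<^sub>h, H\<^sub>T v\<^sub>h\<rangle>\<close> is diagonalised by the discrete cosine transform (type IV) of \<open>z\<^sub>h\<close> and the
  discrete sine transform of \<open>v\<^sub>h\<close>; its symbol is \<open>\<sigma>(x) = (sin x)\<^sup>2 (\<Sum>j. 1 / (x + \<pi> j)\<^sup>2 - 1 / (\<pi> (j + 1) - x)\<^sup>2)\<close>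
  at \<open>x\<^sub>k = (2 k + 1) \<pi> / (4 n)\<close>. Testing with the low frequencies of \<open>z\<^sub>h = u\<^sub>h - Q\<^sub>h u\<close> bounds
  \<open>c\<^sub>S(z\<^sub>h) \<parallel>z\<^sub>h\<parallel>\<close> by \<open>\<parallel>Q\<^sub>h H\<^sub>T\<^sup>-\<^sup>1 (u - Q\<^sub>h u)\<parallel>\<close>, and testing with all of them gives the inf-sup constant
  \<open>2 / (\<pi>\<^sup>2 n)\<close>. This loss of one power of \<open>h\<close> is compensated for \<open>u \<in> H\<^sup>2\<close>: up to a constant, which is
  reproduced exactly, the cosine coefficients of \<open>u\<close> are those of \<open>u''\<close> divided by \<open>- \<omega>\<^sub>l\<^sup>2\<close> precisely
  because \<open>u'(0) = 0\<close>, and as \<open>1 - \<sigma>(x) = O(x\<^sup>2)\<close> the consistency error is \<open>O(h\<^sup>2)\<close>.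
\<close>

section \<open>The space \<open>L\<^sup>2(0,T)\<close>\<close>

text \<open>At x = pi / 2 the aliases cancel in pairs and the symbol vanishes, so the form has no
  inf-sup constant uniform in n. The loss is isolated in \<open>damp\<close>, a lower bound for the
  symbol divided by sinc^2: its value at the truncation index M is the n-dependent factor of
  \<open>cS\<close>, its value at k = n - 1 the factor 1 / n. The other constants come from Jordan's
  bound sinc \<ge> 2 / pi at the angles of index k < n and from pi^2 / 3 in the definition of M: 2 *
  sqrt 3 / pi^2 is 2 / pi times sqrt 3 / pi. In the consistency estimate the expansion at x = 0
  serves only the modes l < n; above n nothing cancels, and the decay of sinc supplies weights that
  are square summable over the blocks of 2 n frequencies. The limits of series, the projection and
  the weak derivatives are all picked by a choice operator and determined only up to null sets. They
  are therefore handled through pairings, and the representation of u by a double primitive has to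
  be won from weak derivatives, which requires an explicit supply of test functions.\<close>

lemmas leb_integral_cong = Bochner_Integration.integral_cong

lemma finite_measure_leb: "finite_measure (leb T)"
proof (rule finite_measureI)
  have "emeasure lborel {0<..<T} \<noteq> \<infinity>"
    by (cases "T \<ge> 0") auto
  thus "emeasure (leb T) (space (leb T)) \<noteq> \<infinity>"
    by (simp add: emeasure_restrict_space)
qed

lemma borel_measurable_leb: "f \<in> borel_measurable borel \<Longrightarrow> f \<in> borel_measurable (leb T)"
  by (simp add: measurable_completion measurable_restrict_space1)

lemma integrable_bounded_leb:
  assumes "f \<in> borel_measurable (leb T)" "\<And>t. t \<in> {0<..<T} \<Longrightarrow> \<bar>f t\<bar> \<le> B"
  shows "integrable (leb T) (f :: real \<Rightarrow> real)"
proof -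
  interpret finite_measure "leb T" by (rule finite_measure_leb)
  show ?thesis
    by (rule integrable_const_bound[where B=B]) (use assms in auto)
qed

lemma L2_measurable: "f \<in> L2 T \<Longrightarrow> f \<in> borel_measurable (leb T)"
  by (simp add: L2_def)

lemma L2_bounded:
  assumes "f \<in> borel_measurable (leb T)" "\<And>t. t \<in> {0<..<T} \<Longrightarrow> \<bar>f t\<bar> \<le> B"
  shows "f \<in> L2 T"
  unfolding L2_def
proof (safe)
  have "\<bar>(f t)\<^sup>2\<bar> \<le> B\<^sup>2" if "t \<in> {0<..<T}" for t
    using power_mono[OF assms(2)[OF that], of 2] by simp
  thus "integrable (leb T) (\<lambda>t. (f t)\<^sup>2)"
    using assms(1) by (intro integrable_bounded_leb) auto
qed (use assms in auto)

lemma indicator_borel_leb: "A \<in> sets borel \<Longrightarrow> (indicator A :: real \<Rightarrow> real) \<in> borel_measurable (leb T)"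
  by (rule borel_measurable_leb) simp

lemma indicator_L2: "A \<in> sets borel \<Longrightarrow> indicator A \<in> L2 T"
  by (rule L2_bounded[where B = 1]) (auto simp: indicator_borel_leb split: split_indicator)

lemma L2_continuous:
  assumes "continuous_on {0..T} f" shows "f \<in> L2 T"
proof -
  have "compact (f ` {0..T})" using assms by (intro compact_continuous_image) auto
  then obtain B where B: "\<And>t. t \<in> {0..T} \<Longrightarrow> \<bar>f t\<bar> \<le> B"
    using compact_imp_bounded[of "f ` {0..T}"] unfolding bounded_iff by force
  have "continuous_on {0<..<T} f" by (rule continuous_on_subset[OF assms]) auto
  hence "f \<in> borel_measurable (leb T)"
    by (rule continuous_imp_measurable_on_sets_lebesgue) auto
  thus ?thesis using B by (intro L2_bounded[where B=B]) auto
qed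

lemma L2_mult_integrable:
  assumes "f \<in> L2 T" "g \<in> L2 T" shows "integrable (leb T) (\<lambda>t. f t * g t)"
proof (rule Bochner_Integration.integrable_bound)
  show "integrable (leb T) (\<lambda>t. (f t)\<^sup>2 + (g t)\<^sup>2)"
    using assms unfolding L2_def by auto
  show "(\<lambda>t. f t * g t) \<in> borel_measurable (leb T)"
    using assms unfolding L2_def by auto
  have "\<bar>a * b\<bar> \<le> \<bar>a\<^sup>2 + b\<^sup>2\<bar>" for a b :: real
  proof -
    have "0 \<le> \<bar>a\<bar> * \<bar>b\<bar>" by simp
    with sum_squares_bound[of "\<bar>a\<bar>" "\<bar>b\<bar>"] have "\<bar>a\<bar> * \<bar>b\<bar> \<le> a\<^sup>2 + b\<^sup>2"
      unfolding power2_abs by linarith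
    thus ?thesis by (simp add: abs_mult)
  qed
  thus "AE t in leb T. norm (f t * g t) \<le> norm ((f t)\<^sup>2 + (g t)\<^sup>2)" by simp
qed

lemma L2_const [simp]: "(\<lambda>t. c) \<in> L2 T"
  by (rule L2_bounded[where B="\<bar>c\<bar>"]) auto

lemma L2_integrable:
  assumes "f \<in> L2 T" shows "integrable (leb T) f"
  using L2_mult_integrable[OF assms L2_const[of 1]] by simp

lemma L2_add [simp]:
  assumes "f \<in> L2 T" "g \<in> L2 T" shows "(\<lambda>t. f t + g t) \<in> L2 T"
proof -
  have "integrable (leb T) (\<lambda>t. (f t)\<^sup>2 + 2 * (f t * g t) + (g t)\<^sup>2)"
    using assms L2_mult_integrable[OF assms] unfolding L2_def by auto
  thus ?thesis using assms unfolding L2_def by (auto simp: power2_sum algebra_simps)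
qed

lemma L2_cmult [simp]: "f \<in> L2 T \<Longrightarrow> (\<lambda>t. c * f t) \<in> L2 T"
  unfolding L2_def by (auto simp: power_mult_distrib)

lemma L2_diff [simp]:
  assumes "f \<in> L2 T" "g \<in> L2 T" shows "(\<lambda>t. f t - g t) \<in> L2 T"
  using L2_add[OF assms(1) L2_cmult[OF assms(2), of "-1"]] by simp

lemma L2_sum [simp]: "(\<And>i. i \<in> A \<Longrightarrow> f i \<in> L2 T) \<Longrightarrow> (\<lambda>t. \<Sum>i\<in>A. f i t) \<in> L2 T"
  by (induction A rule: infinite_finite_induct) auto

lemma L2_mult_bounded:
  assumes "f \<in> L2 T" "g \<in> borel_measurable (leb T)" "\<And>t. t \<in> {0<..<T} \<Longrightarrow> \<bar>g t\<bar> \<le> B"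
  shows "(\<lambda>t. f t * g t) \<in> L2 T"
  unfolding L2_def
proof safe
  show "(\<lambda>t. f t * g t) \<in> borel_measurable (leb T)" using assms unfolding L2_def by auto
  show "integrable (leb T) (\<lambda>t. (f t * g t)\<^sup>2)"
  proof (rule Bochner_Integration.integrable_bound)
    show "integrable (leb T) (\<lambda>t. B\<^sup>2 * (f t)\<^sup>2)" using assms unfolding L2_def by auto
    show "AE t in leb T. norm ((f t * g t)\<^sup>2) \<le> norm (B\<^sup>2 * (f t)\<^sup>2)"
    proof (rule AE_I2)
      fix t assume "t \<in> space (leb T)"
      hence "(g t)\<^sup>2 \<le> B\<^sup>2" using power_mono[OF assms(3)[of t], of 2] by simp
      hence "(g t)\<^sup>2 * (f t)\<^sup>2 \<le> B\<^sup>2 * (f t)\<^sup>2" by (rule mult_right_mono) simp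
      thus "norm ((f t * g t)\<^sup>2) \<le> norm (B\<^sup>2 * (f t)\<^sup>2)"
        by (simp add: power_mult_distrib mult.commute)
    qed
  qed (use assms in \<open>auto simp: L2_def\<close>)
qed

section \<open>The semidefinite inner product and its inequalities\<close>

lemma L2_inner_commute: "L2_inner T f g = L2_inner T g f"
  unfolding L2_inner_def by (simp add: mult.commute)

lemma L2_inner_add_left:
  assumes "f \<in> L2 T" "g \<in> L2 T" "w \<in> L2 T"
  shows "L2_inner T (\<lambda>t. f t + g t) w = L2_inner T f w + L2_inner T g w"
  unfolding L2_inner_def using assms by (simp add: distrib_right L2_mult_integrable)

lemma L2_inner_add_right:
  assumes "f \<in> L2 T" "g \<in> L2 T" "w \<in> L2 T"
  shows "L2_inner T w (\<lambda>t. f t + g t) = L2_inner T w f + L2_inner T w g"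
  using L2_inner_add_left[OF assms] by (simp add: L2_inner_commute[of T w])

lemma L2_inner_cmult_left [simp]: "L2_inner T (\<lambda>t. c * f t) w = c * L2_inner T f w"
  unfolding L2_inner_def by (simp add: mult.assoc)

lemma L2_inner_cmult_right [simp]: "L2_inner T w (\<lambda>t. c * f t) = c * L2_inner T w f"
  using L2_inner_cmult_left L2_inner_commute by metis

lemma L2_inner_diff_left:
  assumes "f \<in> L2 T" "g \<in> L2 T" "w \<in> L2 T"
  shows "L2_inner T (\<lambda>t. f t - g t) w = L2_inner T f w - L2_inner T g w"
  unfolding L2_inner_def using assms by (simp add: left_diff_distrib L2_mult_integrable)

lemma L2_inner_diff_right:
  assumes "f \<in> L2 T" "g \<in> L2 T" "w \<in> L2 T"
  shows "L2_inner T w (\<lambda>t. f t - g t) = L2_inner T w f - L2_inner T w g"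
  using L2_inner_diff_left[OF assms] by (simp add: L2_inner_commute[of T w])

lemma L2_inner_sum_left:
  assumes "\<And>i. i \<in> A \<Longrightarrow> f i \<in> L2 T" "w \<in> L2 T"
  shows "L2_inner T (\<lambda>t. \<Sum>i\<in>A. f i t) w = (\<Sum>i\<in>A. L2_inner T (f i) w)"
  unfolding L2_inner_def using assms by (simp add: sum_distrib_right L2_mult_integrable)

lemma L2_inner_sum_right:
  assumes "\<And>i. i \<in> A \<Longrightarrow> f i \<in> L2 T" "w \<in> L2 T"
  shows "L2_inner T w (\<lambda>t. \<Sum>i\<in>A. f i t) = (\<Sum>i\<in>A. L2_inner T w (f i))"
  using L2_inner_sum_left[OF assms] by (simp add: L2_inner_commute[of T w])

lemma L2_inner_cong_AE:
  assumes "AE t in leb T. f t = f' t" "AE t in leb T. g t = g' t"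
    "f \<in> L2 T" "f' \<in> L2 T" "g \<in> L2 T" "g' \<in> L2 T"
  shows "L2_inner T f g = L2_inner T f' g'"
  unfolding L2_inner_def
  by (rule integral_cong_AE) (use assms in \<open>auto simp: L2_def\<close>)

lemma L2_inner_self_nonneg [simp]: "0 \<le> L2_inner T f f"
  unfolding L2_inner_def by (rule Bochner_Integration.integral_nonneg) auto

lemma L2_norm_nonneg [simp]: "0 \<le> L2_norm T f"
  unfolding L2_norm_def by simp

lemma L2_norm_power2: "(L2_norm T f)\<^sup>2 = L2_inner T f f"
  unfolding L2_norm_def by simp

lemma L2_inner_self_mono:
  assumes "f \<in> L2 T" "g \<in> L2 T" "AE t in leb T. (f t)\<^sup>2 \<le> (g t)\<^sup>2"
  shows "L2_inner T f f \<le> L2_inner T g g"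
  unfolding L2_inner_def power2_eq_square[symmetric]
  using assms by (intro integral_mono_AE) (auto simp: L2_def)

text \<open>The squared norm of f - x g is nonnegative for every real x. On functions the inner
  product is only semidefinite, so a g of norm 0 is treated separately instead of dividing by its
  norm.\<close>

lemma L2_Cauchy_Schwarz:
  assumes "f \<in> L2 T" "g \<in> L2 T"
  shows "\<bar>L2_inner T f g\<bar> \<le> L2_norm T f * L2_norm T g"
proof -
  define a b c where "a = L2_inner T f f" and "b = L2_inner T f g" and "c = L2_inner T g g"
  have *: "0 \<le> a - 2 * x * b + x\<^sup>2 * c" for x
  proof -
    have "0 \<le> L2_inner T (\<lambda>t. f t - x * g t) (\<lambda>t. f t - x * g t)" by simp
    also have "\<dots> = a - 2 * x * b + x\<^sup>2 * c"
      using assms unfolding a_def b_def c_def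
      by (simp add: L2_inner_diff_left L2_inner_diff_right L2_inner_commute[of T g f] power2_eq_square algebra_simps)
    finally show ?thesis .
  qed
  have c0: "c \<ge> 0" "a \<ge> 0" unfolding c_def a_def by auto
  have "b\<^sup>2 \<le> a * c"
  proof (cases "c = 0")
    case True
    have "b = 0"
    proof (rule ccontr)
      assume "b \<noteq> 0"
      \<comment> \<open>For this x the quadratic would equal a - (a + 1) = -1.\<close>
      with *[of "(a + 1) / (2 * b)"] True show False by (simp add: field_simps)
    qed
    thus ?thesis using c0 by simp
  next
    case False
    hence "c > 0" using c0 by simp
    with *[of "b / c"] show ?thesis by (simp add: field_simps power2_eq_square)
  qed
  hence "sqrt (b\<^sup>2) \<le> sqrt (a * c)" by (rule real_sqrt_le_mono)
  thus ?thesis unfolding L2_norm_def a_def b_def c_def by (simp add: real_sqrt_mult)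
qed

lemma L2_norm_triangle:
  assumes "f \<in> L2 T" "g \<in> L2 T"
  shows "L2_norm T (\<lambda>t. f t + g t) \<le> L2_norm T f + L2_norm T g"
proof (rule power2_le_imp_le)
  have "(L2_norm T (\<lambda>t. f t + g t))\<^sup>2 = L2_inner T f f + 2 * L2_inner T f g + L2_inner T g g"
    unfolding L2_norm_power2 using assms
    by (simp add: L2_inner_add_left L2_inner_add_right L2_inner_commute[of T g f])
  also have "\<dots> \<le> (L2_norm T f + L2_norm T g)\<^sup>2"
    using L2_Cauchy_Schwarz[OF assms] by (simp add: power2_sum L2_norm_power2)
  finally show "(L2_norm T (\<lambda>t. f t + g t))\<^sup>2 \<le> (L2_norm T f + L2_norm T g)\<^sup>2" .
qed simp

lemma L2_norm_minus_commute: "L2_norm T (\<lambda>t. f t - g t) = L2_norm T (\<lambda>t. g t - f t)"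
  unfolding L2_norm_def L2_inner_def power2_eq_square[symmetric] by (simp add: power2_commute)

lemma L2_norm_cmult: "L2_norm T (\<lambda>t. c * f t) = \<bar>c\<bar> * L2_norm T f"
  unfolding L2_norm_def by (simp add: real_sqrt_mult real_sqrt_mult_self flip: mult.assoc)

lemma L2_norm_triangle_diff:
  assumes "f \<in> L2 T" "g \<in> L2 T" "h \<in> L2 T"
  shows "L2_norm T (\<lambda>t. f t - h t) \<le> L2_norm T (\<lambda>t. f t - g t) + L2_norm T (\<lambda>t. g t - h t)"
  using L2_norm_triangle[of "\<lambda>t. f t - g t" T "\<lambda>t. g t - h t"] assms by simp

section \<open>Convergence in norm and completeness\<close>

text \<open>Series limits enter later arguments through this continuity of the pairing, which does
  not depend on the representative that \<open>L2_suminf\<close> picks.\<close>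

lemma L2_inner_tendsto:
  assumes "\<And>N. S N \<in> L2 T" "g \<in> L2 T" "w \<in> L2 T"
    and "(\<lambda>N. L2_norm T (\<lambda>t. g t - S N t)) \<longlonglongrightarrow> 0"
  shows "(\<lambda>N. L2_inner T (S N) w) \<longlonglongrightarrow> L2_inner T g w"
proof (rule LIM_zero_cancel, rule Lim_null_comparison)
  show "\<forall>\<^sub>F N in sequentially. norm (L2_inner T (S N) w - L2_inner T g w)
      \<le> L2_norm T (\<lambda>t. g t - S N t) * L2_norm T w"
  proof (rule always_eventually, rule allI)
    fix N
    have "L2_inner T (S N) w - L2_inner T g w = - L2_inner T (\<lambda>t. g t - S N t) w"
      using assms by (simp add: L2_inner_diff_left)
    thus "norm (L2_inner T (S N) w - L2_inner T g w) \<le> L2_norm T (\<lambda>t. g t - S N t) * L2_norm T w"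
      using L2_Cauchy_Schwarz[of "\<lambda>t. g t - S N t" T w] assms by simp
  qed
  show "(\<lambda>N. L2_norm T (\<lambda>t. g t - S N t) * L2_norm T w) \<longlonglongrightarrow> 0"
    using tendsto_mult_left_zero[OF assms(4)] .
qed

text \<open>Riesz--Fischer: a rapidly converging subsequence converges almost everywhere, and Fatou's
  lemma identifies its limit as the \<open>L\<^sup>2\<close> limit.\<close>

lemma L2_complete:
  assumes S: "\<And>N. S N \<in> L2 T"
    and Cau: "\<And>e. e > 0 \<Longrightarrow> \<exists>N0. \<forall>m\<ge>N0. \<forall>n\<ge>N0. L2_norm T (\<lambda>t. S m t - S n t) < e"
  shows "\<exists>g\<in>L2 T. (\<lambda>N. L2_norm T (\<lambda>t. g t - S N t)) \<longlonglongrightarrow> 0"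
proof -
  have Sm [measurable]: "S N \<in> borel_measurable (leb T)" for N using S L2_measurable by auto
  \<comment> \<open>The indices \<open>r j\<close> are chosen nondecreasing with precision 2^-j, so
    that the increments along the subsequence have summable norms.\<close>
  define P where "P j N0 \<longleftrightarrow> (\<forall>m\<ge>N0. \<forall>n\<ge>N0. L2_norm T (\<lambda>t. S m t - S n t) < (1/2)^j)" for j N0
  have "\<exists>r. \<forall>j. P j (r j) \<and> r j \<le> r (Suc j)"
  proof (rule dependent_nat_choice)
    show "\<exists>x. P 0 x" using Cau[of 1] unfolding P_def by simp
    fix x j
    obtain y where "P (Suc j) y" using Cau[of "(1/2)^Suc j"] unfolding P_def by auto
    hence "P (Suc j) (max x y)" unfolding P_def by auto
    thus "\<exists>y. P (Suc j) y \<and> x \<le> y" by (intro exI[of _ "max x y"]) auto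
  qed
  then obtain r where r: "\<And>j. P j (r j)" "\<And>j. r j \<le> r (Suc j)" by blast
  have rmono: "mono r" using r(2) by (simp add: mono_iff_le_Suc)
  define D where "D j t = \<bar>S (r (Suc j)) t - S (r j) t\<bar>" for j t
  have D_L2: "(\<lambda>t. S (r (Suc j)) t - S (r j) t) \<in> L2 T" for j using S by simp
  have D_int: "integrable (leb T) (D j)" for j
    unfolding D_def using L2_integrable[OF D_L2] by auto
  \<comment> \<open>The interval has finite measure, so Cauchy-Schwarz against the constant 1 turns
    summability in L2 into summability in L1; the sum of the increments is then finite almost
    everywhere.\<close>
  have D_bd: "(\<integral>t. D j t \<partial>leb T) \<le> (1/2)^j * L2_norm T (\<lambda>t. 1)" for j
  proof -
    let ?d = "\<lambda>t. S (r (Suc j)) t - S (r j) t"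
    have absL2: "(\<lambda>t. \<bar>?d t\<bar>) \<in> L2 T"
      using D_L2[of j] unfolding L2_def by auto
    have "(\<integral>t. D j t \<partial>leb T) = L2_inner T (\<lambda>t. \<bar>?d t\<bar>) (\<lambda>t. 1)"
      unfolding L2_inner_def D_def by simp
    also have "\<dots> \<le> L2_norm T (\<lambda>t. \<bar>?d t\<bar>) * L2_norm T (\<lambda>t. 1)"
      using L2_Cauchy_Schwarz[OF absL2 L2_const[of 1]] by simp
    also have "L2_norm T (\<lambda>t. \<bar>?d t\<bar>) = L2_norm T ?d"
      unfolding L2_norm_def L2_inner_def by simp
    also have "L2_norm T ?d < (1/2)^j"
      using r(1)[of j] r(2)[of j] unfolding P_def by blast
    hence "L2_norm T ?d * L2_norm T (\<lambda>t. 1) \<le> (1/2)^j * L2_norm T (\<lambda>t. 1)"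
      by (intro mult_right_mono) auto
    finally show ?thesis .
  qed
  have "(\<integral>\<^sup>+t. (\<Sum>j. ennreal (D j t)) \<partial>leb T) = (\<Sum>j. \<integral>\<^sup>+t. ennreal (D j t) \<partial>leb T)"
    by (rule nn_integral_suminf) (auto simp: D_def)
  also have "\<dots> = (\<Sum>j. ennreal (\<integral>t. D j t \<partial>leb T))"
    by (intro suminf_cong nn_integral_eq_integral D_int) (auto simp: D_def)
  also have "\<dots> \<le> (\<Sum>j. ennreal ((1/2)^j * L2_norm T (\<lambda>t. 1)))"
    by (intro suminf_le ennreal_leI D_bd) auto
  also have "\<dots> < top"
  proof -
    have "summable (\<lambda>j. (1/2::real)^j * L2_norm T (\<lambda>t. 1))"
      by (intro summable_mult2 summable_geometric) simp
    hence "(\<Sum>j. ennreal ((1/2)^j * L2_norm T (\<lambda>t. 1))) \<noteq> top"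
      by (rule ennreal_suminf_neq_top) simp
    thus ?thesis by (simp only: less_top)
  qed
  finally have "(\<integral>\<^sup>+t. (\<Sum>j. ennreal (D j t)) \<partial>leb T) \<noteq> \<infinity>"
    by (metis infinity_ennreal_def less_irrefl)
  hence "AE t in leb T. (\<Sum>j. ennreal (D j t)) \<noteq> \<infinity>"
    by (intro nn_integral_PInf_AE) (auto simp: D_def)
  hence conv: "AE t in leb T. convergent (\<lambda>j. S (r j) t)"
  proof (rule AE_mp, intro AE_I2 impI)
    fix t assume "(\<Sum>j. ennreal (D j t)) \<noteq> \<infinity>"
    hence "summable (\<lambda>j. D j t)" by (intro summable_suminf_not_top) (auto simp: D_def)
    hence "summable (\<lambda>j. S (r (Suc j)) t - S (r j) t)"
      unfolding D_def by (rule summable_rabs_cancel)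
    hence "convergent (\<lambda>m. \<Sum>j<m. S (r (Suc j)) t - S (r j) t)"
      by (simp add: summable_iff_convergent)
    hence "convergent (\<lambda>m. S (r m) t - S (r 0) t)" 
      by (simp add: sum_lessThan_telescope[of "\<lambda>j. S (r j) t"])
    hence "convergent (\<lambda>m. (S (r m) t - S (r 0) t) + S (r 0) t)"
      by (intro convergent_add convergent_const)
    thus "convergent (\<lambda>j. S (r j) t)" by simp
  qed
  define g where "g t = lim (\<lambda>j. S (r j) t)" for t
  have [measurable]: "g \<in> borel_measurable (leb T)"
    unfolding g_def by (rule borel_measurable_lim_metric) auto
  \<comment> \<open>Fatou in the subsequence index i with N held fixed. Every N beyond
    \<open>r j\<close> is covered, so the whole sequence converges and not just the
    subsequence.\<close>
  have key: "(\<integral>\<^sup>+t. ennreal ((g t - S N t)\<^sup>2) \<partial>leb T) \<le> ennreal (((1/2)^j)\<^sup>2)" if "N \<ge> r j" for j N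
  proof -
    have "(\<integral>\<^sup>+t. ennreal ((g t - S N t)\<^sup>2) \<partial>leb T)
        = (\<integral>\<^sup>+t. liminf (\<lambda>i. ennreal ((S (r i) t - S N t)\<^sup>2)) \<partial>leb T)"
    proof (rule nn_integral_cong_AE, use conv in eventually_elim)
      fix t assume "convergent (\<lambda>j. S (r j) t)"
      hence "(\<lambda>j. S (r j) t) \<longlonglongrightarrow> g t" unfolding g_def by (simp add: convergent_LIMSEQ_iff)
      hence "(\<lambda>i. ennreal ((S (r i) t - S N t)\<^sup>2)) \<longlonglongrightarrow> ennreal ((g t - S N t)\<^sup>2)"
        by (intro tendsto_intros)
      thus "ennreal ((g t - S N t)\<^sup>2) = liminf (\<lambda>i. ennreal ((S (r i) t - S N t)\<^sup>2))"
        by (rule lim_imp_Liminf[OF trivial_limit_sequentially, symmetric])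
    qed
    also have "\<dots> \<le> liminf (\<lambda>i. \<integral>\<^sup>+t. ennreal ((S (r i) t - S N t)\<^sup>2) \<partial>leb T)"
      by (rule nn_integral_liminf) auto
    also have "\<dots> \<le> ennreal (((1/2)^j)\<^sup>2)"
    proof (rule Liminf_le)
      show "\<forall>\<^sub>F i in sequentially. (\<integral>\<^sup>+t. ennreal ((S (r i) t - S N t)\<^sup>2) \<partial>leb T) \<le> ennreal (((1/2)^j)\<^sup>2)"
        using eventually_ge_at_top[of j]
      proof eventually_elim
        case (elim i)
        hence "r i \<ge> r j" using rmono by (simp add: monoD)
        hence lt: "L2_norm T (\<lambda>t. S (r i) t - S N t) < (1/2)^j"
          using r(1)[of j] that unfolding P_def by blast
        have "(\<lambda>t. S (r i) t - S N t) \<in> L2 T" using S by simp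
        hence "(\<integral>\<^sup>+t. ennreal ((S (r i) t - S N t)\<^sup>2) \<partial>leb T)
            = ennreal (\<integral>t. (S (r i) t - S N t)\<^sup>2 \<partial>leb T)"
          by (intro nn_integral_eq_integral) (auto simp: L2_def)
        also have "(\<integral>t. (S (r i) t - S N t)\<^sup>2 \<partial>leb T) = (L2_norm T (\<lambda>t. S (r i) t - S N t))\<^sup>2"
          unfolding L2_norm_power2 by (simp add: L2_inner_def power2_eq_square)
        finally show ?case using lt by (simp add: ennreal_leI power_mono)
      qed
    qed simp
    finally show ?thesis .
  qed
  have dL2: "(\<lambda>t. g t - S N t) \<in> L2 T" if "N \<ge> r 0" for N
    unfolding L2_def
  proof safe
    show "integrable (leb T) (\<lambda>t. (g t - S N t)\<^sup>2)"
    proof (rule integrableI_bounded)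
      have "(\<integral>\<^sup>+t. ennreal (norm ((g t - S N t)\<^sup>2)) \<partial>leb T) \<le> ennreal (((1/2)^0)\<^sup>2)"
        using key[OF that] by simp
      also have "\<dots> < \<infinity>" by simp
      finally show "(\<integral>\<^sup>+t. ennreal (norm ((g t - S N t)\<^sup>2)) \<partial>leb T) < \<infinity>" .
    qed auto
  qed auto
  have gL2: "g \<in> L2 T"
    using L2_add[OF dL2[of "r 0"] S[of "r 0"]] by simp
  have bd: "L2_norm T (\<lambda>t. g t - S N t) \<le> (1/2)^j" if "N \<ge> r j" for N j
  proof (rule power2_le_imp_le)
    have "ennreal ((L2_norm T (\<lambda>t. g t - S N t))\<^sup>2) = (\<integral>\<^sup>+t. ennreal ((g t - S N t)\<^sup>2) \<partial>leb T)"
      unfolding L2_norm_power2 L2_inner_def power2_eq_square[symmetric]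
      using gL2 S[of N] L2_diff[OF gL2 S[of N]]
      by (intro nn_integral_eq_integral[symmetric]) (auto simp: L2_def)
    also have "\<dots> \<le> ennreal (((1/2)^j)\<^sup>2)" by (rule key[OF that])
    finally show "(L2_norm T (\<lambda>t. g t - S N t))\<^sup>2 \<le> ((1/2)^j)\<^sup>2"
      by (simp add: ennreal_le_iff)
  qed simp
  have "(\<lambda>N. L2_norm T (\<lambda>t. g t - S N t)) \<longlonglongrightarrow> 0"
  proof (rule LIMSEQ_I)
    fix e :: real assume "e > 0"
    then obtain j where j: "(1/2::real)^j < e" using real_arch_pow_inv[of e "1/2"] by auto
    show "\<exists>no. \<forall>n\<ge>no. norm (L2_norm T (\<lambda>t. g t - S n t) - 0) < e"
      using bd[of j] j by (intro exI[of _ "r j"]) (auto intro: le_less_trans)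
  qed
  thus ?thesis using gL2 by blast
qed

section \<open>Orthogonal series and the modified Hilbert transformation\<close>

text \<open>Squared norm T / 2 instead of 1, so that the factor 2 / T of the Fourier coefficients is
  the matching normalisation. Sines and cosines share everything proved about it.\<close>

definition orthogonal_system :: "real \<Rightarrow> (nat \<Rightarrow> real \<Rightarrow> real) \<Rightarrow> bool" where
  "orthogonal_system T e \<longleftrightarrow> (\<forall>k. e k \<in> L2 T) \<and>
    (\<forall>k l. L2_inner T (e k) (e l) = (if k = l then T / 2 else 0))"

lemma orthogonal_systemD:
  assumes "orthogonal_system T e"
  shows "e k \<in> L2 T" "L2_inner T (e k) (e l) = (if k = l then T / 2 else 0)"
  using assms unfolding orthogonal_system_def by blast+

lemma orthogonal_sum_inner:
  assumes "orthogonal_system T e" "finite A"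
  shows "L2_inner T (\<lambda>t. \<Sum>k\<in>A. c k * e k t) (\<lambda>t. \<Sum>k\<in>A. c k * e k t) = T / 2 * (\<Sum>k\<in>A. (c k)\<^sup>2)"
proof -
  note e = orthogonal_systemD[OF assms(1)]
  have "L2_inner T (\<lambda>t. \<Sum>k\<in>A. c k * e k t) (\<lambda>t. \<Sum>k\<in>A. c k * e k t)
      = (\<Sum>k\<in>A. c k * (\<Sum>l\<in>A. c l * (if k = l then T / 2 else 0)))"
    by (simp add: e L2_inner_sum_left L2_inner_sum_right)
  also have "\<dots> = (\<Sum>k\<in>A. c k * (c k * (T / 2)))"
    using assms(2) by (intro sum.cong refl) (simp add: if_distrib cong: if_cong)
  finally show ?thesis by (simp add: sum_distrib_left power2_eq_square mult_ac)
qed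

lemma Bessel:
  assumes "orthogonal_system T e" "finite A" "w \<in> L2 T" "T > 0"
  shows "(\<Sum>k\<in>A. (2 / T * L2_inner T w (e k))\<^sup>2) \<le> 2 / T * (L2_norm T w)\<^sup>2"
proof -
  note e = orthogonal_systemD[OF assms(1)]
  define c where "c k = 2 / T * L2_inner T w (e k)" for k
  let ?p = "\<lambda>t. \<Sum>k\<in>A. c k * e k t"
  have p: "?p \<in> L2 T" using e by simp
  have wp: "L2_inner T w ?p = T / 2 * (\<Sum>k\<in>A. (c k)\<^sup>2)"
  proof -
    have "L2_inner T w (e k) = T / 2 * c k" for k using assms(4) unfolding c_def by simp
    hence "(\<Sum>k\<in>A. c k * L2_inner T w (e k)) = T / 2 * (\<Sum>k\<in>A. (c k)\<^sup>2)"
      by (simp only: sum_distrib_left power2_eq_square mult_ac)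
    thus ?thesis using e assms(3) by (simp add: L2_inner_sum_right)
  qed
  have "0 \<le> L2_inner T (\<lambda>t. w t - ?p t) (\<lambda>t. w t - ?p t)" by simp
  also have "\<dots> = L2_inner T w w - 2 * L2_inner T w ?p + L2_inner T ?p ?p"
    using assms(3) p by (simp add: L2_inner_diff_left L2_inner_diff_right L2_inner_commute[of T ?p w])
  also have "\<dots> = (L2_norm T w)\<^sup>2 - T / 2 * (\<Sum>k\<in>A. (c k)\<^sup>2)"
    by (simp add: wp orthogonal_sum_inner[OF assms(1,2)] L2_norm_power2)
  finally show ?thesis using assms(4) unfolding c_def by (simp add: field_simps)
qed

lemma Bessel_summable:
  assumes "orthogonal_system T e" "w \<in> L2 T" "T > 0"
  shows "summable (\<lambda>k. (2 / T * L2_inner T w (e k))\<^sup>2)"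
  by (rule summableI_nonneg_bounded[where x = "2 / T * (L2_norm T w)\<^sup>2"])
     (use Bessel[OF assms(1) _ assms(2,3)] in auto)

text \<open>Orthogonality makes the squared norm of a block of the series T / 2 times its sum of
  squared coefficients, so the partial sums are Cauchy and the choice in \<open>L2_suminf\<close>
  has a witness.\<close>

lemma L2_suminf_orthogonal:
  assumes e: "orthogonal_system T e" and c: "summable (\<lambda>k. (c k)\<^sup>2)" and T: "T > 0"
  defines "g \<equiv> L2_suminf T (\<lambda>k t. c k * e k t)"
  shows "g \<in> L2 T"
    and "(\<lambda>N. L2_norm T (\<lambda>t. g t - (\<Sum>k<N. c k * e k t))) \<longlonglongrightarrow> 0"
proof -
  note E = orthogonal_systemD[OF e]
  have nrm: "L2_norm T (\<lambda>t. (\<Sum>k<n. c k * e k t) - (\<Sum>k<m. c k * e k t)) = sqrt (T / 2 * (\<Sum>k\<in>{m..<n}. (c k)\<^sup>2))"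
    if "m \<le> n" for m n
  proof -
    have "(\<Sum>k<n. c k * e k t) - (\<Sum>k<m. c k * e k t) = (\<Sum>k\<in>{m..<n}. c k * e k t)" for t
      using sum_diff_nat_ivl[of 0 m n "\<lambda>k. c k * e k t"] that by (simp add: atLeast0LessThan)
    thus ?thesis unfolding L2_norm_def by (simp add: orthogonal_sum_inner[OF e])
  qed
  have "\<exists>g\<in>L2 T. (\<lambda>N. L2_norm T (\<lambda>t. g t - (\<Sum>k<N. c k * e k t))) \<longlonglongrightarrow> 0"
  proof (rule L2_complete)
    show "(\<lambda>t. \<Sum>k<N. c k * e k t) \<in> L2 T" for N using E by simp
    fix \<epsilon> :: real assume "\<epsilon> > 0"
    hence "2 / T * \<epsilon>\<^sup>2 > 0" using T by simp
    then obtain N0 where N0: "\<And>m n. m \<ge> N0 \<Longrightarrow> norm (\<Sum>k\<in>{m..<n}. (c k)\<^sup>2) < 2 / T * \<epsilon>\<^sup>2"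
      using c unfolding summable_Cauchy by blast
    have lt: "L2_norm T (\<lambda>t. (\<Sum>k<n. c k * e k t) - (\<Sum>k<m. c k * e k t)) < \<epsilon>" if "m \<ge> N0" "m \<le> n" for m n
    proof -
      have "(\<Sum>k\<in>{m..<n}. (c k)\<^sup>2) < 2 / T * \<epsilon>\<^sup>2" using N0[OF that(1), of n] by simp
      hence "T / 2 * (\<Sum>k\<in>{m..<n}. (c k)\<^sup>2) < \<epsilon>\<^sup>2" using T by (simp add: field_simps)
      hence "sqrt (T / 2 * (\<Sum>k\<in>{m..<n}. (c k)\<^sup>2)) < sqrt (\<epsilon>\<^sup>2)" by (rule real_sqrt_less_mono)
      thus ?thesis using nrm[OF that(2)] \<open>\<epsilon> > 0\<close> by simp
    qed
    show "\<exists>N0. \<forall>m\<ge>N0. \<forall>n\<ge>N0. L2_norm T (\<lambda>t. (\<Sum>k<m. c k * e k t) - (\<Sum>k<n. c k * e k t)) < \<epsilon>"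
    proof (intro exI allI impI)
      fix m n assume mn: "m \<ge> N0" "n \<ge> N0"
      show "L2_norm T (\<lambda>t. (\<Sum>k<m. c k * e k t) - (\<Sum>k<n. c k * e k t)) < \<epsilon>"
      proof (cases "m \<le> n")
        case True
        from lt[OF mn(1) True] show ?thesis by (subst L2_norm_minus_commute)
      next
        case False
        with lt[OF mn(2), of m] show ?thesis by simp
      qed
    qed
  qed
  hence "g \<in> L2 T \<and> (\<lambda>N. L2_norm T (\<lambda>t. g t - (\<Sum>k<N. c k * e k t))) \<longlonglongrightarrow> 0"
    unfolding g_def L2_suminf_def by (intro someI_ex[where P="\<lambda>g. g \<in> L2 T \<and> (\<lambda>N. L2_norm T (\<lambda>t. g t - (\<Sum>k<N. c k * e k t))) \<longlonglongrightarrow> 0"]) blast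
  thus "g \<in> L2 T" "(\<lambda>N. L2_norm T (\<lambda>t. g t - (\<Sum>k<N. c k * e k t))) \<longlonglongrightarrow> 0" by auto
qed

lemma L2_suminf_inner_sums:
  assumes e: "orthogonal_system T e" and c: "summable (\<lambda>k. (c k)\<^sup>2)" and T: "T > 0" and w: "w \<in> L2 T"
  shows "(\<lambda>k. c k * L2_inner T w (e k)) sums L2_inner T w (L2_suminf T (\<lambda>k t. c k * e k t))"
proof -
  note E = orthogonal_systemD[OF e]
  have "(\<lambda>N. L2_inner T (\<lambda>t. \<Sum>k<N. c k * e k t) w) \<longlonglongrightarrow> L2_inner T (L2_suminf T (\<lambda>k t. c k * e k t)) w"
    using E w by (intro L2_inner_tendsto L2_suminf_orthogonal[OF e c T]) auto
  moreover have "L2_inner T (\<lambda>t. \<Sum>k<N. c k * e k t) w = (\<Sum>k<N. c k * L2_inner T w (e k))" for N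
    using E w by (simp add: L2_inner_sum_left L2_inner_commute[of T w])
  ultimately show ?thesis
    unfolding sums_def by (simp add: L2_inner_commute[of T w])
qed

section \<open>Trigonometric integrals and orthogonality of the modes\<close>

lemma L2_cos [simp]: "(\<lambda>t. cos (a * t)) \<in> L2 T" and L2_sin [simp]: "(\<lambda>t. sin (a * t)) \<in> L2 T"
  by (auto intro!: L2_continuous continuous_intros)

text \<open>The indicator stays inside an integral over (0, T), so that one statement serves
  subintervals, mesh cells and the whole interval.\<close>

lemma integral_leb_FTC:
  fixes F f :: "real \<Rightarrow> real"
  assumes "a \<le> b" "0 \<le> a" "b \<le> T" "\<And>t. t \<in> {a..b} \<Longrightarrow> (F has_real_derivative f t) (at t)"
    "continuous_on {a..b} f"
  shows "(\<integral>t. f t * indicator {a<..<b} t \<partial>leb T) = F b - F a"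
    and "integrable (leb T) (\<lambda>t. f t * indicator {a<..<b} t)"
proof -
  have sub: "{0<..<T} \<inter> {a<..<b} = {a<..<b}" using assms by auto
  have int: "integrable (lebesgue_on {a<..<b}) f"
  proof -
    have "set_integrable lebesgue {a..b} f"
      using assms(5) by (rule absolutely_integrable_continuous_real)
    hence "set_integrable lebesgue {a<..<b} f" by (rule set_integrable_subset) auto
    thus ?thesis unfolding set_integrable_def by (subst integrable_restrict_space) auto
  qed
  have eq: "indicator {0<..<T} t *\<^sub>R (f t * indicator {a<..<b} t) = indicator {a<..<b} t *\<^sub>R f t" for t
    using sub by (auto split: split_indicator)
  show "integrable (leb T) (\<lambda>t. f t * indicator {a<..<b} t)"
    using int by (simp add: integrable_restrict_space eq del: real_scaleR_def)
  have "(\<integral>t. f t * indicator {a<..<b} t \<partial>leb T) = (\<integral>t. f t \<partial>lebesgue_on {a<..<b})"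
    by (simp add: integral_restrict_space eq del: real_scaleR_def)
  also have "\<dots> = integral {a<..<b} f"
    by (rule lebesgue_integral_eq_integral[OF int]) auto
  also have "\<dots> = integral {a..b} f"
    by (rule integral_open_interval_real[symmetric])
  also have "\<dots> = F b - F a"
    using assms by (intro integral_unique fundamental_theorem_of_calculus)
      (auto simp: has_real_derivative_iff_has_vector_derivative[symmetric] intro: has_field_derivative_at_within)
  finally show "(\<integral>t. f t * indicator {a<..<b} t \<partial>leb T) = F b - F a" .
qed

lemma integral_leb_FTC_full:
  fixes F f :: "real \<Rightarrow> real"
  assumes "0 \<le> T" "\<And>t. t \<in> {0..T} \<Longrightarrow> (F has_real_derivative f t) (at t)" "continuous_on {0..T} f"
  shows "(\<integral>t. f t \<partial>leb T) = F T - F 0"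
proof -
  have "(\<integral>t. f t \<partial>leb T) = (\<integral>t. f t * indicator {0<..<T} t \<partial>leb T)"
    by (rule leb_integral_cong) auto
  also have "\<dots> = F T - F 0" using assms by (intro integral_leb_FTC) auto
  finally show ?thesis .
qed

lemma integral_leb_cos:
  assumes "T > 0" "a \<noteq> 0" shows "(\<integral>t. cos (a * t) \<partial>leb T) = sin (a * T) / a"
proof -
  have "(\<integral>t. cos (a * t) \<partial>leb T) = sin (a * T) / a - sin (a * 0) / a"
    using assms by (intro integral_leb_FTC_full) (auto intro!: derivative_eq_intros continuous_intros)
  thus ?thesis by simp
qed

definition freq :: "real \<Rightarrow> nat \<Rightarrow> real" where
  "freq T k = (pi / 2 + real k * pi) / T"

lemma freq_pos: "T > 0 \<Longrightarrow> freq T k > 0"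
  unfolding freq_def by (intro divide_pos_pos add_pos_nonneg) auto

lemma sin_mode_eq: "sin_mode T k t = sin (freq T k * t)"
  and cos_mode_eq: "cos_mode T k t = cos (freq T k * t)"
  unfolding sin_mode_def cos_mode_def freq_def by (simp_all add: field_simps)

lemma sin_mode_fun: "sin_mode T k = (\<lambda>t. sin (freq T k * t))"
  and cos_mode_fun: "cos_mode T k = (\<lambda>t. cos (freq T k * t))"
  by (auto simp: sin_mode_eq cos_mode_eq)

text \<open>Differences and sums of two frequencies are integer multiples of pi / T, so the
  primitive sin (a t) / a vanishes at both ends unless a = 0.\<close>

lemma sin_mode_cos_mode_products:
  assumes "T > 0"
  shows "(\<integral>t. cos ((freq T k - freq T l) * t) \<partial>leb T) = (if k = l then T else 0)"
    "(\<integral>t. cos ((freq T k + freq T l) * t) \<partial>leb T) = 0"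
proof -
  show "(\<integral>t. cos ((freq T k - freq T l) * t) \<partial>leb T) = (if k = l then T else 0)"
  proof (cases "k = l")
    case False
    hence ne: "freq T k - freq T l \<noteq> 0" using assms unfolding freq_def by (auto simp: field_simps)
    have "(freq T k - freq T l) * T = of_int (int k - int l) * pi"
      using assms unfolding freq_def by (simp add: field_simps)
    hence "sin ((freq T k - freq T l) * T) = 0" by (metis sin_zero_iff_int2)
    thus ?thesis using integral_leb_cos[OF assms ne] False by simp
  qed (use assms in \<open>simp add: measure_restrict_space\<close>)
  have ne: "freq T k + freq T l \<noteq> 0" using freq_pos[OF assms, of k] freq_pos[OF assms, of l] by simp
  have "(freq T k + freq T l) * T = of_int (int k + int l + 1) * pi"
    using assms unfolding freq_def by (simp add: field_simps)
  hence "sin ((freq T k + freq T l) * T) = 0" by (metis sin_zero_iff_int2)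
  thus "(\<integral>t. cos ((freq T k + freq T l) * t) \<partial>leb T) = 0" using integral_leb_cos[OF assms ne] by simp
qed

lemma orthogonal_cos_mode:
  assumes "T > 0" shows "orthogonal_system T (cos_mode T)"
  unfolding orthogonal_system_def
proof safe
  show "cos_mode T k \<in> L2 T" for k unfolding cos_mode_fun by simp
  fix k l
  have "L2_inner T (cos_mode T k) (cos_mode T l)
     = (\<integral>t. (1/2) * cos ((freq T k - freq T l) * t) + (1/2) * cos ((freq T k + freq T l) * t) \<partial>leb T)"
    unfolding L2_inner_def cos_mode_fun cos_times_cos by (simp add: algebra_simps add_divide_distrib)
  also have "\<dots> = (1/2) * (if k = l then T else 0) + (1/2) * 0"
    using assms 
    by (subst Bochner_Integration.integral_add) (simp_all add: sin_mode_cos_mode_products L2_integrable[OF L2_cos])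
  finally show "L2_inner T (cos_mode T k) (cos_mode T l) = (if k = l then T / 2 else 0)"
    by (simp split: if_splits)
qed

lemma orthogonal_sin_mode:
  assumes "T > 0" shows "orthogonal_system T (sin_mode T)"
  unfolding orthogonal_system_def
proof safe
  show "sin_mode T k \<in> L2 T" for k unfolding sin_mode_fun by simp
  fix k l
  have "L2_inner T (sin_mode T k) (sin_mode T l)
     = (\<integral>t. (1/2) * cos ((freq T k - freq T l) * t) - (1/2) * cos ((freq T k + freq T l) * t) \<partial>leb T)"
    unfolding L2_inner_def sin_mode_fun sin_times_sin by (simp add: algebra_simps diff_divide_distrib)
  also have "\<dots> = (1/2) * (if k = l then T else 0) - (1/2) * 0"
    using assms 
    by (subst Bochner_Integration.integral_diff) (simp_all add: sin_mode_cos_mode_products L2_integrable[OF L2_cos])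
  finally show "L2_inner T (sin_mode T k) (sin_mode T l) = (if k = l then T / 2 else 0)"
    by (simp split: if_splits)
qed

lemma fourier_cos_eq: "fourier_cos T w k = 2 / T * L2_inner T w (cos_mode T k)"
  and fourier_sin_eq: "fourier_sin T w k = 2 / T * L2_inner T w (sin_mode T k)"
  unfolding fourier_cos_def fourier_sin_def L2_inner_def by simp_all

section \<open>The transformation and its inverse as pairings\<close>

lemma modHilbert_L2:
  assumes "T > 0" "v \<in> L2 T" shows "modHilbert T v \<in> L2 T"
  unfolding modHilbert_def fourier_sin_eq
  using assms by (intro L2_suminf_orthogonal(1) orthogonal_cos_mode Bessel_summable orthogonal_sin_mode)

lemma modHilbert_inv_L2:
  assumes "T > 0" "v \<in> L2 T" shows "modHilbert_inv T v \<in> L2 T"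
  unfolding modHilbert_inv_def fourier_cos_eq
  using assms by (intro L2_suminf_orthogonal(1) orthogonal_cos_mode Bessel_summable orthogonal_sin_mode)

lemma inner_modHilbert_sums:
  assumes T: "T > 0" and "v \<in> L2 T" "w \<in> L2 T"
  shows "(\<lambda>k. T / 2 * (fourier_cos T w k * fourier_sin T v k)) sums L2_inner T w (modHilbert T v)"
proof -
  have "(\<lambda>k. fourier_sin T v k * L2_inner T w (cos_mode T k)) sums L2_inner T w (modHilbert T v)"
    unfolding modHilbert_def fourier_sin_eq
    using assms by (intro L2_suminf_inner_sums orthogonal_cos_mode Bessel_summable orthogonal_sin_mode)
  thus ?thesis using T by (simp add: fourier_cos_eq mult_ac)
qed

text \<open>Both pairings expand into the same series of products of cosine coefficients of w and
  sine coefficients of v; the inverse acts as the adjoint.\<close>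

lemma inner_modHilbert_inv:
  assumes T: "T > 0" and "v \<in> L2 T" "w \<in> L2 T"
  shows "L2_inner T (modHilbert_inv T w) v = L2_inner T w (modHilbert T v)"
proof -
  have "(\<lambda>k. fourier_cos T w k * L2_inner T v (sin_mode T k)) sums L2_inner T v (modHilbert_inv T w)"
    unfolding modHilbert_inv_def fourier_cos_eq
    using assms by (intro L2_suminf_inner_sums orthogonal_cos_mode Bessel_summable orthogonal_sin_mode)
  hence "(\<lambda>k. T / 2 * (fourier_cos T w k * fourier_sin T v k)) sums L2_inner T v (modHilbert_inv T w)"
    using T by (simp add: fourier_sin_eq mult_ac)
  from sums_unique2[OF this inner_modHilbert_sums[OF assms]] show ?thesis
    by (simp add: L2_inner_commute)
qed

section \<open>Trigonometric estimates\<close>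

definition sinc :: "real \<Rightarrow> real" where "sinc x = sin x / x"

text \<open>The sine is concave on [0, pi / 2] and lies above its chord.\<close>

lemma sinc_ge_Jordan:
  assumes "0 < x" "x \<le> pi / 2" shows "2 / pi \<le> sinc x"
proof -
  have "concave_on {0..pi/2} sin"
    by (rule f''_le0_imp_concave[where f' = cos and f'' = "\<lambda>x. - sin x"])
       (auto intro!: derivative_eq_intros sin_ge_zero)
  hence "sin ((1 - 2 * x / pi) *\<^sub>R 0 + (2 * x / pi) *\<^sub>R (pi / 2)) \<ge> (1 - 2 * x / pi) * sin 0 + (2 * x / pi) * sin (pi / 2)"
    by (rule concave_onD) (use assms in \<open>auto simp: field_simps\<close>)
  hence "2 * x / pi \<le> sin x" by simp
  thus ?thesis using assms unfolding sinc_def by (simp add: field_simps)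
qed

lemma sinc_le_1:
  assumes "0 < x" shows "sinc x \<le> 1"
  using sin_x_le_x[of x] assms unfolding sinc_def by (simp add: field_simps)

lemma sinc_ge_taylor:
  assumes "0 < x" shows "1 - x\<^sup>2 / 6 \<le> sinc x"
proof -
  have s: "(\<Sum>m<3. sin_coeff m * x ^ m) = x"
    by (simp add: numeral_3_eq_3 sin_coeff_def)
  have "\<bar>sin x - x\<bar> \<le> inverse (fact 3) * \<bar>x\<bar> ^ 3"
    using Maclaurin_sin_bound[of x 3] unfolding s .
  hence "\<bar>sin x - x\<bar> \<le> x ^ 3 / 6" using assms by (simp add: fact_numeral field_simps)
  hence "sin x \<ge> x - x ^ 3 / 6" by linarith
  thus ?thesis using assms unfolding sinc_def by (simp add: field_simps power2_eq_square power3_eq_cube)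
qed

section \<open>The symbol of the aliased form\<close>

text \<open>Since sin^2 is even with period pi, this is sinc^2 at x + pi j minus sinc^2 at pi (j +
  1) - x: the two aliases of x in the j-th block of 2 n frequencies.\<close>

definition alias_term :: "real \<Rightarrow> nat \<Rightarrow> real" where
  "alias_term x j = (sin x)\<^sup>2 * (1 / (x + pi * real j)\<^sup>2 - 1 / (pi * real (Suc j) - x)\<^sup>2)"

definition alias_symbol :: "real \<Rightarrow> real" where
  "alias_symbol x = (\<Sum>j. alias_term x j)"

lemma alias_term_nonneg:
  assumes "0 < x" "x < pi / 2" shows "0 \<le> alias_term x j"
proof -
  have pj: "0 \<le> pi * real j" by simp
  hence pos: "0 < x + pi * real j" using assms by linarith
  have "x + pi * real j \<le> pi * real (Suc j) - x" using assms by (simp add: algebra_simps)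
  hence le: "(x + pi * real j)\<^sup>2 \<le> (pi * real (Suc j) - x)\<^sup>2" using pos by (intro power_mono) auto
  have "0 < (x + pi * real j)\<^sup>2" using pos by (rule zero_less_power)
  hence "1 / (pi * real (Suc j) - x)\<^sup>2 \<le> 1 / (x + pi * real j)\<^sup>2"
    using le by (intro frac_le) auto
  thus ?thesis unfolding alias_term_def by (intro mult_nonneg_nonneg) auto
qed

text \<open>Lowering x + pi (j + 1) to pi (j + 1) and raising pi (j + 2) - x to pi (j + 2) enlarges
  the difference and makes the majorant telescope.\<close>

lemma alias_term_Suc_le:
  assumes "0 < x" "x < pi / 2"
  shows "alias_term x (Suc j) \<le> (sin x)\<^sup>2 * (1 / (pi * real (Suc j))\<^sup>2 - 1 / (pi * real (Suc (Suc j)))\<^sup>2)"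
proof -
  have pj: "0 < pi * real (Suc j)" "pi \<le> pi * real (Suc j)" by simp_all
  have "1 / (x + pi * real (Suc j))\<^sup>2 \<le> 1 / (pi * real (Suc j))\<^sup>2"
    using assms pj(1) by (intro frac_le power_mono zero_less_power) auto
  moreover have pos: "0 < pi * real (Suc (Suc j)) - x"
    using assms pj by (simp add: algebra_simps)
  have "1 / (pi * real (Suc (Suc j)))\<^sup>2 \<le> 1 / (pi * real (Suc (Suc j)) - x)\<^sup>2"
    using assms pos by (intro frac_le power_mono zero_less_power) auto
  ultimately show ?thesis unfolding alias_term_def by (intro mult_left_mono) auto
qed

lemma alias_majorant_sums:
  "(\<lambda>j. (sin x)\<^sup>2 * (1 / (pi * real (Suc j))\<^sup>2 - 1 / (pi * real (Suc (Suc j)))\<^sup>2)) sums ((sin x)\<^sup>2 / pi\<^sup>2)"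
proof -
  have "(\<lambda>j. 1 / (pi * real (Suc j))\<^sup>2) \<longlonglongrightarrow> 0"
  proof -
    have "(\<lambda>j. (1 / pi * inverse (real (Suc j)))\<^sup>2) \<longlonglongrightarrow> (1 / pi * 0)\<^sup>2"
      by (intro tendsto_intros LIMSEQ_inverse_real_of_nat)
    thus ?thesis by (simp add: field_simps power_mult_distrib)
  qed
  from sums_mult[OF telescope_sums'[OF this], of "(sin x)\<^sup>2"] show ?thesis by simp
qed

lemma alias_term_summable:
  assumes "0 < x" "x < pi / 2" shows "summable (alias_term x)"
proof -
  have "summable (\<lambda>j. alias_term x (Suc j))"
    by (rule summable_comparison_test'[OF sums_summable[OF alias_majorant_sums[of x]], of 0])
       (use alias_term_Suc_le[OF assms] alias_term_nonneg[OF assms] in auto)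
  thus ?thesis by (subst (asm) summable_Suc_iff)
qed

lemma alias_symbol_sums:
  assumes "0 < x" "x < pi / 2" shows "alias_term x sums alias_symbol x"
  unfolding alias_symbol_def using alias_term_summable[OF assms] by (rule summable_sums)

lemma alias_term_0:
  assumes "0 < x" "x < pi / 2"
  shows "alias_term x 0 = (sinc x)\<^sup>2 * (1 - x\<^sup>2 / (pi - x)\<^sup>2)"
  using assms unfolding alias_term_def sinc_def by (simp add: field_simps)

text \<open>All terms are nonnegative, and the one with j = 0 already carries the order of vanishing
  at x = pi / 2.\<close>

lemma alias_symbol_ge:
  assumes "0 < x" "x < pi / 2"
  shows "(sinc x)\<^sup>2 * (1 - x\<^sup>2 / (pi - x)\<^sup>2) \<le> alias_symbol x"
proof -
  have "sum (alias_term x) {..<1} \<le> alias_symbol x"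
    unfolding alias_symbol_def
    by (rule sum_le_suminf[OF alias_term_summable[OF assms]]) (use alias_term_nonneg[OF assms] in auto)
  thus ?thesis using alias_term_0[OF assms] by simp
qed

lemma alias_symbol_le:
  assumes "0 < x" "x < pi / 2"
  shows "alias_symbol x \<le> (sinc x)\<^sup>2 + (sin x)\<^sup>2 / pi\<^sup>2"
proof -
  have "alias_symbol x = alias_term x 0 + (\<Sum>j. alias_term x (Suc j))"
    unfolding alias_symbol_def using suminf_split_head[OF alias_term_summable[OF assms]] by simp
  also have "(\<Sum>j. alias_term x (Suc j)) \<le> (sin x)\<^sup>2 / pi\<^sup>2"
    unfolding sums_unique[OF alias_majorant_sums[of x]]
    by (rule suminf_le[OF alias_term_Suc_le[OF assms] _ sums_summable[OF alias_majorant_sums]])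
       (simp add: summable_Suc_iff alias_term_summable[OF assms])
  also have "alias_term x 0 \<le> (sinc x)\<^sup>2"
    unfolding alias_term_0[OF assms] by (simp add: mult_left_le)
  finally show ?thesis by simp
qed

text \<open>This quadratic contact with 1 makes the consistency error of the low modes small; the
  form of the bound lets x^2 cancel against 1 / omega^2 later.\<close>

lemma alias_symbol_near_1:
  assumes "0 < x" "x < pi / 2"
  shows "\<bar>1 - alias_symbol x\<bar> \<le> x\<^sup>2"
proof -
  have s0: "0 \<le> sinc x" using sinc_ge_Jordan[of x] assms by (simp add: sinc_def sin_ge_zero)
  have s1: "(sinc x)\<^sup>2 \<le> 1" using s0 sinc_le_1[of x] assms by (simp add: power_le_one)
  have x2: "x\<^sup>2 \<le> 2 * 2" using assms pi_less_4 unfolding power2_eq_square by (intro mult_mono) auto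
  have s2: "(sinc x)\<^sup>2 \<ge> 1 - x\<^sup>2 / 3"
  proof -
    have "(1 - x\<^sup>2 / 6)\<^sup>2 \<le> (sinc x)\<^sup>2"
      using sinc_ge_taylor[of x] assms x2 by (intro power_mono) auto
    moreover have "(1 - x\<^sup>2 / 6)\<^sup>2 = 1 - x\<^sup>2 / 3 + (x\<^sup>2 / 6)\<^sup>2" by (simp add: power2_diff)
    ultimately show ?thesis using zero_le_power2[of "x\<^sup>2 / 6"] by linarith
  qed
  define p where "p = 1 - x\<^sup>2 / (pi - x)\<^sup>2"
  have xpi: "x\<^sup>2 \<le> (pi - x)\<^sup>2" using assms by (intro power_mono) auto
  have p0: "0 \<le> p" "p \<le> 1" using xpi assms unfolding p_def by (auto simp: field_simps)
  \<comment> \<open>The resulting constant 4 / 9 is below 1 / 2; together with the Taylor loss 1 / 3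
    the total 5 / 6 stays below 1.\<close>
  have "3 / 2 \<le> pi - x" using assms pi_gt3 by auto
  hence "(3 / 2)\<^sup>2 \<le> (pi - x)\<^sup>2" by (intro power_mono) auto
  hence "x\<^sup>2 / (pi - x)\<^sup>2 \<le> x\<^sup>2 / (3 / 2)\<^sup>2" by (intro frac_le) auto
  hence "x\<^sup>2 / (pi - x)\<^sup>2 \<le> x\<^sup>2 * (4 / 9)" by (simp add: power_divide)
  hence p1: "p \<ge> 1 - x\<^sup>2 / 2" unfolding p_def using zero_le_power2[of x] by linarith
  have "1 - x\<^sup>2 \<le> p - x\<^sup>2 / 3 * p"
  proof -
    have "x\<^sup>2 / 3 * p \<le> x\<^sup>2 / 3 * 1" using p0 by (intro mult_left_mono) auto
    thus ?thesis using p1 zero_le_power2[of x] by linarith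
  qed
  also have "\<dots> = (1 - x\<^sup>2 / 3) * p" by (simp add: algebra_simps)
  also have "\<dots> \<le> (sinc x)\<^sup>2 * p" using s2 p0 by (intro mult_right_mono)
  also have "\<dots> \<le> alias_symbol x" using alias_symbol_ge[OF assms] unfolding p_def .
  finally have lo: "1 - x\<^sup>2 \<le> alias_symbol x" .
  have "(sin x)\<^sup>2 / pi\<^sup>2 \<le> x\<^sup>2 / 1"
  proof (rule frac_le)
    show "(sin x)\<^sup>2 \<le> x\<^sup>2" using abs_sin_x_le_abs_x[of x] by (simp add: abs_le_square_iff)
    show "1 \<le> pi\<^sup>2" using pi_gt3 by (intro one_le_power) auto
  qed auto
  with alias_symbol_le[OF assms] s1 lo show ?thesis by (auto simp: abs_le_iff)
qed

section \<open>Discrete cosine and sine transforms of type IV\<close>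

text \<open>Half of the phase that mode k gains over one cell. Thus
  \<open>halfang n k * real (2 * i + 1)\<close> is the phase of mode k at the midpoint of cell
  i.\<close>

definition halfang :: "nat \<Rightarrow> nat \<Rightarrow> real" where
  "halfang n k = real (2 * k + 1) * pi / (4 * real n)"

text \<open>Each product 2 sin x cos ((2 i + 1) x) is a difference of sines, and the sum
  telescopes.\<close>

lemma sum_cos_odd_multiples:
  "2 * sin x * (\<Sum>i<n. cos (x * real (2 * i + 1))) = sin (2 * real n * x)"
proof (induction n)
  case (Suc n)
  have "sin (2 * real (Suc n) * x) - sin (2 * real n * x) = 2 * sin x * cos (x * real (2 * n + 1))"
  proof -
    have "(2 * real (Suc n) * x - 2 * real n * x) / 2 = x"
      "(2 * real (Suc n) * x + 2 * real n * x) / 2 = x * real (2 * n + 1)"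
      by (simp_all add: algebra_simps add_divide_distrib)
    thus ?thesis by (simp only: sin_diff_sin)
  qed
  thus ?case using Suc by (simp add: distrib_left)
qed simp

text \<open>Product-to-sum formulas leave cosine sums at the difference and the sum of the two
  angles. There 2 n x is an integer multiple of pi while sin x is nonzero, so the closed form
  vanishes unless the difference is 0.\<close>

lemma dtrans_orthogonal:
  assumes "n > 0" "k < n" "l < n" "f = cos \<or> f = sin"
  shows "(\<Sum>i<n. f (halfang n k * real (2 * i + 1)) * f (halfang n l * real (2 * i + 1)))
     = (if k = l then real n / 2 else 0 :: real)"
proof -
  define C where "C x = (\<Sum>i<n. cos (x * real (2 * i + 1)))" for x
  have plus: "C (halfang n k + halfang n l) = 0"
  proof -
    define x where "x = halfang n k + halfang n l"
    have xe: "x = real (k + l + 1) * pi / (2 * real n)" unfolding x_def halfang_def using assms(1) by (simp add: field_simps)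
    have "real (k + l + 1) * pi < 2 * real n * pi"
      using assms by (intro mult_strict_right_mono) auto
    moreover have "0 < real (k + l + 1) * pi" by simp
    ultimately have "0 < x" "x < pi" unfolding xe using assms(1) by (auto simp: field_simps)
    hence "sin x \<noteq> 0" using sin_gt_zero by force
    moreover have "2 * real n * x = real (k + l + 1) * pi" unfolding xe using assms(1) by simp
    hence "sin (2 * real n * x) = 0" by (simp only: sin_npi)
    ultimately show ?thesis using sum_cos_odd_multiples[of x n] unfolding C_def x_def by simp
  qed
  have minus: "C (halfang n k - halfang n l) = (if k = l then real n else 0)"
  proof (cases "k = l")
    case False
    define x where "x = halfang n k - halfang n l"
    have xe: "x = (real k - real l) * pi / (2 * real n)" unfolding x_def halfang_def using assms(1) by (simp add: field_simps)
    have "\<bar>real k - real l\<bar> * pi < 2 * real n * pi"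
      using assms by (intro mult_strict_right_mono) auto
    hence "\<bar>real k - real l\<bar> * pi / (2 * real n) < pi" using assms(1) by (subst pos_divide_less_eq) (auto simp: mult_ac)
    moreover have "\<bar>x\<bar> = \<bar>real k - real l\<bar> * pi / (2 * real n)" unfolding xe by (simp add: abs_mult)
    ultimately have "- pi < x" "x < pi" by linarith+
    moreover have "x \<noteq> 0" unfolding xe using False assms(1) by simp
    ultimately have "sin x \<noteq> 0" using sin_eq_0_pi[of x] by blast
    moreover have "2 * real n * x = real_of_int (int k - int l) * pi" unfolding xe using assms(1) by simp
    hence "sin (2 * real n * x) = 0" by (metis sin_zero_iff_int2)
    ultimately show ?thesis using sum_cos_odd_multiples[of x n] False unfolding C_def x_def by simp
  qed (simp add: C_def)
  have "(\<Sum>i<n. f (halfang n k * real (2 * i + 1)) * f (halfang n l * real (2 * i + 1)))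
      = C (halfang n k - halfang n l) / 2 + (if f = cos then 1 else -1) * (C (halfang n k + halfang n l) / 2)"
    using assms(4)
  proof
    assume [simp]: "f = cos"
    show ?thesis unfolding C_def
      by (simp add: cos_times_cos sum.distrib sum_divide_distrib add_divide_distrib left_diff_distrib distrib_right
           del: of_nat_add of_nat_mult of_nat_Suc)
  next
    assume [simp]: "f = sin"
    have ne: "(sin :: real \<Rightarrow> real) \<noteq> cos"
    proof
      assume "(sin :: real \<Rightarrow> real) = cos"
      from fun_cong[OF this, of 0] show False by simp
    qed
    show ?thesis unfolding C_def
      by (simp add: ne sin_times_sin sum_subtractf sum_divide_distrib diff_divide_distrib left_diff_distrib distrib_right
           del: of_nat_add of_nat_mult of_nat_Suc)
  qed
  thus ?thesis unfolding plus minus by (cases "k = l") simp_all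
qed

text \<open>The index k is not confined to k < n: larger values are the aliases that occur in the
  Fourier series of a step function.\<close>

definition dtrans :: "(real \<Rightarrow> real) \<Rightarrow> nat \<Rightarrow> (nat \<Rightarrow> real) \<Rightarrow> nat \<Rightarrow> real" where
  "dtrans f n a k = 2 / real n * (\<Sum>i<n. a i * f (halfang n k * real (2 * i + 1)))"

abbreviation "dct \<equiv> dtrans cos"
abbreviation "dst \<equiv> dtrans sin"

lemma halfang_symmetric: "halfang n k * real (2 * i + 1) = halfang n i * real (2 * k + 1)"
  unfolding halfang_def by simp

lemma dtrans_inverse:
  assumes "n > 0" "f = cos \<or> f = sin" "k < n"
  shows "dtrans f n (\<lambda>i. \<Sum>l<n. c l * f (halfang n l * real (2 * i + 1))) k = c k"
proof -
  define F where "F l i = f (halfang n l * real (2 * i + 1))" for l i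
  have orth: "(\<Sum>i<n. F l i * F k i) = (if l = k then real n / 2 else 0)" if "l < n" for l
    unfolding F_def by (rule dtrans_orthogonal[OF assms(1) that assms(3,2)])
  have "(\<Sum>i<n. (\<Sum>l<n. c l * F l i) * F k i) = (\<Sum>l<n. c l * (\<Sum>i<n. F l i * F k i))"
    unfolding sum_distrib_right sum_distrib_left mult.assoc by (rule sum.swap)
  also have "\<dots> = (\<Sum>l<n. c l * (if l = k then real n / 2 else 0))"
    by (intro sum.cong refl) (simp add: orth)
  also have "\<dots> = c k * (real n / 2)" using assms(3) by (simp add: if_distrib cong: if_cong)
  finally show ?thesis using assms(1) unfolding dtrans_def F_def by (simp add: field_simps)
qed

text \<open>By \<open>halfang_symmetric\<close> the transform matrix is symmetric, so orthogonality
  of its rows is also orthogonality of its columns.\<close>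

lemma dtrans_expansion:
  assumes "n > 0" "f = cos \<or> f = sin" "i < n"
  shows "a i = (\<Sum>k<n. dtrans f n a k * f (halfang n k * real (2 * i + 1)))"
proof -
  define F where "F l i = f (halfang n l * real (2 * i + 1))" for l i
  have orth: "(\<Sum>k<n. F k j * F k i) = (if j = i then real n / 2 else 0)" if "j < n" for j
    unfolding F_def halfang_symmetric[of n _ i] halfang_symmetric[of n _ j]
    by (rule dtrans_orthogonal[OF assms(1) that assms(3,2)])
  have "(\<Sum>k<n. dtrans f n a k * F k i) = (\<Sum>k<n. \<Sum>j<n. 2 / real n * (a j * (F k j * F k i)))"
    unfolding dtrans_def F_def[symmetric] by (simp add: sum_distrib_left sum_distrib_right mult_ac)
  also have "\<dots> = (\<Sum>j<n. \<Sum>k<n. 2 / real n * (a j * (F k j * F k i)))" by (rule sum.swap)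
  also have "\<dots> = (\<Sum>j<n. 2 / real n * (a j * (if j = i then real n / 2 else 0)))"
    unfolding sum_distrib_left[symmetric] by (intro arg_cong[where f = "\<lambda>z. 2 / real n * z"] sum.cong refl) (simp add: orth)
  also have "\<dots> = a i" using assms(1,3) by (simp add: if_distrib cong: if_cong)
  finally show ?thesis unfolding F_def by simp
qed

lemma dtrans_Parseval:
  assumes "n > 0" "f = cos \<or> f = sin"
  shows "(\<Sum>i<n. (a i)\<^sup>2) = real n / 2 * (\<Sum>k<n. (dtrans f n a k)\<^sup>2)"
proof -
  have "(\<Sum>i<n. (a i)\<^sup>2) = (\<Sum>i<n. \<Sum>k<n. a i * (dtrans f n a k * f (halfang n k * real (2 * i + 1))))"
    using dtrans_expansion[OF assms, of _ a] by (intro sum.cong refl) (simp add: power2_eq_square flip: sum_distrib_left)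
  also have "\<dots> = (\<Sum>k<n. \<Sum>i<n. a i * (dtrans f n a k * f (halfang n k * real (2 * i + 1))))" by (rule sum.swap)
  also have "\<dots> = (\<Sum>k<n. dtrans f n a k * (\<Sum>i<n. a i * f (halfang n k * real (2 * i + 1))))"
    by (simp add: sum_distrib_left mult_ac)
  also have "\<dots> = (\<Sum>k<n. dtrans f n a k * (real n / 2 * dtrans f n a k))"
    using assms(1) unfolding dtrans_def by simp
  finally show ?thesis by (simp add: sum_distrib_left power2_eq_square mult_ac)
qed

section \<open>Aliasing of the grid angles\<close>

lemma halfang_bounds:
  assumes "k < n" shows "0 < halfang n k" "halfang n k < pi / 2"
proof -
  show "0 < halfang n k" unfolding halfang_def using assms by (intro divide_pos_pos mult_pos_pos) auto
  have "real (2 * k + 1) * pi < real (2 * n) * pi" using assms by (intro mult_strict_right_mono) auto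
  thus "halfang n k < pi / 2" unfolding halfang_def using assms by (simp add: field_simps)
qed

lemma halfang_pos: "n > 0 \<Longrightarrow> 0 < halfang n k"
  unfolding halfang_def by (intro divide_pos_pos mult_pos_pos) auto

lemma halfang_alias:
  assumes "n > 0"
  shows "halfang n (2 * n * j + k) = halfang n k + pi * real j"
    and "k < n \<Longrightarrow> halfang n (2 * n * j + (2 * n - 1 - k)) = pi * real (Suc j) - halfang n k"
proof -
  show "halfang n (2 * n * j + k) = halfang n k + pi * real j"
    unfolding halfang_def using assms by (simp add: field_simps)
  assume "k < n"
  hence "real (2 * (2 * n * j + (2 * n - 1 - k)) + 1) = 4 * real n * real (Suc j) - real (2 * k + 1)"
    by (simp add: of_nat_diff algebra_simps)
  thus "halfang n (2 * n * j + (2 * n - 1 - k)) = pi * real (Suc j) - halfang n k"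
    unfolding halfang_def using assms by (simp only: left_diff_distrib diff_divide_distrib) simp
qed

text \<open>Only odd multiples of the angle are sampled, so a shift by pi j acts as the sign (-1)^j.
  Reflection costs the cosine a further sign but not the sine; this is why the second alias enters
  the symbol negatively.\<close>

lemma cos_sin_alias:
  fixes y :: real
  shows "cos ((y + pi * real j) * real (2 * i + 1)) = (-1) ^ j * cos (y * real (2 * i + 1))"
    "sin ((y + pi * real j) * real (2 * i + 1)) = (-1) ^ j * sin (y * real (2 * i + 1))"
    "cos ((pi * real (Suc j) - y) * real (2 * i + 1)) = (-1) ^ Suc j * cos (y * real (2 * i + 1))"
    "sin ((pi * real (Suc j) - y) * real (2 * i + 1)) = (-1) ^ j * sin (y * real (2 * i + 1))"
proof -
  have e: "(y + pi * real j) * real (2 * i + 1) = y * real (2 * i + 1) + real (j * (2 * i + 1)) * pi"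
    "(pi * real (Suc j) - y) * real (2 * i + 1) = real (Suc j * (2 * i + 1)) * pi - y * real (2 * i + 1)"
    by (simp_all add: algebra_simps)
  have p: "(-1 :: real) ^ (j * (2 * i + 1)) = (-1) ^ j" for j
    by (cases "even j") auto
  show "cos ((y + pi * real j) * real (2 * i + 1)) = (-1) ^ j * cos (y * real (2 * i + 1))"
    "sin ((y + pi * real j) * real (2 * i + 1)) = (-1) ^ j * sin (y * real (2 * i + 1))"
    "cos ((pi * real (Suc j) - y) * real (2 * i + 1)) = (-1) ^ Suc j * cos (y * real (2 * i + 1))"
    "sin ((pi * real (Suc j) - y) * real (2 * i + 1)) = (-1) ^ j * sin (y * real (2 * i + 1))"
    unfolding e cos_add sin_add cos_diff sin_diff cos_npi sin_npi p by simp_all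
qed

lemma dct_dst_alias:
  assumes "n > 0"
  shows "dct n a (2 * n * j + k) = (-1) ^ j * dct n a k"
    "dst n a (2 * n * j + k) = (-1) ^ j * dst n a k"
    "k < n \<Longrightarrow> dct n a (2 * n * j + (2 * n - 1 - k)) = (-1) ^ Suc j * dct n a k"
    "k < n \<Longrightarrow> dst n a (2 * n * j + (2 * n - 1 - k)) = (-1) ^ j * dst n a k"
proof -
  show "dct n a (2 * n * j + k) = (-1) ^ j * dct n a k"
    "dst n a (2 * n * j + k) = (-1) ^ j * dst n a k"
    unfolding dtrans_def halfang_alias(1)[OF assms] cos_sin_alias sum_distrib_left
    by (simp_all only: mult.left_commute)
  assume k: "k < n"
  show "dct n a (2 * n * j + (2 * n - 1 - k)) = (-1) ^ Suc j * dct n a k"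
    "dst n a (2 * n * j + (2 * n - 1 - k)) = (-1) ^ j * dst n a k"
    unfolding dtrans_def halfang_alias(2)[OF assms k] cos_sin_alias sum_distrib_left
    by (simp_all only: mult.left_commute)
qed

text \<open>A block of 2 n consecutive frequencies is folded in the middle, which pairs the two
  aliases of each k < n.\<close>

lemma sum_alias_block:
  fixes f :: "nat \<Rightarrow> real"
  shows "sum f {j * (2 * n)..<j * (2 * n) + 2 * n} = (\<Sum>k<n. f (2 * n * j + k) + f (2 * n * j + (2 * n - 1 - k)))"
proof -
  have "sum f {j * (2 * n)..<j * (2 * n) + 2 * n} = (\<Sum>k<2 * n. f (2 * n * j + k))"
    using sum.shift_bounds_nat_ivl[of f 0 "2 * n * j" "2 * n"]
    by (simp add: atLeast0LessThan add.commute mult.commute mult.left_commute)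
  also have "\<dots> = (\<Sum>k<n. f (2 * n * j + k)) + (\<Sum>k\<in>{n..<2 * n}. f (2 * n * j + k))"
    by (subst sum.union_disjoint[symmetric]) (auto intro!: sum.cong)
  also have "(\<Sum>k\<in>{n..<2 * n}. f (2 * n * j + k)) = (\<Sum>k<n. f (2 * n * j + (2 * n - 1 - k)))"
    by (rule sum.reindex_bij_witness[of _ "\<lambda>k. 2 * n - 1 - k" "\<lambda>k. 2 * n - 1 - k"]) auto
  finally show ?thesis by (simp add: sum.distrib)
qed

section \<open>Piecewise constant functions\<close>

lemma AE_leb_not_finite:
  assumes "finite S" shows "AE t in leb T. t \<notin> S"
proof -
  have "S \<in> null_sets lebesgue" using assms by (simp add: finite_imp_null_set_lborel null_sets_completionI)
  hence "AE t in lebesgue. t \<notin> S" by (rule AE_not_in)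
  thus ?thesis by (subst AE_restrict_space_iff) auto
qed

locale mesh =
  fixes T :: real and n :: nat
  assumes T_pos: "T > 0" and n_pos: "n > 0"
begin

definition h :: real where "h = T / real n"

text \<open>Counted from 0, so cell i is element i + 1 of \<open>pw_const\<close>. The nodes belong
  to no cell, hence the equalities that hold only almost everywhere.\<close>

definition cell :: "nat \<Rightarrow> real set" where
  "cell i = {real i * h<..<real (Suc i) * h}"

abbreviation ind :: "nat \<Rightarrow> real \<Rightarrow> real" where
  "ind i \<equiv> indicator (cell i)"

definition pw_step :: "(nat \<Rightarrow> real) \<Rightarrow> real \<Rightarrow> real" where
  "pw_step a t = (\<Sum>i<n. a i * ind i t)"

lemma h_pos: "h > 0" using T_pos n_pos by (simp add: h_def)

lemma n_times_h: "real n * h = T" using n_pos by (simp add: h_def)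

lemma cell_ends:
  assumes "i < n"
  shows "real i * h \<le> real (Suc i) * h" "0 \<le> real i * h" "real (Suc i) * h \<le> T"
proof -
  have "real (Suc i) * h \<le> real n * h" using assms h_pos by (intro mult_right_mono) auto
  thus "real (Suc i) * h \<le> T" unfolding n_times_h .
  show "real i * h \<le> real (Suc i) * h" using h_pos by (intro mult_right_mono) auto
  show "0 \<le> real i * h" using h_pos by simp
qed

lemma cell_disjoint:
  assumes "t \<in> cell i" "t \<in> cell j" shows "i = j"
proof (rule ccontr)
  have *: False if "t \<in> cell i" "t \<in> cell j" "i < j" for i j
  proof -
    have "real (Suc i) * h \<le> real j * h" using that(3) h_pos by (intro mult_right_mono) auto
    thus False using that(1,2) unfolding cell_def by auto
  qed
  assume "i \<noteq> j"
  thus False using *[of i j] *[of j i] assms by linarith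
qed

lemma pw_step_cell:
  assumes "i < n" "t \<in> cell i" shows "pw_step a t = a i"
proof -
  have "ind j t = (if j = i then 1 else 0 :: real)" for j
  proof (cases "j = i")
    case False
    hence "t \<notin> cell j" using cell_disjoint assms(2) by blast
    thus ?thesis using False by simp
  qed (use assms(2) in simp)
  hence "pw_step a t = (\<Sum>j<n. if j = i then a i else 0)"
    unfolding pw_step_def by (intro sum.cong refl) auto
  thus ?thesis using assms(1) by simp
qed

lemma AE_in_cell: "AE t in leb T. \<exists>i<n. t \<in> cell i"
proof -
  have "AE t in leb T. t \<notin> (\<lambda>i. real i * h) ` {..n}" by (rule AE_leb_not_finite) simp
  moreover have "AE t in leb T. t \<in> {0<..<T}" using AE_space[of "leb T"] by simp
  ultimately show ?thesis
  proof eventually_elim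
    case (elim t)
    define i where "i = nat \<lfloor>t / h\<rfloor>"
    have t0: "0 < t / h" using elim h_pos by (intro divide_pos_pos) auto
    have i1: "real i \<le> t / h" "t / h < real (Suc i)" using t0 unfolding i_def by linarith+
    have "t / h < real n" using elim h_pos n_times_h by (simp add: pos_divide_less_eq)
    hence "i < n" using i1 by linarith
    moreover have "real i * h \<le> t" "t < real (Suc i) * h"
      using i1 h_pos by (simp_all only: pos_le_divide_eq pos_divide_less_eq)
    moreover have "t \<noteq> real i * h" using elim(1) \<open>i < n\<close> by auto
    ultimately have "i < n" "t \<in> cell i" unfolding cell_def by auto
    thus ?case by blast
  qed
qed

lemma ind_L2 [simp]: "ind i \<in> L2 T"
  by (rule L2_bounded[where B = 1]) (auto simp: cell_def intro!: borel_measurable_leb split: split_indicator)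

lemma pw_step_fun: "pw_step a = (\<lambda>t. \<Sum>i<n. a i * ind i t)"
  by (simp add: fun_eq_iff pw_step_def)

lemma pw_step_L2 [simp]: "pw_step a \<in> L2 T"
  unfolding pw_step_fun by (intro L2_sum L2_cmult ind_L2)

lemma pw_const_iff:
  "v \<in> pw_const T n \<longleftrightarrow> v \<in> L2 T \<and> (\<forall>i<n. \<exists>c. \<forall>t\<in>cell i. v t = c)"
proof -
  have "(\<forall>i\<in>{1..n}. P i) \<longleftrightarrow> (\<forall>i<n. P (Suc i))" for P
    by (metis Suc_le_eq Suc_le_mono atLeastAtMost_iff le0 One_nat_def Suc_le_D)
  thus ?thesis unfolding pw_const_def cell_def h_def by simp
qed

lemma pw_step_pw_const [simp]: "pw_step a \<in> pw_const T n"
  unfolding pw_const_iff using pw_step_cell by auto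

lemma pw_const_AE_pw_step:
  assumes "v \<in> pw_const T n" obtains a where "AE t in leb T. v t = pw_step a t"
proof -
  obtain a where a: "\<And>i t. i < n \<Longrightarrow> t \<in> cell i \<Longrightarrow> v t = a i"
    using assms unfolding pw_const_iff by metis
  have "AE t in leb T. v t = pw_step a t"
    using AE_in_cell by eventually_elim (use a pw_step_cell in auto)
  thus ?thesis using that by blast
qed

lemma inner_pw_step_right:
  assumes "w \<in> L2 T"
  shows "L2_inner T w (pw_step a) = (\<Sum>i<n. a i * L2_inner T w (ind i))"
  unfolding pw_step_fun using assms by (subst L2_inner_sum_right) (simp_all only: L2_cmult ind_L2 L2_inner_cmult_right)

lemma inner_indicator_cell:
  assumes "i < n" "j < n"
  shows "L2_inner T (ind i) (ind j) = (if i = j then h else 0)"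
proof (cases "i = j")
  case True
  have "L2_inner T (ind i) (ind j) = (\<integral>t. 1 * ind i t \<partial>leb T)"
    unfolding L2_inner_def True by (intro leb_integral_cong) (auto split: split_indicator)
  also have "\<dots> = real (Suc i) * h - real i * h"
    unfolding cell_def by (intro integral_leb_FTC(1)[where F = "\<lambda>t. t"] cell_ends[OF assms(1)]) auto
  finally show ?thesis using True by (simp add: algebra_simps)
next
  case False
  have "L2_inner T (ind i) (ind j) = (\<integral>t. 0 \<partial>leb T)"
    unfolding L2_inner_def using False cell_disjoint[of _ i j]
    by (intro leb_integral_cong) (auto split: split_indicator)
  thus ?thesis using False by simp
qed

lemma inner_pw_step: "L2_inner T (pw_step a) (pw_step b) = h * (\<Sum>i<n. a i * b i)"
proof -
  have "L2_inner T (pw_step a) (ind j) = h * a j" if "j < n" for j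
    using that by (simp add: L2_inner_commute[of T "pw_step a"] inner_pw_step_right inner_indicator_cell
        if_distrib cong: if_cong)
  thus ?thesis by (simp add: inner_pw_step_right sum_distrib_left mult_ac)
qed

lemma pw_step_norm:
  assumes "f = cos \<or> f = sin"
  shows "(L2_norm T (pw_step a))\<^sup>2 = T / 2 * (\<Sum>k<n. (dtrans f n a k)\<^sup>2)"
proof -
  have "(L2_norm T (pw_step a))\<^sup>2 = h * (\<Sum>i<n. (a i)\<^sup>2)"
    unfolding L2_norm_power2 inner_pw_step by (simp add: power2_eq_square)
  also have "\<dots> = (real n * h) / 2 * (\<Sum>k<n. (dtrans f n a k)\<^sup>2)"
    unfolding dtrans_Parseval[OF n_pos assms, of a] by simp
  finally show ?thesis unfolding n_times_h .
qed

lemmas pw_step_norm_dct = pw_step_norm[OF disjI1[OF refl]]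
  and pw_step_norm_dst = pw_step_norm[OF disjI2[OF refl]]

section \<open>Fourier coefficients of step functions\<close>

lemma freq_h: "freq T k * h = 2 * halfang n k"
  using T_pos n_pos unfolding freq_def halfang_def h_def by (simp add: field_simps)

text \<open>The difference of the primitive between the two nodes is 2 sin x / omega times the mode
  at the midpoint, and 2 / omega = h / x.\<close>

lemma inner_cos_mode_cell:
  assumes "i < n"
  shows "L2_inner T (cos_mode T k) (ind i)
    = h * (sinc (halfang n k) * cos (halfang n k * real (2 * i + 1)))"
    and "L2_inner T (sin_mode T k) (ind i)
    = h * (sinc (halfang n k) * sin (halfang n k * real (2 * i + 1)))"
proof -
  define w x where "w = freq T k" and "x = halfang n k"
  have w: "w > 0" unfolding w_def using T_pos by (rule freq_pos)
  have x: "x > 0" unfolding x_def using n_pos by (rule halfang_pos)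
  have wh: "w * h = 2 * x" unfolding w_def x_def by (rule freq_h)
  have wx: "2 / w = h / x" using wh w x by (simp add: field_simps)
  have arg: "w * (real j * h) = 2 * x * real j" for j
    using wh by (metis mult.commute mult.left_commute)
  note c = cell_ends[OF assms]
  have half: "(2 * x * real (Suc i) - 2 * x * real i) / 2 = x"
    "(2 * x * real (Suc i) + 2 * x * real i) / 2 = x * real (2 * i + 1)"
    "(2 * x * real i - 2 * x * real (Suc i)) / 2 = - x"
    "(2 * x * real i + 2 * x * real (Suc i)) / 2 = x * real (2 * i + 1)"
    by (simp_all add: algebra_simps add_divide_distrib)
  have "L2_inner T (cos_mode T k) (ind i)
      = sin (w * (real (Suc i) * h)) / w - sin (w * (real i * h)) / w"
    unfolding L2_inner_def cos_mode_eq cell_def w_def[symmetric] using w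
    by (intro integral_leb_FTC(1) c) (auto intro!: derivative_eq_intros continuous_intros)
  also have "\<dots> = (sin (2 * x * real (Suc i)) - sin (2 * x * real i)) / w"
    unfolding arg by (rule diff_divide_distrib[symmetric])
  also have "\<dots> = 2 / w * (sin x * cos (x * real (2 * i + 1)))"
    unfolding sin_diff_sin half by simp
  finally show "L2_inner T (cos_mode T k) (ind i) = h * (sinc x * cos (x * real (2 * i + 1)))"
    unfolding wx by (simp add: sinc_def)
  have "L2_inner T (sin_mode T k) (ind i)
      = - cos (w * (real (Suc i) * h)) / w - (- cos (w * (real i * h)) / w)"
    unfolding L2_inner_def sin_mode_eq cell_def w_def[symmetric] using w
    by (intro integral_leb_FTC(1) c) (auto intro!: derivative_eq_intros continuous_intros)
  also have "\<dots> = (cos (2 * x * real i) - cos (2 * x * real (Suc i))) / w"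
    unfolding arg by (simp add: diff_divide_distrib)
  also have "\<dots> = 2 / w * (sin x * sin (x * real (2 * i + 1)))"
    unfolding cos_diff_cos half by simp
  finally show "L2_inner T (sin_mode T k) (ind i) = h * (sinc x * sin (x * real (2 * i + 1)))"
    unfolding wx by (simp add: sinc_def)
qed

lemma fourier_pw_step:
  "fourier_cos T (pw_step a) k = sinc (halfang n k) * dct n a k"
  "fourier_sin T (pw_step a) k = sinc (halfang n k) * dst n a k"
proof -
  have L: "cos_mode T k \<in> L2 T" "sin_mode T k \<in> L2 T"
    using orthogonal_systemD(1)[OF orthogonal_cos_mode[OF T_pos]]
      orthogonal_systemD(1)[OF orthogonal_sin_mode[OF T_pos]] by auto
  have r: "2 / T * (\<Sum>i<n. a i * (h * (s * f i))) = s * (2 / real n * (\<Sum>i<n. a i * f i))" for s and f :: "nat \<Rightarrow> real"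
    using T_pos unfolding h_def by (simp add: sum_distrib_left mult_ac)
  show "fourier_cos T (pw_step a) k = sinc (halfang n k) * dct n a k"
    unfolding fourier_cos_eq L2_inner_commute[of T "pw_step a"] inner_pw_step_right[OF L(1)] dtrans_def r[symmetric]
    by (simp add: inner_cos_mode_cell(1))
  show "fourier_sin T (pw_step a) k = sinc (halfang n k) * dst n a k"
    unfolding fourier_sin_eq L2_inner_commute[of T "pw_step a"] inner_pw_step_right[OF L(2)] dtrans_def r[symmetric]
    by (simp add: inner_cos_mode_cell(2))
qed

text \<open>The series behind the form is grouped into blocks of 2 n terms. By aliasing each block
  involves the same transforms for k < n, only its scalar factors depend on the block, and these add
  up to the symbol.\<close>

lemma inner_pw_step_modHilbert:
  "L2_inner T (pw_step a) (modHilbert T (pw_step b))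
    = T / 2 * (\<Sum>k<n. alias_symbol (halfang n k) * (dct n a k * dst n b k))"
proof -
  define f where "f k = T / 2 * (fourier_cos T (pw_step a) k * fourier_sin T (pw_step b) k)" for k
  have f: "f sums L2_inner T (pw_step a) (modHilbert T (pw_step b))"
    unfolding f_def by (rule inner_modHilbert_sums) (use T_pos in auto)
  \<comment> \<open>The signs of the cosine and sine transforms cancel for the shifted alias and
    leave -1 for the reflected one.\<close>
  have pair: "f (2 * n * j + k) + f (2 * n * j + (2 * n - 1 - k))
      = T / 2 * (alias_term (halfang n k) j * (dct n a k * dst n b k))" if k: "k < n" for j k
  proof -
    define x where "x = halfang n k"
    define D where "D = dct n a k * dst n b k"
    have sq: "((-1::real) ^ j) * (-1) ^ j = 1" by (simp flip: power_add)
    hence sq2: "((-1::real) ^ j)\<^sup>2 = 1" by (simp add: power2_eq_square)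
    have "f (2 * n * j + k) = T / 2 * ((sinc (x + pi * real j))\<^sup>2 * D)"
      unfolding f_def fourier_pw_step dct_dst_alias[OF n_pos] halfang_alias[OF n_pos] x_def D_def
      using sq by (simp add: power2_eq_square mult_ac)
    moreover have "f (2 * n * j + (2 * n - 1 - k)) = T / 2 * (- (sinc (pi * real (Suc j) - x))\<^sup>2 * D)"
      unfolding f_def fourier_pw_step dct_dst_alias(3,4)[OF n_pos k] halfang_alias(2)[OF n_pos k] x_def D_def
      using sq by (simp add: power2_eq_square mult_ac)
    moreover have "(sinc (x + pi * real j))\<^sup>2 = (sin x)\<^sup>2 / (x + pi * real j)\<^sup>2"
      unfolding sinc_def by (simp add: power_divide sin_add power_mult_distrib sq2)
    moreover have "(sinc (pi * real (Suc j) - x))\<^sup>2 = (sin x)\<^sup>2 / (pi * real (Suc j) - x)\<^sup>2"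
      unfolding sinc_def by (simp add: power_divide sin_diff power_mult_distrib sq2 del: of_nat_Suc)
    ultimately show ?thesis unfolding alias_term_def x_def[symmetric] D_def[symmetric]
      by (simp add: algebra_simps)
  qed
  have block: "(\<Sum>k<n. f (2 * n * j + k) + f (2 * n * j + (2 * n - 1 - k)))
      = (\<Sum>k<n. T / 2 * (alias_term (halfang n k) j * (dct n a k * dst n b k)))" for j
    by (intro sum.cong refl pair) auto
  have "(\<lambda>j. \<Sum>k<n. f (2 * n * j + k) + f (2 * n * j + (2 * n - 1 - k)))
      sums L2_inner T (pw_step a) (modHilbert T (pw_step b))"
    using sums_group[OF f, of "2 * n"] n_pos unfolding sum_alias_block by simp
  hence "(\<lambda>j. \<Sum>k<n. T / 2 * (alias_term (halfang n k) j * (dct n a k * dst n b k)))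
      sums L2_inner T (pw_step a) (modHilbert T (pw_step b))" unfolding block .
  moreover have "(\<lambda>j. \<Sum>k<n. T / 2 * (alias_term (halfang n k) j * (dct n a k * dst n b k)))
      sums (\<Sum>k<n. T / 2 * (alias_symbol (halfang n k) * (dct n a k * dst n b k)))"
    by (intro sums_sum sums_mult sums_mult2 alias_symbol_sums halfang_bounds) auto
  ultimately show ?thesis unfolding sum_distrib_left by (rule sums_unique2)
qed

lemma ex_dtrans:
  assumes "f = cos \<or> f = sin" shows "\<exists>a. \<forall>k<n. dtrans f n a k = c k"
  using dtrans_inverse[OF n_pos assms] by blast

end

lemma L2_norm_cong_AE:
  assumes "AE t in leb T. f t = g t" "f \<in> L2 T" "g \<in> L2 T"
  shows "L2_norm T f = L2_norm T g"
  unfolding L2_norm_def using L2_inner_cong_AE[OF assms(1,1,2,3,2,3)] by simp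

lemma cos_mode_L2 [simp]: "cos_mode T k \<in> L2 T" and sin_mode_L2 [simp]: "sin_mode T k \<in> L2 T"
  unfolding cos_mode_fun sin_mode_fun by simp_all

lemma fourier_cos_cong_AE:
  assumes "AE t in leb T. f t = g t" "f \<in> L2 T" "g \<in> L2 T"
  shows "fourier_cos T f k = fourier_cos T g k"
  unfolding fourier_cos_eq using L2_inner_cong_AE[OF assms(1), of "cos_mode T k" "cos_mode T k"] assms by simp

text \<open>\<open>cS\<close> sees its argument through the norm and the cosine coefficients only;
  this allows passing from the Galerkin difference to a \<open>pw_step\<close>.\<close>

lemma cS_cong_AE:
  assumes "AE t in leb T. f t = g t" "f \<in> L2 T" "g \<in> L2 T"
  shows "cS T n f = cS T n g"
  unfolding cS_def cS_index_def using L2_norm_cong_AE[OF assms] fourier_cos_cong_AE[OF assms] by simp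

context mesh
begin

lemma pw_const_L2: "v \<in> pw_const T n \<Longrightarrow> v \<in> L2 T"
  by (simp add: pw_const_iff)

lemma pw_const_diff:
  assumes "v \<in> pw_const T n" "w \<in> pw_const T n" shows "(\<lambda>t. v t - w t) \<in> pw_const T n"
  unfolding pw_const_iff
proof safe
  show "(\<lambda>t. v t - w t) \<in> L2 T" using assms by (simp add: pw_const_L2)
  fix i assume "i < n"
  then obtain c d where "\<forall>t\<in>cell i. v t = c" "\<forall>t\<in>cell i. w t = d" using assms unfolding pw_const_iff by blast
  thus "\<exists>c. \<forall>t\<in>cell i. v t - w t = c" by auto
qed

section \<open>The projection onto piecewise constants\<close>

abbreviation "Q \<equiv> Q_proj T n"

text \<open>The cell averages witness existence. Membership and orthogonality are what the choice
  operator guarantees, and later arguments rest on these two facts.\<close>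

lemma Q_proj:
  assumes u: "u \<in> L2 T"
  shows "Q u \<in> pw_const T n"
    and "v \<in> pw_const T n \<Longrightarrow> L2_inner T (\<lambda>t. u t - Q u t) v = 0"
proof -
  define q where "q = pw_step (\<lambda>i. L2_inner T u (ind i) / h)"
  have "L2_inner T (\<lambda>t. u t - q t) v = 0" if v: "v \<in> pw_const T n" for v
  proof -
    obtain a where a: "AE t in leb T. v t = pw_step a t" using pw_const_AE_pw_step[OF v] .
    have uq: "(\<lambda>t. u t - q t) \<in> L2 T" using u unfolding q_def by simp
    have "L2_inner T (\<lambda>t. u t - q t) v = L2_inner T (\<lambda>t. u t - q t) (pw_step a)"
      using a uq pw_const_L2[OF v] by (intro L2_inner_cong_AE) auto
    also have "\<dots> = (\<Sum>i<n. a i * L2_inner T (\<lambda>t. u t - q t) (ind i))"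
      by (rule inner_pw_step_right[OF uq])
    also have "\<dots> = 0"
    proof (rule sum.neutral, safe)
      fix i assume i: "i < n"
      have "L2_inner T q (ind i) = L2_inner T (ind i) q" by (rule L2_inner_commute)
      also have "\<dots> = (\<Sum>j<n. L2_inner T u (ind j) / h * (if i = j then h else 0))"
        unfolding q_def inner_pw_step_right[OF ind_L2] using i
        by (intro sum.cong refl) (simp add: inner_indicator_cell)
      also have "\<dots> = L2_inner T u (ind i)" using i h_pos by (simp add: if_distrib cong: if_cong)
      finally show "a i * L2_inner T (\<lambda>t. u t - q t) (ind i) = 0"
        using u unfolding q_def by (simp add: L2_inner_diff_left)
    qed
    finally show ?thesis .
  qed
  hence "q \<in> pw_const T n \<and> (\<forall>v\<in>pw_const T n. L2_inner T (\<lambda>t. u t - q t) v = 0)"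
    unfolding q_def by simp
  hence "Q u \<in> pw_const T n \<and> (\<forall>v\<in>pw_const T n. L2_inner T (\<lambda>t. u t - Q u t) v = 0)"
    unfolding Q_proj_def
    by (rule someI[of "\<lambda>q. q \<in> pw_const T n \<and> (\<forall>v\<in>pw_const T n. L2_inner T (\<lambda>t. u t - q t) v = 0)"])
  thus "Q u \<in> pw_const T n"
    "v \<in> pw_const T n \<Longrightarrow> L2_inner T (\<lambda>t. u t - Q u t) v = 0" by auto
qed

lemma Q_proj_L2 [simp]: "u \<in> L2 T \<Longrightarrow> Q u \<in> L2 T"
  using Q_proj(1) pw_const_L2 by blast

lemma Q_proj_inner:
  assumes "u \<in> L2 T" "v \<in> pw_const T n"
  shows "L2_inner T (Q u) v = L2_inner T u v"
  using Q_proj(2)[OF assms] assms by (simp add: L2_inner_diff_left pw_const_L2)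

text \<open>Pythagoras, with u - Qu orthogonal to Qu - v.\<close>

lemma Q_proj_best:
  assumes u: "u \<in> L2 T" and v: "v \<in> pw_const T n"
  shows "L2_norm T (\<lambda>t. u t - Q u t) \<le> L2_norm T (\<lambda>t. u t - v t)"
proof (rule power2_le_imp_le)
  let ?q = "Q u"
  let ?f = "\<lambda>t. u t - ?q t" and ?g = "\<lambda>t. ?q t - v t"
  have f: "?f \<in> L2 T" using u by simp
  have gp: "?g \<in> pw_const T n" using Q_proj(1)[OF u] v by (rule pw_const_diff)
  hence g: "?g \<in> L2 T" by (rule pw_const_L2)
  have fg: "L2_inner T ?f ?g = 0" by (rule Q_proj(2)[OF u gp])
  have "L2_inner T (\<lambda>t. ?f t + ?g t) (\<lambda>t. ?f t + ?g t) = L2_inner T ?f ?f + L2_inner T ?g ?g"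
    using fg L2_inner_commute[of T ?f ?g] by (simp only: L2_inner_add_left[OF f g] L2_inner_add_right[OF f g] L2_add[OF f g] f g)
  thus "(L2_norm T ?f)\<^sup>2 \<le> (L2_norm T (\<lambda>t. u t - v t))\<^sup>2"
    unfolding L2_norm_power2 by simp
qed simp

section \<open>Stability\<close>

text \<open>The lower bound of \<open>alias_symbol_ge\<close> without its factor sinc^2. It
  decreases in k and is of order 1 / n at k = n - 1.\<close>

definition damp :: "nat \<Rightarrow> real" where
  "damp k = 1 - (halfang n k)\<^sup>2 / (pi - halfang n k)\<^sup>2"

lemma damp_antimono:
  assumes "k \<le> l" "l < n" shows "damp l \<le> damp k"
proof -
  have kl: "halfang n k \<le> halfang n l" "0 < halfang n k" "halfang n l < pi / 2"
    using assms halfang_bounds[of l n] halfang_bounds[of k n] n_pos unfolding halfang_def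
    by (auto intro!: divide_right_mono)
  have "halfang n k / (pi - halfang n k) \<le> halfang n l / (pi - halfang n l)"
    using kl by (intro frac_le) auto
  hence "(halfang n k / (pi - halfang n k))\<^sup>2 \<le> (halfang n l / (pi - halfang n l))\<^sup>2"
    using kl by (intro power_mono) auto
  thus ?thesis unfolding damp_def by (simp add: power_divide)
qed

text \<open>The minimum is at k = n - 1, where 2 x misses pi by pi / (2 n). The numerator (pi - x)^2
  - x^2 = pi (pi - 2 x) is then pi^2 / (2 n), and the denominator is at most pi^2.\<close>

lemma damp_ge:
  assumes "k < n" shows "1 / (2 * real n) \<le> damp k"
proof -
  define x where "x = halfang n (n - 1)"
  have x: "0 < x" "x < pi / 2" unfolding x_def using halfang_bounds[of "n - 1" n] n_pos by auto
  have xe: "2 * x = pi - pi / (2 * real n)"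
    unfolding x_def halfang_def using n_pos by (simp add: of_nat_diff field_simps)
  have "1 / (2 * real n) = (pi\<^sup>2 - 2 * pi * x) / pi\<^sup>2"
  proof -
    have "pi\<^sup>2 - 2 * pi * x = pi * (pi - 2 * x)" by (simp add: algebra_simps power2_eq_square)
    also have "\<dots> = pi\<^sup>2 / (2 * real n)" unfolding xe by (simp add: power2_eq_square)
    finally show ?thesis by simp
  qed
  also have "\<dots> \<le> (pi\<^sup>2 - 2 * pi * x) / (pi - x)\<^sup>2"
  proof (rule divide_left_mono)
    show "(pi - x)\<^sup>2 \<le> pi\<^sup>2" using x by (intro power_mono) auto
    have "pi\<^sup>2 - 2 * pi * x = pi * (pi - 2 * x)" by (simp add: algebra_simps power2_eq_square)
    thus "0 \<le> pi\<^sup>2 - 2 * pi * x" using x by simp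
    show "0 < pi\<^sup>2 * (pi - x)\<^sup>2" using x by (intro mult_pos_pos zero_less_power) auto
  qed
  also have "\<dots> = ((pi - x)\<^sup>2 - x\<^sup>2) / (pi - x)\<^sup>2" by (simp add: power2_diff)
  also have "\<dots> = damp (n - 1)" unfolding damp_def x_def[symmetric] using x by (simp add: diff_divide_distrib)
  also have "\<dots> \<le> damp k" using assms by (intro damp_antimono) auto
  finally show ?thesis .
qed

lemma damp_pos: "k < n \<Longrightarrow> 0 < damp k"
  using damp_ge[of k] n_pos by (smt (verit) divide_pos_pos of_nat_0_less_iff)

lemma alias_symbol_halfang_ge:
  assumes "k < n" shows "(sinc (halfang n k))\<^sup>2 * damp k \<le> alias_symbol (halfang n k)"
  using alias_symbol_ge[OF halfang_bounds[OF assms]] unfolding damp_def .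

lemma sinc_halfang_ge: "k < n \<Longrightarrow> 2 / pi \<le> sinc (halfang n k)"
  using halfang_bounds[of k n] by (intro sinc_ge_Jordan) auto

lemma sinc_halfang_sq_ge: "k < n \<Longrightarrow> 4 / pi\<^sup>2 \<le> (sinc (halfang n k))\<^sup>2"
  using power_mono[OF sinc_halfang_ge[of k], of 2] by (simp add: power_divide)

text \<open>Jordan's bound gives pi^2 / 3 * sinc^2 \<ge> 4 / 3 for every k < n, so by Parseval the
  defining condition of M holds at n - 1; this bounds the least index and shows that it
  exists.\<close>

lemma cS_index_pw_step:
  defines "M a \<equiv> cS_index T (pw_step a)"
  shows "M a < n"
    and "(L2_norm T (pw_step a))\<^sup>2 \<le> T / 2 * (pi\<^sup>2 / 3) * (\<Sum>k\<le>M a. (sinc (halfang n k) * dct n a k)\<^sup>2)"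
proof -
  define P where "P m \<longleftrightarrow> (L2_norm T (pw_step a))\<^sup>2 \<le> T / 2 * (pi\<^sup>2 / 3) * (\<Sum>k\<le>m. (fourier_cos T (pw_step a) k)\<^sup>2)" for m
  have M: "M a = Least P" unfolding M_def cS_index_def P_def ..
  have "P (n - 1)"
  proof -
    have "(dct n a k)\<^sup>2 \<le> pi\<^sup>2 / 3 * (sinc (halfang n k) * dct n a k)\<^sup>2" if "k < n" for k
    proof -
      have "1 = pi\<^sup>2 / 4 * (4 / pi\<^sup>2)" by simp
      also have "\<dots> \<le> pi\<^sup>2 / 3 * (sinc (halfang n k))\<^sup>2"
        using sinc_halfang_sq_ge[OF that] by (intro mult_mono) auto
      finally have "1 * (dct n a k)\<^sup>2 \<le> pi\<^sup>2 / 3 * (sinc (halfang n k))\<^sup>2 * (dct n a k)\<^sup>2"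
        by (intro mult_right_mono) auto
      thus ?thesis by (simp add: power_mult_distrib mult_ac)
    qed
    hence "(\<Sum>k<n. (dct n a k)\<^sup>2) \<le> (\<Sum>k<n. pi\<^sup>2 / 3 * (sinc (halfang n k) * dct n a k)\<^sup>2)"
      by (intro sum_mono) auto
    hence "T / 2 * (\<Sum>k<n. (dct n a k)\<^sup>2) \<le> T / 2 * (\<Sum>k<n. pi\<^sup>2 / 3 * (sinc (halfang n k) * dct n a k)\<^sup>2)"
      using T_pos by (intro mult_left_mono) auto
    moreover have "{..n - 1} = {..<n}" using n_pos by auto
    ultimately show ?thesis
      unfolding P_def fourier_pw_step pw_step_norm_dct[of a] by (simp add: sum_distrib_left mult_ac)
  qed
  hence "P (M a)" "M a \<le> n - 1" unfolding M by (auto intro: LeastI Least_le)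
  thus "M a < n" "(L2_norm T (pw_step a))\<^sup>2 \<le> T / 2 * (pi\<^sup>2 / 3) * (\<Sum>k\<le>M a. (sinc (halfang n k) * dct n a k)\<^sup>2)"
    using n_pos unfolding P_def fourier_pw_step by auto
qed

text \<open>With q = 2 M + 1 the numerator 16 n^2 - 8 n q is (4 n - q)^2 - q^2, and q / (4 n - q) is
  the quotient of the angle at M and its complement to pi.\<close>

lemma cS_pw_step: "cS T n (pw_step a) = 2 * sqrt 3 / pi\<^sup>2 * damp (cS_index T (pw_step a))"
proof -
  define M where "M = cS_index T (pw_step a)"
  define q where "q = 2 * real M + 1"
  have "M < n" unfolding M_def by (rule cS_index_pw_step)
  hence q: "q < 4 * real n" "0 < q" unfolding q_def by auto
  have he: "halfang n M = q * pi / (4 * real n)" unfolding halfang_def q_def by simp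
  have he2: "pi - halfang n M = (4 * real n - q) * pi / (4 * real n)"
    unfolding he using n_pos by (simp add: field_simps)
  have "(halfang n M)\<^sup>2 / (pi - halfang n M)\<^sup>2 = q\<^sup>2 / (4 * real n - q)\<^sup>2"
    unfolding he2 unfolding he using q n_pos by (simp add: power_divide power_mult_distrib)
  hence "damp M = 1 - q\<^sup>2 / (4 * real n - q)\<^sup>2" unfolding damp_def by simp
  also have "\<dots> = ((4 * real n - q)\<^sup>2 - q\<^sup>2) / (4 * real n - q)\<^sup>2"
    using q by (simp add: diff_divide_distrib)
  also have "(4 * real n - q)\<^sup>2 - q\<^sup>2 = 16 * (real n)\<^sup>2 - 8 * real n * q"
    by (simp add: power2_eq_square algebra_simps)
  finally show ?thesis unfolding cS_def Let_def M_def[symmetric] q_def by simp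
qed

lemma cS_pos: "cS T n (pw_step a) > 0"
  unfolding cS_pw_step using damp_pos[OF cS_index_pw_step(1)] by simp

text \<open>Testing with the low-frequency part of the function, up to the index \<open>M\<close> of \<open>c\<^sub>S\<close>.\<close>

lemma cS_stability:
  assumes R: "R \<in> L2 T"
    and RB: "\<And>b. L2_inner T R (pw_step b) = L2_inner T (pw_step a) (modHilbert T (pw_step b))"
  shows "cS T n (pw_step a) * L2_norm T (pw_step a) \<le> L2_norm T R"
proof -
  define M where "M = cS_index T (pw_step a)"
  define A where "A k = dct n a k" for k
  define s where "s k = sinc (halfang n k)" for k
  note Mn = cS_index_pw_step(1)[of a, folded M_def]
  note Mz = cS_index_pw_step(2)[of a, folded M_def A_def s_def]
  \<comment> \<open>The sine spectrum of the test function is the cosine spectrum of the given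
    function cut off above M, so the diagonal form becomes a sum of squares.\<close>
  obtain b where b: "\<And>k. k < n \<Longrightarrow> dst n b k = (if k \<le> M then A k else 0)"
    using ex_dtrans[of sin "\<lambda>k. if k \<le> M then A k else 0"] by blast
  \<comment> \<open>Z is the norm of the first M + 1 terms of the cosine series; by the choice of M
    it controls the full norm up to the factor pi / sqrt 3.\<close>
  define Z where "Z = sqrt (T / 2 * (\<Sum>k\<le>M. (s k * A k)\<^sup>2))"
  have nn: "0 \<le> T / 2 * (\<Sum>k\<le>M. (s k * A k)\<^sup>2)"
    using T_pos by (intro mult_nonneg_nonneg sum_nonneg) auto
  have Z0: "Z \<ge> 0" and Z2: "Z\<^sup>2 = T / 2 * (\<Sum>k\<le>M. (s k * A k)\<^sup>2)"
    unfolding Z_def by (rule real_sqrt_ge_zero[OF nn], rule real_sqrt_pow2[OF nn])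
  have res: "(\<Sum>k<n. if k \<le> M then f k else 0) = sum f {..M}" for f :: "nat \<Rightarrow> real"
  proof -
    have "{..<n} \<inter> {k. k \<le> M} = {..M}" using Mn by auto
    thus ?thesis by (simp add: sum.If_cases)
  qed
  \<comment> \<open>Passing from Fourier coefficients to the discrete transform divides by sinc, at
    the price of Jordan's factor pi / 2.\<close>
  have V: "L2_norm T (pw_step b) \<le> pi / 2 * Z"
  proof (rule power2_le_imp_le)
    have "(L2_norm T (pw_step b))\<^sup>2 = T / 2 * (\<Sum>k<n. if k \<le> M then (A k)\<^sup>2 else 0)"
      unfolding pw_step_norm_dst[of b]
      by (intro arg_cong[where f = "(*) (T / 2)"] sum.cong refl) (simp add: b)
    also have "\<dots> = T / 2 * (\<Sum>k\<le>M. (A k)\<^sup>2)" unfolding res ..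
    also have "\<dots> \<le> T / 2 * (\<Sum>k\<le>M. pi\<^sup>2 / 4 * (s k * A k)\<^sup>2)"
    proof (intro mult_left_mono sum_mono)
      fix k assume "k \<in> {..M}"
      hence "4 / pi\<^sup>2 \<le> (s k)\<^sup>2" unfolding s_def using Mn by (intro sinc_halfang_sq_ge) auto
      hence "pi\<^sup>2 / 4 * (4 / pi\<^sup>2) \<le> pi\<^sup>2 / 4 * (s k)\<^sup>2" by (intro mult_left_mono) auto
      hence "1 * (A k)\<^sup>2 \<le> pi\<^sup>2 / 4 * (s k)\<^sup>2 * (A k)\<^sup>2" by (intro mult_right_mono) auto
      thus "(A k)\<^sup>2 \<le> pi\<^sup>2 / 4 * (s k * A k)\<^sup>2" by (simp add: power_mult_distrib mult_ac)
    qed (use T_pos in auto)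
    also have "\<dots> = (pi / 2 * Z)\<^sup>2"
      unfolding power_mult_distrib Z2 by (simp add: power_divide sum_distrib_left mult_ac)
    finally show "(L2_norm T (pw_step b))\<^sup>2 \<le> (pi / 2 * Z)\<^sup>2" .
  qed (use Z0 in simp)
  have "damp M * Z\<^sup>2 = T / 2 * (\<Sum>k\<le>M. damp M * (s k * A k)\<^sup>2)"
    unfolding Z2 by (simp add: sum_distrib_left mult_ac)
  also have "\<dots> \<le> T / 2 * (\<Sum>k\<le>M. alias_symbol (halfang n k) * (A k * A k))"
  proof (intro mult_left_mono sum_mono)
    fix k assume k: "k \<in> {..M}"
    have "damp M * (s k)\<^sup>2 \<le> damp k * (s k)\<^sup>2" using k Mn by (intro mult_right_mono damp_antimono) auto
    also have "\<dots> \<le> alias_symbol (halfang n k)"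
      using alias_symbol_halfang_ge[of k] k Mn unfolding s_def by (simp add: mult.commute)
    finally have "damp M * (s k)\<^sup>2 * (A k)\<^sup>2 \<le> alias_symbol (halfang n k) * (A k)\<^sup>2"
      by (intro mult_right_mono) auto
    thus "damp M * (s k * A k)\<^sup>2 \<le> alias_symbol (halfang n k) * (A k * A k)"
      by (simp add: power_mult_distrib power2_eq_square mult_ac)
  qed (use T_pos in auto)
  also have "\<dots> = T / 2 * (\<Sum>k<n. if k \<le> M then alias_symbol (halfang n k) * (A k * A k) else 0)"
    unfolding res ..
  also have "\<dots> = L2_inner T R (pw_step b)"
    unfolding RB inner_pw_step_modHilbert
    by (intro arg_cong[where f = "(*) (T / 2)"] sum.cong refl) (simp add: b A_def)
  also have "\<dots> \<le> L2_norm T R * L2_norm T (pw_step b)"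
    using L2_Cauchy_Schwarz[OF R pw_step_L2, of b] by simp
  also have "\<dots> \<le> L2_norm T R * (pi / 2 * Z)" using V by (intro mult_left_mono) auto
  finally have main: "damp M * Z\<^sup>2 \<le> L2_norm T R * (pi / 2 * Z)" .
  have dZ: "damp M * Z \<le> pi / 2 * L2_norm T R"
  proof (cases "Z = 0")
    case False
    with Z0 have "Z > 0" by simp
    from main have "damp M * Z * Z \<le> pi / 2 * L2_norm T R * Z" by (simp add: power2_eq_square mult_ac)
    thus ?thesis using \<open>Z > 0\<close> by simp
  qed simp
  have "L2_norm T (pw_step a) \<le> pi / sqrt 3 * Z"
  proof (rule power2_le_imp_le)
    show "(L2_norm T (pw_step a))\<^sup>2 \<le> (pi / sqrt 3 * Z)\<^sup>2"
      unfolding power_mult_distrib[of "pi / sqrt 3" Z] Z2 using Mz by (simp add: power_divide mult_ac)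
  qed (use Z0 in simp)
  hence "cS T n (pw_step a) * L2_norm T (pw_step a) \<le> cS T n (pw_step a) * (pi / sqrt 3 * Z)"
    using cS_pos[of a] by (intro mult_left_mono) auto
  \<comment> \<open>The product of 2 * sqrt 3 / pi^2 and pi / sqrt 3 is 2 / pi, which cancels the
    factor pi / 2 in \<open>dZ\<close>.\<close>
  also have "\<dots> = 2 / pi * (damp M * Z)"
    unfolding cS_pw_step M_def[symmetric] by (simp add: field_simps power2_eq_square)
  also have "\<dots> \<le> 2 / pi * (pi / 2 * L2_norm T R)" using dZ by (intro mult_left_mono) auto
  finally show ?thesis by simp
qed

section \<open>The Galerkin solution against the projection\<close>

lemma galerkin_difference:
  assumes "u \<in> L2 T" "galerkin_solution T n u uh"
  shows "(\<lambda>t. uh t - Q u t) \<in> pw_const T n"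
    and "v \<in> pw_const T n \<Longrightarrow> L2_inner T (\<lambda>t. uh t - Q u t) (modHilbert T v)
      = L2_inner T (\<lambda>t. u t - Q u t) (modHilbert T v)"
proof -
  have uh: "uh \<in> pw_const T n" "v \<in> pw_const T n \<Longrightarrow> L2_inner T uh (modHilbert T v) = L2_inner T u (modHilbert T v)" for v
    using assms(2) unfolding galerkin_solution_def by auto
  show "(\<lambda>t. uh t - Q u t) \<in> pw_const T n"
    using uh(1) Q_proj(1)[OF assms(1)] by (rule pw_const_diff)
  assume v: "v \<in> pw_const T n"
  show "L2_inner T (\<lambda>t. uh t - Q u t) (modHilbert T v)
      = L2_inner T (\<lambda>t. u t - Q u t) (modHilbert T v)"
    using uh(2)[OF v] assms(1) uh(1) modHilbert_L2[OF T_pos pw_const_L2[OF v]]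
    by (simp add: L2_inner_diff_left pw_const_L2)
qed

text \<open>Moving Q and the inverse transformation to the test side turns R into the functional v
  -> <u - Qu, H v>, which the Galerkin equations identify with <z, H v>.\<close>

lemma galerkin_projection_error:
  assumes u: "u \<in> L2 T" and g: "galerkin_solution T n u uh"
  defines "R \<equiv> Q (modHilbert_inv T (\<lambda>t. u t - Q u t))"
    and "z \<equiv> \<lambda>t. uh t - Q u t"
  shows "L2_norm T z \<le> L2_norm T R / cS T n z" "0 < cS T n z"
proof -
  have z: "z \<in> pw_const T n" unfolding z_def by (rule galerkin_difference[OF u g])
  obtain a where a: "AE t in leb T. z t = pw_step a t" using pw_const_AE_pw_step[OF z] .
  have zL2: "z \<in> L2 T" using z by (rule pw_const_L2)
  have f: "(\<lambda>t. u t - Q u t) \<in> L2 T" using u by simp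
  have Hf: "modHilbert_inv T (\<lambda>t. u t - Q u t) \<in> L2 T" using T_pos f by (rule modHilbert_inv_L2)
  hence R: "R \<in> L2 T" unfolding R_def by simp
  have "L2_inner T R (pw_step b) = L2_inner T (pw_step a) (modHilbert T (pw_step b))" for b
  proof -
    have Hb: "modHilbert T (pw_step b) \<in> L2 T" using T_pos by (intro modHilbert_L2) auto
    have "L2_inner T R (pw_step b) = L2_inner T (\<lambda>t. u t - Q u t) (modHilbert T (pw_step b))"
      unfolding R_def using Hf f by (simp add: Q_proj_inner inner_modHilbert_inv[OF T_pos])
    also have "\<dots> = L2_inner T z (modHilbert T (pw_step b))"
      unfolding z_def by (rule galerkin_difference(2)[OF u g, symmetric]) simp
    also have "\<dots> = L2_inner T (pw_step a) (modHilbert T (pw_step b))"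
      using a zL2 Hb by (intro L2_inner_cong_AE) auto
    finally show ?thesis .
  qed
  from cS_stability[OF R this] have *: "cS T n (pw_step a) * L2_norm T (pw_step a) \<le> L2_norm T R" .
  have eq: "cS T n z = cS T n (pw_step a)" "L2_norm T z = L2_norm T (pw_step a)"
    using cS_cong_AE[OF a zL2 pw_step_L2] L2_norm_cong_AE[OF a zL2 pw_step_L2] by auto
  show "0 < cS T n z" unfolding eq by (rule cS_pos)
  thus "L2_norm T z \<le> L2_norm T R / cS T n z"
    using * unfolding eq by (simp add: pos_le_divide_eq mult.commute)
qed

text \<open>Testing with all frequencies; the factor \<open>1 / n\<close> is the decay of \<open>damp\<close> at \<open>k = n - 1\<close>.\<close>

lemma coercivity:
  obtains b where "L2_norm T (pw_step b) = L2_norm T (pw_step a)"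
    "2 / (pi\<^sup>2 * real n) * (L2_norm T (pw_step a))\<^sup>2 \<le> L2_inner T (pw_step a) (modHilbert T (pw_step b))"
proof -
  define A where "A k = dct n a k" for k
  \<comment> \<open>Equal spectra make the form a sum of squares, and by Parseval for both
    transforms the test function has the same norm.\<close>
  obtain b where b: "\<And>k. k < n \<Longrightarrow> dst n b k = A k" using ex_dtrans[of sin A] by blast
  have "(L2_norm T (pw_step b))\<^sup>2 = (L2_norm T (pw_step a))\<^sup>2"
    unfolding pw_step_norm_dst[of b] pw_step_norm_dct[of a]
    using b unfolding A_def by simp
  hence "L2_norm T (pw_step b) = L2_norm T (pw_step a)" by simp
  moreover have "2 / (pi\<^sup>2 * real n) * (L2_norm T (pw_step a))\<^sup>2 \<le> L2_inner T (pw_step a) (modHilbert T (pw_step b))"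
  proof -
    have "2 / (pi\<^sup>2 * real n) * (L2_norm T (pw_step a))\<^sup>2 = T / 2 * (\<Sum>k<n. 2 / (pi\<^sup>2 * real n) * (A k * A k))"
      unfolding pw_step_norm_dct[of a] A_def
      by (simp add: sum_distrib_left power2_eq_square mult_ac)
    also have "\<dots> \<le> T / 2 * (\<Sum>k<n. alias_symbol (halfang n k) * (A k * A k))"
    proof (intro mult_left_mono sum_mono mult_right_mono)
      fix k assume "k \<in> {..<n}"
      hence k: "k < n" by simp
      \<comment> \<open>Jordan's bound for sinc^2 times the smallest value of
        \<open>damp\<close>.\<close>
      have "2 / (pi\<^sup>2 * real n) = 4 / pi\<^sup>2 * (1 / (2 * real n))" by simp
      also have "\<dots> \<le> (sinc (halfang n k))\<^sup>2 * damp k"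
        using sinc_halfang_sq_ge[OF k] damp_ge[OF k] by (intro mult_mono) auto
      also have "\<dots> \<le> alias_symbol (halfang n k)" by (rule alias_symbol_halfang_ge[OF k])
      finally show "2 / (pi\<^sup>2 * real n) \<le> alias_symbol (halfang n k)" .
    qed (use T_pos in auto)
    also have "\<dots> = L2_inner T (pw_step a) (modHilbert T (pw_step b))"
      unfolding inner_pw_step_modHilbert using b by (simp add: A_def)
    finally show ?thesis .
  qed
  ultimately show ?thesis using that by blast
qed

end

section \<open>Test functions\<close>

definition smooth :: "(real \<Rightarrow> real) \<Rightarrow> bool" where
  "smooth f \<longleftrightarrow> (\<forall>k. (deriv ^^ k) f differentiable_on UNIV)"

text \<open>Membership in S passes to every iterated derivative, so no formula for higher
  derivatives has to be found.\<close>

lemma smooth_coinduct: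
  assumes "f \<in> S" and step: "\<And>f. f \<in> S \<Longrightarrow> \<exists>f'\<in>S. \<forall>x. (f has_real_derivative f' x) (at x)"
  shows "smooth f"
proof -
  have S': "deriv f \<in> S \<and> f differentiable_on UNIV" if "f \<in> S" for f
  proof -
    obtain f' where f': "f' \<in> S" "\<And>x. (f has_real_derivative f' x) (at x)" using step[OF \<open>f \<in> S\<close>] by blast
    have "deriv f = f'" using DERIV_imp_deriv[OF f'(2)] by (rule ext)
    moreover have "f differentiable_on UNIV"
      unfolding differentiable_on_def using f'(2) real_differentiable_def by blast
    ultimately show ?thesis using f'(1) by simp
  qed
  have "(deriv ^^ k) f \<in> S" for k by (induction k) (use assms(1) S' in auto)
  thus ?thesis unfolding smooth_def using S' by blast
qed

lemma smooth_DERIV: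
  assumes "smooth f" shows "(f has_real_derivative deriv f x) (at x)"
proof -
  have "f differentiable_on UNIV" using assms unfolding smooth_def by (metis funpow_0)
  hence "f differentiable at x" unfolding differentiable_on_def by simp
  thus ?thesis by (simp add: DERIV_deriv_iff_real_differentiable)
qed

lemma smooth_deriv: "smooth f \<Longrightarrow> smooth (deriv f)"
  unfolding smooth_def by (metis comp_apply funpow_Suc_right)

lemma smooth_primitive:
  assumes "smooth \<psi>" "\<And>x. (f has_real_derivative \<psi> x) (at x)"
  shows "smooth f"
proof (rule smooth_coinduct[where S = "insert f {g. smooth g}"])
  fix g assume "g \<in> insert f {g. smooth g}"
  thus "\<exists>g'\<in>insert f {g. smooth g}. \<forall>x. (g has_real_derivative g' x) (at x)"
    using assms smooth_DERIV smooth_deriv by blast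
qed simp

lemma smooth_add_cmult:
  assumes "smooth f" "smooth g" shows "smooth (\<lambda>x. f x + c * g x)"
proof (rule smooth_coinduct[where S = "{\<lambda>x. f x + c * g x | f g. smooth f \<and> smooth g}"])
  fix F assume "F \<in> {\<lambda>x. f x + c * g x | f g. smooth f \<and> smooth g}"
  then obtain f g where F: "F = (\<lambda>x. f x + c * g x)" and fg: "smooth f" "smooth g" by blast
  have "(F has_real_derivative deriv f x + c * deriv g x) (at x)" for x
    unfolding F by (intro DERIV_add DERIV_cmult smooth_DERIV fg)
  moreover have "(\<lambda>x. deriv f x + c * deriv g x) \<in> {\<lambda>x. f x + c * g x | f g. smooth f \<and> smooth g}"
    using fg smooth_deriv by blast
  ultimately show "\<exists>f'\<in>{\<lambda>x. f x + c * g x | f g. smooth f \<and> smooth g}. \<forall>x. (F has_real_derivative f' x) (at x)"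
    by (intro bexI[of _ "\<lambda>x. deriv f x + c * deriv g x"]) auto
qed (use assms in blast)

lemma smooth_continuous: "smooth f \<Longrightarrow> continuous_on A f"
  using smooth_DERIV by (meson DERIV_isCont continuous_at_imp_continuous_on)

lemma test_fun_iff:
  "\<phi> \<in> test_fun T \<longleftrightarrow> smooth \<phi> \<and> (\<exists>K. compact K \<and> K \<subseteq> {0<..<T} \<and> (\<forall>t. t \<notin> K \<longrightarrow> \<phi> t = 0))"
  unfolding test_fun_def smooth_def by simp

section \<open>Smooth bumps from flat functions\<close>

text \<open>The polynomial is a parameter so that the family is closed under
  differentiation.\<close>

definition flat :: "real poly \<Rightarrow> real \<Rightarrow> real" where
  "flat p x = (if x > 0 then poly p (1 / x) * exp (- (1 / x)) else 0)"

lemma poly_exp_tendsto_0: "((\<lambda>x. poly p x * exp (- x)) \<longlongrightarrow> (0::real)) at_top"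
proof -
  have "((\<lambda>x. \<Sum>i\<le>degree p. coeff p i * (x ^ i / exp x)) \<longlongrightarrow> (\<Sum>i\<le>degree p. coeff p i * 0)) at_top"
    by (intro tendsto_sum tendsto_mult_left tendsto_power_div_exp_0)
  moreover have "(\<Sum>i\<le>degree p. coeff p i * (x ^ i / exp x)) = poly p x * exp (- x)" for x
    by (simp add: poly_altdef sum_distrib_right exp_minus divide_inverse mult.assoc)
  ultimately show ?thesis by simp
qed

text \<open>For x > 0 the chain rule gives (1 / x)^2 (p - p') (1 / x) exp (- 1 / x). At 0 the right
  difference quotient has the same shape with X p in place of p, and tends to 0.\<close>

lemma flat_DERIV: "(flat p has_real_derivative flat ([:0, 0, 1:] * (p - pderiv p)) x) (at x)"
proof (cases x "0::real" rule: linorder_cases)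
  case greater
  have "((\<lambda>x. poly p (1 / x) * exp (- (1 / x))) has_real_derivative
      flat ([:0, 0, 1:] * (p - pderiv p)) x) (at x)"
  proof -
    have d: "((\<lambda>x. 1 / x) has_real_derivative - (1 / x\<^sup>2)) (at x)"
      using greater by (auto intro!: derivative_eq_intros simp: power2_eq_square)
    have "((\<lambda>x. poly p (1 / x)) has_real_derivative poly (pderiv p) (1 / x) * (- (1 / x\<^sup>2))) (at x)"
      by (rule DERIV_chain2[OF poly_DERIV d])
    moreover have "((\<lambda>x. exp (- (1 / x))) has_real_derivative exp (- (1 / x)) * (1 / x\<^sup>2)) (at x)"
      using DERIV_fun_exp[OF DERIV_minus[OF d]] by simp
    ultimately have "((\<lambda>x. poly p (1 / x) * exp (- (1 / x))) has_real_derivative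
       (poly (pderiv p) (1 / x) * (- (1 / x\<^sup>2))) * exp (- (1 / x)) + (exp (- (1 / x)) * (1 / x\<^sup>2)) * poly p (1 / x)) (at x)"
      by (rule DERIV_mult)
    thus ?thesis
      by (rule DERIV_cong) (use greater in \<open>simp add: flat_def power2_eq_square algebra_simps\<close>)
  qed
  moreover have "eventually (\<lambda>y. poly p (1 / y) * exp (- (1 / y)) = flat p y) (nhds x)"
    using eventually_nhds_in_open[of "{0<..}" x] greater by (auto simp: flat_def elim!: eventually_mono)
  ultimately show ?thesis by (subst (asm) DERIV_cong_ev[OF refl _ refl]) auto
next
  case less
  have "eventually (\<lambda>y. 0 = flat p y) (nhds x)"
    using eventually_nhds_in_open[of "{..<0}" x] less by (auto simp: flat_def elim!: eventually_mono)
  moreover have "((\<lambda>y. 0) has_real_derivative flat ([:0, 0, 1:] * (p - pderiv p)) x) (at x)"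
    using less by (simp add: flat_def)
  ultimately show ?thesis by (subst (asm) DERIV_cong_ev[OF refl _ refl]) auto
next
  case equal
  have "((\<lambda>h. (flat p (0 + h) - flat p 0) / h) \<longlongrightarrow> 0) (at 0)"
  proof (rule filterlim_split_at)
    have "((\<lambda>h. 0::real) \<longlongrightarrow> 0) (at_left 0)" by simp
    thus "((\<lambda>h. (flat p (0 + h) - flat p 0) / h) \<longlongrightarrow> 0) (at_left 0)"
      by (rule Lim_transform_eventually) (auto simp: flat_def eventually_at_filter)
    have "((\<lambda>h. poly ([:0, 1:] * p) (inverse h) * exp (- inverse h)) \<longlongrightarrow> 0) (at_right (0::real))"
      by (rule filterlim_compose[OF poly_exp_tendsto_0 filterlim_inverse_at_top_right])
    thus "((\<lambda>h. (flat p (0 + h) - flat p 0) / h) \<longlongrightarrow> 0) (at_right 0)"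
      by (rule Lim_transform_eventually) (auto simp: flat_def eventually_at_filter field_simps)
  qed
  thus ?thesis using equal by (simp add: DERIV_def flat_def)
qed

text \<open>Each product has one flat factor per end of [a, b]. Both polynomials vary because
  differentiation changes them; \<alpha> is the steepness.\<close>

inductive_set bump_span :: "real \<Rightarrow> real \<Rightarrow> real \<Rightarrow> (real \<Rightarrow> real) set" for \<alpha> a b where
  base: "(\<lambda>t. c * (flat p (\<alpha> * (t - a)) * flat q (\<alpha> * (b - t)))) \<in> bump_span \<alpha> a b"
| add: "f \<in> bump_span \<alpha> a b \<Longrightarrow> g \<in> bump_span \<alpha> a b \<Longrightarrow> (\<lambda>t. f t + g t) \<in> bump_span \<alpha> a b"

lemma bump_span_smooth:
  assumes "f \<in> bump_span \<alpha> a b" shows "smooth f"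
proof (rule smooth_coinduct[OF assms])
  fix f assume "f \<in> bump_span \<alpha> a b"
  thus "\<exists>f'\<in>bump_span \<alpha> a b. \<forall>x. (f has_real_derivative f' x) (at x)"
  proof induction
    case (base c p q)
    let ?D = "\<lambda>p. [:0, 0, 1:] * (p - pderiv p)"
    have d1: "((\<lambda>t. flat p (\<alpha> * (t - a))) has_real_derivative flat (?D p) (\<alpha> * (x - a)) * \<alpha>) (at x)" for x
      by (rule DERIV_chain2[OF flat_DERIV]) (auto intro!: derivative_eq_intros)
    have d2: "((\<lambda>t. flat q (\<alpha> * (b - t))) has_real_derivative flat (?D q) (\<alpha> * (b - x)) * (- \<alpha>)) (at x)" for x
      by (rule DERIV_chain2[OF flat_DERIV]) (auto intro!: derivative_eq_intros)
    have "((\<lambda>t. c * (flat p (\<alpha> * (t - a)) * flat q (\<alpha> * (b - t)))) has_real_derivative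
        (c * \<alpha>) * (flat (?D p) (\<alpha> * (x - a)) * flat q (\<alpha> * (b - x)))
        + (- c * \<alpha>) * (flat p (\<alpha> * (x - a)) * flat (?D q) (\<alpha> * (b - x)))) (at x)" for x
      by (rule DERIV_cong[OF DERIV_cmult[OF DERIV_mult[OF d1 d2]]]) (simp add: algebra_simps)
    thus ?case by (intro bexI[OF _ bump_span.add[OF bump_span.base bump_span.base]] allI)
  next
    case (add f g)
    then obtain f' g' where "f' \<in> bump_span \<alpha> a b" "g' \<in> bump_span \<alpha> a b"
      "\<And>x. (f has_real_derivative f' x) (at x)" "\<And>x. (g has_real_derivative g' x) (at x)" by blast
    thus ?case by (intro bexI[OF _ bump_span.add[of f' _ _ _ g']] allI DERIV_add)
  qed
qed

text \<open>Not normalised to integral 1: with growing steepness the bumps tend to the indicator of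
  (a, b), so identities for bumps pass to integrals over intervals.\<close>

definition bump :: "nat \<Rightarrow> real \<Rightarrow> real \<Rightarrow> real \<Rightarrow> real" where
  "bump j a b t = flat 1 (real (Suc j) * (t - a)) * flat 1 (real (Suc j) * (b - t))"

lemma bump_smooth: "smooth (bump j a b)"
  using bump_span_smooth[OF bump_span.base[of 1 1 "real (Suc j)" a 1 b]]
  unfolding bump_def[abs_def] by simp

lemma bump_outside: "t \<notin> {a<..<b} \<Longrightarrow> bump j a b t = 0"
  unfolding bump_def flat_def by (auto simp: zero_less_mult_iff)

lemma bump_le_1: "\<bar>bump j a b t\<bar> \<le> 1"
proof -
  have "0 \<le> flat 1 x \<and> flat 1 x \<le> 1" for x unfolding flat_def by auto
  thus ?thesis unfolding bump_def by (simp add: abs_mult mult_le_one)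
qed

lemma bump_tendsto: "(\<lambda>j. bump j a b t) \<longlonglongrightarrow> indicator {a<..<b} t"
proof (cases "t \<in> {a<..<b}")
  case True
  have l: "(\<lambda>j. flat 1 (real (Suc j) * x)) \<longlonglongrightarrow> 1" if "x > 0" for x
  proof -
    have "(\<lambda>j. exp (- (1 / x * inverse (real (Suc j))))) \<longlonglongrightarrow> exp (- (1 / x * 0))"
      by (intro tendsto_intros LIMSEQ_inverse_real_of_nat)
    moreover have "flat 1 (real (Suc j) * x) = exp (- (1 / x * inverse (real (Suc j))))" for j
    proof -
      have "0 < real (Suc j) * x" using that by (intro mult_pos_pos) auto
      moreover have "1 / (real (Suc j) * x) = 1 / x * inverse (real (Suc j))"
        by (simp add: divide_inverse inverse_mult_distrib mult.commute del: of_nat_Suc)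
      ultimately show ?thesis unfolding flat_def by simp
    qed
    ultimately show ?thesis by simp
  qed
  have "(\<lambda>j. bump j a b t) \<longlonglongrightarrow> 1 * 1"
    unfolding bump_def using True by (intro tendsto_mult l) auto
  thus ?thesis using True by simp
qed (simp add: bump_outside)

lemma integral_bump_tendsto:
  assumes "integrable (leb T) w"
  shows "(\<lambda>j. \<integral>t. w t * bump j a b t \<partial>leb T) \<longlonglongrightarrow> (\<integral>t. w t * indicator {a<..<b} t \<partial>leb T)"
proof (rule integral_dominated_convergence[where w = "\<lambda>t. \<bar>w t\<bar>"])
  have bm: "bump j a b \<in> borel_measurable (leb T)" for j
    by (intro borel_measurable_leb borel_measurable_continuous_onI smooth_continuous bump_smooth)
  show "(\<lambda>t. w t * bump j a b t) \<in> borel_measurable (leb T)" for j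
    by (intro borel_measurable_times borel_measurable_integrable[OF assms] bm)
  have im: "indicator {a<..<b} \<in> borel_measurable (leb T)" by (rule borel_measurable_leb) simp
  show "(\<lambda>t. w t * indicator {a<..<b} t) \<in> borel_measurable (leb T)"
    by (intro borel_measurable_times borel_measurable_integrable[OF assms] im)
  show "integrable (leb T) (\<lambda>t. \<bar>w t\<bar>)" using assms by simp
  show "AE t in leb T. (\<lambda>j. w t * bump j a b t) \<longlonglongrightarrow> w t * indicator {a<..<b} t"
    by (intro AE_I2 tendsto_mult_left bump_tendsto)
  show "AE t in leb T. norm (w t * bump j a b t) \<le> \<bar>w t\<bar>" for j
    using bump_le_1 by (intro AE_I2) (simp add: abs_mult mult_left_le)
qed

text \<open>To the right of b the primitive from 0 is constant and equal to the full integral; mean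
  zero makes this 0 and the support compact.\<close>

lemma primitive_test_fun:
  assumes "smooth \<psi>" "0 < a" "a \<le> b" "b < T" "\<And>t. t \<notin> {a..b} \<Longrightarrow> \<psi> t = 0"
    and int0: "(\<integral>t. \<psi> t \<partial>leb T) = 0"
  obtains \<phi> where "\<phi> \<in> test_fun T" "deriv \<phi> = \<psi>"
proof -
  define \<phi> where "\<phi> t = integral {0..t} \<psi>" for t
  have cont: "continuous_on A \<psi>" for A using assms(1) by (rule smooth_continuous)
  have ii: "\<psi> integrable_on {x..y}" for x y by (intro integrable_continuous_interval cont)
  have low: "\<phi> t = 0" if "t < a" for t
  proof -
    have "integral {0..t} \<psi> = integral {0..t} (\<lambda>_. 0)"
      by (rule integral_cong) (use that assms(5) in auto)
    thus ?thesis unfolding \<phi>_def by simp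
  qed
  have D: "(\<phi> has_real_derivative \<psi> t) (at t)" for t
  proof (cases "t < a")
    case True
    have "((\<lambda>_. 0) has_real_derivative \<psi> t) (at t)" using True assms(5)[of t] by simp
    moreover have "eventually (\<lambda>y. 0 = \<phi> y) (nhds t)"
      using eventually_nhds_in_open[of "{..<a}" t] True low by (auto elim!: eventually_mono)
    ultimately show ?thesis by (subst (asm) DERIV_cong_ev[OF refl _ refl]) auto
  next
    case False
    hence t: "t \<in> {0<..<t + 1}" using assms by auto
    have "(\<phi> has_real_derivative \<psi> t) (at t within {0..t + 1})"
      unfolding \<phi>_def using t by (intro integral_has_real_derivative cont) auto
    moreover have "at t within {0..t + 1} = at t" using t by (intro at_within_Icc_at) auto
    ultimately show ?thesis by simp
  qed
  have intT: "integral {0..T} \<psi> = 0"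
  proof -
    have "integrable (leb T) \<psi>" by (intro L2_integrable L2_continuous cont)
    hence "(\<integral>t. \<psi> t \<partial>leb T) = integral {0<..<T} \<psi>" by (rule lebesgue_integral_eq_integral) auto
    thus ?thesis using int0 integral_open_interval_real[of 0 T \<psi>] by simp
  qed
  have high: "\<phi> t = 0" if "b < t" for t
  proof -
    have z: "integral {x..y} \<psi> = 0" if "b < x" for x y
    proof -
      have "integral {x..y} \<psi> = integral {x..y} (\<lambda>_. 0)"
        by (rule integral_cong) (use that assms(5) in auto)
      thus ?thesis by simp
    qed
    show ?thesis
    proof (cases "t \<le> T")
      case True
      have "integral {0..t} \<psi> + integral {t..T} \<psi> = integral {0..T} \<psi>"
        using True that assms by (intro Henstock_Kurzweil_Integration.integral_combine ii) auto
      thus ?thesis using z[OF that] intT unfolding \<phi>_def by simp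
    next
      case False
      have "integral {0..T} \<psi> + integral {T..t} \<psi> = integral {0..t} \<psi>"
        using False that assms by (intro Henstock_Kurzweil_Integration.integral_combine ii) auto
      thus ?thesis using z[of T t] assms intT unfolding \<phi>_def by simp
    qed
  qed
  have "\<phi> \<in> test_fun T"
    unfolding test_fun_iff
  proof (intro conjI exI)
    show "smooth \<phi>" using assms(1) D by (rule smooth_primitive)
    show "compact {a..b}" by simp
    show "{a..b} \<subseteq> {0<..<T}" using assms by auto
    show "\<forall>t. t \<notin> {a..b} \<longrightarrow> \<phi> t = 0" using low high by auto
  qed
  moreover have "deriv \<phi> = \<psi>" using DERIV_imp_deriv[OF D] by (rule ext)
  ultimately show ?thesis using that by blast
qed

section \<open>The lemma of du Bois-Reymond\<close>

text \<open>Lebesgue differentiation: off a negligible set f is the limit of its means over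
  [x, x + h], all of which are 0.\<close>

lemma AE_zero_if_interval_integrals_zero:
  assumes f: "integrable (leb T) f"
    and 0: "\<And>a b. 0 < a \<Longrightarrow> a < b \<Longrightarrow> b < T \<Longrightarrow> (\<integral>t. f t * indicator {a<..<b} t \<partial>leb T) = 0"
  shows "AE t in leb T. f t = (0::real)"
proof -
  define F where "F t = indicator {0<..<T} t *\<^sub>R f t" for t
  have F: "integrable lebesgue F"
    using f unfolding F_def by (subst (asm) integrable_restrict_space) auto
  have FU: "F integrable_on UNIV" using F by (rule integrable_on_lebesgue)
  obtain N where N: "negligible N"
    "\<And>x e. x \<notin> N \<Longrightarrow> 0 < e \<Longrightarrow> \<exists>d>0. \<forall>h. 0 < h \<and> h < d \<longrightarrow>
       norm (integral (cbox x (x + h *\<^sub>R One)) F /\<^sub>R h ^ DIM(real) - F x) < e"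
    by (rule integrable_ccontinuous_explicit[of F, OF integrable_on_subcbox[OF FU subset_UNIV]]) (rule that; assumption)
  have int0: "integral {a..b} F = 0" if "0 < a" "a < b" "b < T" for a b
  proof -
    have i: "integrable lebesgue (\<lambda>t. indicator {a<..<b} t *\<^sub>R F t)"
      by (rule integrable_mult_indicator[OF _ F]) simp
    have "0 = (\<integral>t. f t * indicator {a<..<b} t \<partial>leb T)" using 0[OF that] by simp
    also have "\<dots> = (\<integral>t. indicator {a<..<b} t *\<^sub>R F t \<partial>lebesgue)"
      by (subst integral_restrict_space) (auto simp: F_def mult_ac)
    also have "\<dots> = integral {a<..<b} F"
      using set_lebesgue_integral_eq_integral(2)[of "{a<..<b}" F] i
      unfolding set_integrable_def set_lebesgue_integral_def by simp
    finally show ?thesis by (simp add: integral_open_interval_real)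
  qed
  have Fx: "F x = 0" if x: "x \<in> {0<..<T}" "x \<notin> N" for x
  proof (rule ccontr)
    assume "F x \<noteq> 0"
    then obtain d where d: "d > 0" "\<And>h. 0 < h \<Longrightarrow> h < d \<Longrightarrow>
       norm (integral (cbox x (x + h *\<^sub>R One)) F /\<^sub>R h ^ DIM(real) - F x) < \<bar>F x\<bar>"
      using N(2)[OF x(2), of "\<bar>F x\<bar>"] by auto
    define h where "h = min (d / 2) ((T - x) / 2)"
    have h: "0 < h" "h < d" "x + h < T" using d(1) x unfolding h_def by (auto simp: min_def field_simps)
    have "integral {x..x + h} F = 0" by (rule int0) (use x h in auto)
    thus False using d(2)[OF h(1,2)] by simp
  qed
  have "N \<in> null_sets lebesgue" using N(1) by (simp add: negligible_iff_null_sets)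
  hence "AE t in lebesgue. t \<notin> N" by (rule AE_not_in)
  hence "AE t in lebesgue. t \<in> {0<..<T} \<longrightarrow> f t = 0"
  proof eventually_elim
    case (elim t)
    show ?case
    proof
      assume "t \<in> {0<..<T}"
      thus "f t = 0" using Fx[of t] elim unfolding F_def by simp
    qed
  qed
  thus ?thesis by (subst AE_restrict_space_iff) auto
qed

text \<open>A bump minus the multiple of one fixed bump \<psi> with the same integral is the
  derivative of a test function. Hence w pairs with every bump as the constant c does, and the limit
  of bumps extends this to intervals.\<close>

lemma du_Bois_Reymond:
  assumes T: "T > 0" and w: "w \<in> L2 T"
    and weak: "\<And>\<phi>. \<phi> \<in> test_fun T \<Longrightarrow> L2_inner T w (deriv \<phi>) = 0"
  shows "\<exists>c. AE t in leb T. w t = c"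
proof -
  have w1: "integrable (leb T) w" using w by (rule L2_integrable)
  have one: "integrable (leb T) (\<lambda>t. 1::real)" using L2_integrable[OF L2_const] .
  have len: "(\<integral>t. 1 * indicator {a<..<b} t \<partial>leb T) = b - a" if "0 \<le> a" "a \<le> b" "b \<le> T" for a b :: real
    by (rule integral_leb_FTC(1)[where F = "\<lambda>t. t"]) (use that in auto)
  have bL2: "bump j a b \<in> L2 T" for j a b
    by (intro L2_continuous smooth_continuous bump_smooth)
  \<comment> \<open>These integrals tend to T / 3, so some steepness gives a reference bump of
    positive integral.\<close>
  have "(\<lambda>j. \<integral>t. 1 * bump j (T/3) (2*T/3) t \<partial>leb T) \<longlonglongrightarrow> 2 * T / 3 - T / 3"
  proof -
    have le: "(\<integral>t. 1 * indicator {T/3<..<2*T/3} t \<partial>leb T) = 2 * T / 3 - T / 3"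
      by (rule len) (use T in auto)
    show ?thesis unfolding le[symmetric] by (rule integral_bump_tendsto[OF one])
  qed
  hence "eventually (\<lambda>j. 0 < (\<integral>t. 1 * bump j (T/3) (2*T/3) t \<partial>leb T)) sequentially"
    by (rule order_tendstoD(1)) (use T in simp)
  then obtain j0 where j0: "0 < (\<integral>t. bump j0 (T/3) (2*T/3) t \<partial>leb T)"
    by (auto simp: eventually_sequentially)
  define \<psi> where "\<psi> = bump j0 (T/3) (2*T/3)"
  define I where "I = (\<integral>t. \<psi> t \<partial>leb T)"
  define c where "c = (\<integral>t. w t * \<psi> t \<partial>leb T) / I"
  have I: "I > 0" using j0 unfolding I_def \<psi>_def .
  have \<psi>L2: "\<psi> \<in> L2 T" unfolding \<psi>_def by (rule bL2)
  have bump_eq: "(\<integral>t. w t * bump j a b t \<partial>leb T) = c * (\<integral>t. 1 * bump j a b t \<partial>leb T)"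
    if ab: "0 < a" "a < b" "b < T" for j a b
  proof -
    define J where "J = (\<integral>t. bump j a b t \<partial>leb T)"
    define \<eta> where "\<eta> t = bump j a b t + (- J / I) * \<psi> t" for t
    have \<eta>: "smooth \<eta>" unfolding \<eta>_def \<psi>_def by (intro smooth_add_cmult bump_smooth)
    have "(\<integral>t. \<eta> t \<partial>leb T) = J + (- J / I) * I"
      unfolding \<eta>_def J_def I_def using L2_integrable[OF bL2] L2_integrable[OF \<psi>L2]
      by (subst Bochner_Integration.integral_add) auto
    hence \<eta>0: "(\<integral>t. \<eta> t \<partial>leb T) = 0" using I by simp
    have out: "\<eta> t = 0" if "t \<notin> {min a (T/3)..max b (2*T/3)}" for t
    proof -
      have "t \<notin> {a<..<b}" "t \<notin> {T/3<..<2*T/3}" using that by auto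
      thus ?thesis unfolding \<eta>_def \<psi>_def by (simp add: bump_outside)
    qed
    obtain \<phi> where "\<phi> \<in> test_fun T" "deriv \<phi> = \<eta>"
      by (rule primitive_test_fun[OF \<eta> _ _ _ out \<eta>0]) (use ab T in \<open>auto simp: min_def max_def\<close>)
    hence "0 = L2_inner T w \<eta>" using weak by force
    also have "\<dots> = L2_inner T w (bump j a b) + (- J / I) * L2_inner T w \<psi>"
      unfolding \<eta>_def L2_inner_add_right[OF bL2 L2_cmult[OF \<psi>L2] w] L2_inner_cmult_right ..
    finally show ?thesis unfolding c_def L2_inner_def J_def using I by simp
  qed
  have "AE t in leb T. w t - c = 0"
  proof (rule AE_zero_if_interval_integrals_zero)
    show "integrable (leb T) (\<lambda>t. w t - c)" using w by (intro L2_integrable L2_diff L2_const)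
    fix a b assume ab: "0 < a" "a < b" "b < T"
    have "(\<lambda>j. \<integral>t. w t * bump j a b t \<partial>leb T) \<longlonglongrightarrow> (\<integral>t. w t * indicator {a<..<b} t \<partial>leb T)"
      by (rule integral_bump_tendsto[OF w1])
    moreover have "(\<lambda>j. \<integral>t. w t * bump j a b t \<partial>leb T) \<longlonglongrightarrow> c * (\<integral>t. 1 * indicator {a<..<b} t \<partial>leb T)"
      unfolding bump_eq[OF ab] by (intro tendsto_mult_left integral_bump_tendsto[OF one])
    ultimately have "(\<integral>t. w t * indicator {a<..<b} t \<partial>leb T) = c * (\<integral>t. 1 * indicator {a<..<b} t \<partial>leb T)"
      by (rule LIMSEQ_unique)
    moreover have "integrable (leb T) (\<lambda>t. w t * indicator {a<..<b} t)" "integrable (leb T) (\<lambda>t. c * (1 * indicator {a<..<b} t))"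
      using L2_mult_integrable[OF w indicator_L2, of "{a<..<b}"] L2_integrable[OF indicator_L2, of "{a<..<b}" T]
      by auto
    moreover have "(w t - c) * indicator {a<..<b} t = w t * indicator {a<..<b} t - c * (1 * indicator {a<..<b} t)" for t
      by (simp add: left_diff_distrib)
    ultimately show "(\<integral>t. (w t - c) * indicator {a<..<b} t \<partial>leb T) = 0"
      by (simp only: Bochner_Integration.integral_diff integral_mult_right_zero diff_self)
  qed
  thus ?thesis by (intro exI[of _ c]) auto
qed

section \<open>Primitives and weak derivatives\<close>

text \<open>The integral of g from 0 to t, written as a pairing so that Cauchy-Schwarz and
  invariance under null sets apply directly. It is 0 for t \<le> 0 and constant for t \<ge>
  T.\<close>

definition prim :: "real \<Rightarrow> (real \<Rightarrow> real) \<Rightarrow> real \<Rightarrow> real" where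
  "prim T g t = L2_inner T g (indicator {..<t})"

lemma prim_diff:
  assumes "g \<in> L2 T" "s \<le> t"
  shows "prim T g t - prim T g s = L2_inner T g (indicator {s<..<t})"
proof -
  have "prim T g t - prim T g s = L2_inner T g (\<lambda>r. indicator {..<t} r - indicator {..<s} r)"
    unfolding prim_def using assms by (simp add: L2_inner_diff_right indicator_L2)
  also have "\<dots> = L2_inner T g (indicator {s<..<t})"
  proof (rule L2_inner_cong_AE)
    have "AE r in leb T. r \<notin> {s}" by (rule AE_leb_not_finite) simp
    thus "AE r in leb T. indicator {..<t} r - indicator {..<s} r = (indicator {s<..<t} r :: real)"
      by eventually_elim (use assms(2) in \<open>auto split: split_indicator\<close>)
  qed (use assms(1) in \<open>auto simp: indicator_L2\<close>)
  finally show ?thesis .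
qed

lemma inner_indicator_interval:
  assumes "0 \<le> a" "a \<le> b" "b \<le> T"
  shows "L2_inner T (indicator {a<..<b}) (indicator {a<..<b}) = b - a"
proof -
  have "L2_inner T (indicator {a<..<b}) (indicator {a<..<b}) = (\<integral>t. 1 * indicator {a<..<b} t \<partial>leb T)"
    unfolding L2_inner_def by (intro leb_integral_cong) (auto split: split_indicator)
  also have "\<dots> = b - a"
    by (rule integral_leb_FTC(1)[where F = "\<lambda>t. t"]) (use assms in auto)
  finally show ?thesis .
qed

text \<open>Cauchy-Schwarz against the indicator of (s, t) gives Hoelder continuity of order 1 /
  2.\<close>

lemma prim_continuous:
  assumes g: "g \<in> L2 T" shows "continuous_on {0..T} (prim T g)"
proof -
  have le: "\<bar>prim T g t - prim T g s\<bar> \<le> L2_norm T g * sqrt \<bar>t - s\<bar>" if "s \<in> {0..T}" "t \<in> {0..T}" "s \<le> t" for s t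
  proof -
    have "\<bar>prim T g t - prim T g s\<bar> \<le> L2_norm T g * L2_norm T (indicator {s<..<t})"
      unfolding prim_diff[OF g that(3)] by (intro L2_Cauchy_Schwarz g indicator_L2) simp
    also have "L2_norm T (indicator {s<..<t}) = sqrt (t - s)"
      unfolding L2_norm_def using that by (simp add: inner_indicator_interval)
    finally show ?thesis using that(3) by simp
  qed
  have le': "\<bar>prim T g t - prim T g s\<bar> \<le> L2_norm T g * sqrt \<bar>t - s\<bar>" if "s \<in> {0..T}" "t \<in> {0..T}" for s t
    using le[of s t] le[of t s] that by (cases "s \<le> t") (auto simp: abs_minus_commute)
  show ?thesis
    unfolding continuous_on_def
  proof
    fix s assume s: "s \<in> {0..T}"
    show "(prim T g \<longlongrightarrow> prim T g s) (at s within {0..T})"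
    proof (rule LIM_zero_cancel, rule Lim_null_comparison)
      show "\<forall>\<^sub>F t in at s within {0..T}. norm (prim T g t - prim T g s) \<le> L2_norm T g * sqrt \<bar>t - s\<bar>"
        unfolding eventually_at_filter using le'[OF s] by (auto intro!: always_eventually)
      have "((\<lambda>t. L2_norm T g * sqrt \<bar>t - s\<bar>) \<longlongrightarrow> L2_norm T g * sqrt \<bar>s - s\<bar>) (at s within {0..T})"
        by (intro tendsto_intros)
      thus "((\<lambda>t. L2_norm T g * sqrt \<bar>t - s\<bar>) \<longlongrightarrow> 0) (at s within {0..T})" by simp
    qed
  qed
qed

lemma prim_L2 [simp]: "g \<in> L2 T \<Longrightarrow> prim T g \<in> L2 T"
  by (rule L2_continuous, rule prim_continuous)

lemma L2_norm_power2_integral: "(L2_norm T f)\<^sup>2 = (\<integral>t. (f t)\<^sup>2 \<partial>leb T)"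
  unfolding L2_norm_power2 L2_inner_def by (simp add: power2_eq_square)

lemma prim_0: "prim T g 0 = 0"
proof -
  have "prim T g 0 = (\<integral>t. 0 \<partial>leb T)"
    unfolding prim_def L2_inner_def by (intro leb_integral_cong) auto
  thus ?thesis by simp
qed

lemma borel_measurable_leb_id [measurable]: "(\<lambda>x. x) \<in> borel_measurable (leb T)"
  by (rule borel_measurable_leb) simp

text \<open>Fubini on the triangle s < t takes the place of the product rule, since
  \<open>prim T g\<close> need not be differentiable.\<close>

lemma inner_prim_parts:
  assumes T: "T > 0" and g: "g \<in> L2 T"
    and D: "\<And>t. t \<in> {0..T} \<Longrightarrow> (\<phi> has_real_derivative \<phi>' t) (at t)"
    and cont: "continuous_on {0..T} \<phi>'"
  shows "L2_inner T (prim T g) \<phi>' = L2_inner T g (\<lambda>s. \<phi> T - \<phi> s)"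
proof -
  interpret finite_measure "leb T" by (rule finite_measure_leb)
  interpret pair_sigma_finite "leb T" "leb T" by unfold_locales
  have [measurable]: "g \<in> borel_measurable (leb T)" "\<phi>' \<in> borel_measurable (leb T)"
    using g L2_continuous[OF cont] by (auto intro: L2_measurable)
  have "compact (\<phi>' ` {0..T})" using cont by (intro compact_continuous_image) auto
  then obtain B where B: "\<And>t. t \<in> {0..T} \<Longrightarrow> \<bar>\<phi>' t\<bar> \<le> B"
    using compact_imp_bounded[of "\<phi>' ` {0..T}"] unfolding bounded_iff by force
  define f where "f s t = g s * (if s < t then \<phi>' t else 0)" for s t
  have "integrable (leb T \<Otimes>\<^sub>M leb T) (\<lambda>(s, t). B * g s)"
  proof (rule Fubini_integrable)
    show "integrable (leb T) (\<lambda>x. \<integral>y. norm (case (x, y) of (s, t) \<Rightarrow> B * g s) \<partial>leb T)"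
      using L2_integrable[OF g] by (auto simp: abs_mult)
  qed (auto)
  hence fint: "integrable (leb T \<Otimes>\<^sub>M leb T) (case_prod f)"
  proof (rule Bochner_Integration.integrable_bound)
    show "case_prod f \<in> borel_measurable (leb T \<Otimes>\<^sub>M leb T)"
      unfolding f_def by measurable
    show "AE x in leb T \<Otimes>\<^sub>M leb T. norm (case_prod f x) \<le> norm (case x of (s, t) \<Rightarrow> B * g s)"
    proof (rule AE_I2, clarify)
      fix s t assume "(s, t) \<in> space (leb T \<Otimes>\<^sub>M leb T)"
      hence "t \<in> {0..T}" by (auto simp: space_pair_measure)
      hence "\<bar>if s < t then \<phi>' t else 0\<bar> \<le> \<bar>B\<bar>" using B[of t] by auto
      thus "norm (f s t) \<le> norm (B * g s)"
        unfolding f_def by (simp add: abs_mult mult.commute[of "\<bar>B\<bar>"] mult_left_mono)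
    qed
  qed
  have "(\<integral>t. (\<integral>s. f s t \<partial>leb T) \<partial>leb T) = L2_inner T (prim T g) \<phi>'"
    unfolding L2_inner_def prim_def
  proof (intro leb_integral_cong refl)
    fix t
    have "(\<integral>s. f s t \<partial>leb T) = (\<integral>s. (g s * indicator {..<t} s) * \<phi>' t \<partial>leb T)"
      unfolding f_def by (intro leb_integral_cong) (auto split: split_indicator)
    thus "(\<integral>s. f s t \<partial>leb T) = (\<integral>s. g s * indicator {..<t} s \<partial>leb T) * \<phi>' t" by simp
  qed
  moreover have "(\<integral>s. (\<integral>t. f s t \<partial>leb T) \<partial>leb T) = L2_inner T g (\<lambda>s. \<phi> T - \<phi> s)"
    unfolding L2_inner_def
  proof (intro leb_integral_cong refl)
    fix s assume "s \<in> space (leb T)"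
    hence s: "0 < s" "s < T" by auto
    have "(\<integral>t. f s t \<partial>leb T) = (\<integral>t. g s * (\<phi>' t * indicator {s<..<T} t) \<partial>leb T)"
      unfolding f_def by (intro leb_integral_cong) (auto split: split_indicator)
    also have "\<dots> = g s * (\<phi> T - \<phi> s)"
    proof -
      have "(\<integral>t. \<phi>' t * indicator {s<..<T} t \<partial>leb T) = \<phi> T - \<phi> s"
        by (rule integral_leb_FTC(1)) (use s D in \<open>auto intro: continuous_on_subset[OF cont]\<close>)
      thus ?thesis by simp
    qed
    finally show "(\<integral>t. f s t \<partial>leb T) = g s * (\<phi> T - \<phi> s)" .
  qed
  ultimately show ?thesis using Fubini_integral[OF fint] by simp
qed

text \<open>Integration by parts shows that u - \<open>prim T g\<close> annihilates the derivatives
  of all test functions.\<close>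

lemma weak_deriv_primitive:
  assumes T: "T > 0" and u: "u \<in> L2 T" and g: "g \<in> L2 T" and weak: "has_weak_deriv T u g"
  shows "\<exists>C. AE t in leb T. u t = C + prim T g t"
proof -
  have "\<exists>C. AE t in leb T. u t - prim T g t = C"
  proof (rule du_Bois_Reymond[OF T])
    show "(\<lambda>t. u t - prim T g t) \<in> L2 T" using u g by simp
    fix \<phi> assume \<phi>: "\<phi> \<in> test_fun T"
    then obtain K where sm: "smooth \<phi>" and K: "K \<subseteq> {0<..<T}" "\<And>t. t \<notin> K \<Longrightarrow> \<phi> t = 0"
      unfolding test_fun_iff by blast
    have cont: "continuous_on {0..T} (deriv \<phi>)" "continuous_on {0..T} \<phi>"
      using sm by (auto intro: smooth_continuous smooth_deriv)
    have "\<phi> T = 0" using K by force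
    have "L2_inner T (prim T g) (deriv \<phi>) = L2_inner T g (\<lambda>s. \<phi> T - \<phi> s)"
      by (rule inner_prim_parts[OF T g _ cont(1)]) (rule smooth_DERIV[OF sm])
    also have "(\<lambda>s. \<phi> T - \<phi> s) = (\<lambda>s. (-1) * \<phi> s)" using \<open>\<phi> T = 0\<close> by simp
    also have "L2_inner T g (\<lambda>s. (-1) * \<phi> s) = - L2_inner T g \<phi>"
      unfolding L2_inner_cmult_right by simp
    finally show "L2_inner T (\<lambda>t. u t - prim T g t) (deriv \<phi>) = 0"
      using weak \<phi> u g L2_continuous[OF cont(1)] unfolding has_weak_deriv_def by (simp add: L2_inner_diff_left)
  qed
  then obtain C where "AE t in leb T. u t - prim T g t = C" by blast
  hence "AE t in leb T. u t = C + prim T g t" by eventually_elim auto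
  thus ?thesis by blast
qed

lemma weak_deriv_some:
  assumes "\<exists>g\<in>L2 T. has_weak_deriv T u g"
  shows "weak_deriv T u \<in> L2 T" "has_weak_deriv T u (weak_deriv T u)"
  using someI_ex[of "\<lambda>g. g \<in> L2 T \<and> has_weak_deriv T u g"] assms unfolding weak_deriv_def by blast+

section \<open>Approximation by piecewise constants\<close>

context mesh
begin

lemma AE_pw_step_one: "AE t in leb T. pw_step (\<lambda>_. 1) t = 1"
  using AE_in_cell by eventually_elim (use pw_step_cell in auto)

lemma integral_cells:
  fixes f :: "real \<Rightarrow> real"
  assumes f: "integrable (leb T) f"
  shows "(\<Sum>i<n. \<integral>t. f t * ind i t \<partial>leb T) = (\<integral>t. f t \<partial>leb T)"
proof -
  have m: "(ind i :: real \<Rightarrow> real) \<in> borel_measurable (leb T)" for i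
    unfolding cell_def by (rule indicator_borel_leb) simp
  have i: "integrable (leb T) (\<lambda>t. f t * ind i t)" for i
    by (rule Bochner_Integration.integrable_bound[OF f])
       (use f m in \<open>auto intro!: borel_measurable_times split: split_indicator\<close>)
  have "(\<Sum>i<n. \<integral>t. f t * ind i t \<partial>leb T) = (\<integral>t. (\<Sum>i<n. f t * ind i t) \<partial>leb T)"
    using i by (subst Bochner_Integration.integral_sum) auto
  also have "\<dots> = (\<integral>t. f t \<partial>leb T)"
  proof (rule integral_cong_AE)
    show "(\<lambda>t. \<Sum>i<n. f t * ind i t) \<in> borel_measurable (leb T)"
      using i by (intro borel_measurable_sum) auto
    show "AE t in leb T. (\<Sum>i<n. f t * ind i t) = f t"
      using AE_pw_step_one
    proof eventually_elim
      case (elim t)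
      have "(\<Sum>i<n. f t * ind i t) = f t * pw_step (\<lambda>_. 1) t"
        unfolding pw_step_def sum_distrib_left by simp
      thus ?case using elim by simp
    qed
  qed (use f in auto)
  finally show ?thesis .
qed

lemma integral_pw_step: "(\<integral>t. pw_step a t \<partial>leb T) = h * (\<Sum>i<n. a i)"
proof -
  have "(\<integral>t. pw_step a t \<partial>leb T) = L2_inner T (\<lambda>t. 1) (pw_step a)" unfolding L2_inner_def by simp
  also have "\<dots> = L2_inner T (pw_step (\<lambda>_. 1)) (pw_step a)"
    using AE_pw_step_one by (intro L2_inner_cong_AE) auto
  finally show ?thesis unfolding inner_pw_step by simp
qed

text \<open>Common frame for the smoothness classes: a convenient step function replaces the best
  one, and a pointwise majorant K of its squared error is integrated.\<close>

lemma projection_error_le: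
  assumes u: "u \<in> L2 T" and K: "integrable (leb T) K"
    and le: "AE t in leb T. (u t - pw_step a t)\<^sup>2 \<le> K t" and I: "(\<integral>t. K t \<partial>leb T) \<le> c\<^sup>2" and c: "c \<ge> 0"
  shows "L2_norm T (\<lambda>t. u t - Q u t) \<le> c"
proof -
  have d: "(\<lambda>t. u t - pw_step a t) \<in> L2 T" using u by simp
  have "L2_norm T (\<lambda>t. u t - Q u t) \<le> L2_norm T (\<lambda>t. u t - pw_step a t)"
    using u by (intro Q_proj_best) auto
  also have "\<dots> \<le> c"
  proof (rule power2_le_imp_le[OF _ c])
    have "(L2_norm T (\<lambda>t. u t - pw_step a t))\<^sup>2 = (\<integral>t. (u t - pw_step a t)\<^sup>2 \<partial>leb T)"
      by (rule L2_norm_power2_integral)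
    also have "\<dots> \<le> (\<integral>t. K t \<partial>leb T)"
      using d K le by (intro integral_mono_AE) (auto simp: L2_def)
    finally show "(L2_norm T (\<lambda>t. u t - pw_step a t))\<^sup>2 \<le> c\<^sup>2" using I by simp
  qed
  finally show ?thesis .
qed

lemma inner_indicator_square_le:
  assumes f: "f \<in> L2 T" and A: "{a<..<b} \<subseteq> cell i" and ab: "0 \<le> a" "a \<le> b" "b \<le> T"
  shows "(L2_inner T f (indicator {a<..<b}))\<^sup>2 \<le> (b - a) * (\<integral>t. (f t)\<^sup>2 * ind i t \<partial>leb T)"
proof -
  define F where "F t = f t * ind i t" for t
  have F: "F \<in> L2 T"
    unfolding F_def by (rule L2_mult_bounded[OF f, where B = 1])
      (auto simp: cell_def indicator_borel_leb split: split_indicator)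
  have "L2_inner T f (indicator {a<..<b}) = L2_inner T F (indicator {a<..<b})"
    unfolding L2_inner_def F_def using A by (intro leb_integral_cong) (auto split: split_indicator)
  hence "\<bar>L2_inner T f (indicator {a<..<b})\<bar> \<le> L2_norm T F * L2_norm T (indicator {a<..<b})"
    using L2_Cauchy_Schwarz[OF F indicator_L2, of "{a<..<b}"] by simp
  hence "\<bar>L2_inner T f (indicator {a<..<b})\<bar>\<^sup>2 \<le> (L2_norm T F * L2_norm T (indicator {a<..<b}))\<^sup>2"
    by (rule power_mono) simp
  also have "\<dots> = (b - a) * L2_inner T F F"
    by (simp add: power_mult_distrib L2_norm_power2 inner_indicator_interval ab)
  also have "L2_inner T F F = (\<integral>t. (f t)\<^sup>2 * ind i t \<partial>leb T)"
    unfolding L2_inner_def F_def by (intro leb_integral_cong) (auto simp: power2_eq_square split: split_indicator)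
  finally show ?thesis by simp
qed

section \<open>Projection error by order of smoothness\<close>

text \<open>The comparison function takes the value of the primitive at the left node. In the
  squared error one factor h comes from the distance to this node, the other from integrating over
  the cell.\<close>

lemma projection_error_H1:
  assumes u: "u \<in> L2 T" and g: "g \<in> L2 T" and ug: "AE t in leb T. u t = C + prim T g t"
  shows "L2_norm T (\<lambda>t. u t - Q u t) \<le> h * L2_norm T g"
proof (rule projection_error_le[OF u])
  define E where "E i = (\<integral>t. (g t)\<^sup>2 * ind i t \<partial>leb T)" for i
  define a where "a i = C + prim T g (real i * h)" for i
  have E0: "E i \<ge> 0" for i unfolding E_def by (intro Bochner_Integration.integral_nonneg) auto
  show "integrable (leb T) (pw_step (\<lambda>i. h * E i))" by (intro L2_integrable) simp
  show "AE t in leb T. (u t - pw_step a t)\<^sup>2 \<le> pw_step (\<lambda>i. h * E i) t"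
    using ug AE_in_cell
  proof eventually_elim
    case (elim t)
    then obtain i where i: "i < n" "t \<in> cell i" by blast
    note ends = cell_ends[OF i(1)]
    have t: "real i * h < t" "t < real (Suc i) * h" using i(2) unfolding cell_def by auto
    have "u t - pw_step a t = prim T g t - prim T g (real i * h)"
      unfolding pw_step_cell[OF i] a_def elim(1) by simp
    also have "\<dots> = L2_inner T g (indicator {real i * h<..<t})"
      using t by (intro prim_diff g) auto
    finally have eq: "u t - pw_step a t = L2_inner T g (indicator {real i * h<..<t})" .
    have "(u t - pw_step a t)\<^sup>2 \<le> (t - real i * h) * E i"
      unfolding E_def eq
      by (rule inner_indicator_square_le[OF g]) (use t ends in \<open>auto simp: cell_def simp del: of_nat_Suc\<close>)
    also have "\<dots> \<le> h * E i" using t E0 by (intro mult_right_mono) (auto simp: algebra_simps)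
    finally show ?case unfolding pw_step_cell[OF i] .
  qed
  have "(\<integral>t. pw_step (\<lambda>i. h * E i) t \<partial>leb T) = h\<^sup>2 * (\<Sum>i<n. E i)"
    unfolding integral_pw_step by (simp add: sum_distrib_left power2_eq_square mult_ac)
  also have "(\<Sum>i<n. E i) = (\<integral>t. (g t)\<^sup>2 \<partial>leb T)"
    unfolding E_def by (rule integral_cells) (use g in \<open>simp add: L2_def\<close>)
  also have "\<dots> = (L2_norm T g)\<^sup>2" by (simp add: L2_norm_power2_integral)
  finally show "(\<integral>t. pw_step (\<lambda>i. h * E i) t \<partial>leb T) \<le> (h * L2_norm T g)\<^sup>2"
    by (simp add: power_mult_distrib)
  show "0 \<le> h * L2_norm T g" using h_pos by simp
qed

text \<open>With cell averages as comparison, h times the error at x is the integral of u x - u y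
  over the cell. Cauchy-Schwarz yields one factor h, and |x - y| < h inserts h^(1 + 2 s); dividing
  by h^2 leaves h^(2 s).\<close>

lemma projection_error_slobodeckij:
  assumes u: "u \<in> L2 T" and s: "0 < s"
    and int: "integrable (leb T \<Otimes>\<^sub>M leb T) (slob_integrand s u)"
  shows "L2_norm T (\<lambda>t. u t - Q u t)
    \<le> h powr s * sqrt (\<integral>p. slob_integrand s u p \<partial>(leb T \<Otimes>\<^sub>M leb T))"
proof (rule projection_error_le[OF u])
  interpret finite_measure "leb T" by (rule finite_measure_leb)
  interpret pair_sigma_finite "leb T" "leb T" by unfold_locales
  define S where "S x = (\<integral>y. slob_integrand s u (x, y) \<partial>leb T)" for x
  define a where "a i = L2_inner T u (ind i) / h" for i
  have nonneg: "0 \<le> slob_integrand s u p" for p unfolding slob_integrand_def by (auto split: prod.split)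
  have hp: "h powr (2 * s) = (h powr s)\<^sup>2" using powr_add[of h s s] by (simp add: power2_eq_square)
  show "integrable (leb T) (\<lambda>x. h powr (2 * s) * S x)"
    unfolding S_def using integrable_fst'[OF int] by simp
  show "AE x in leb T. (u x - pw_step a x)\<^sup>2 \<le> h powr (2 * s) * S x"
    using AE_integrable_fst'[OF int] AE_in_cell
  proof eventually_elim
    case (elim x)
    then obtain i where i: "i < n" "x \<in> cell i" by blast
    have w: "(\<lambda>y. u x - u y) \<in> L2 T" using u by simp
    have "h * (u x - pw_step a x) = L2_inner T (\<lambda>y. u x - u y) (ind i)"
    proof -
      have "L2_inner T (\<lambda>y. u x * 1) (ind i) = u x * h"
      proof -
        have "L2_inner T (\<lambda>y. 1) (ind i) = L2_inner T (ind i) (ind i)"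
          unfolding L2_inner_def by (intro leb_integral_cong) (auto split: split_indicator)
        thus ?thesis unfolding L2_inner_cmult_left using inner_indicator_cell[OF i(1) i(1)] by simp
      qed
      hence "L2_inner T (\<lambda>y. u x - u y) (ind i) = u x * h - L2_inner T u (ind i)"
        using u by (simp add: L2_inner_diff_left)
      thus ?thesis unfolding pw_step_cell[OF i] a_def using h_pos by (simp add: right_diff_distrib mult.commute)
    qed
    hence "(h * (u x - pw_step a x))\<^sup>2 \<le> h * (\<integral>y. (u x - u y)\<^sup>2 * ind i y \<partial>leb T)"
      using inner_indicator_square_le[OF w, of "real i * h" "real (Suc i) * h" i] cell_ends[OF i(1)]
      unfolding cell_def by (simp add: algebra_simps)
    also have "\<dots> \<le> h * (\<integral>y. h powr (1 + 2 * s) * slob_integrand s u (x, y) \<partial>leb T)"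
    proof (intro mult_left_mono integral_mono')
      show "integrable (leb T) (\<lambda>y. h powr (1 + 2 * s) * slob_integrand s u (x, y))" using elim(1) by simp
      fix y
      show "(u x - u y)\<^sup>2 * ind i y \<le> h powr (1 + 2 * s) * slob_integrand s u (x, y)"
      \<comment> \<open>On the diagonal the quotient is 0 by the convention for division by zero;
        the left side is 0 there as well.\<close>
      proof (cases "y \<in> cell i \<and> y \<noteq> x")
        case True
        have "\<bar>x - y\<bar> < h" using True i(2) unfolding cell_def by (auto simp: algebra_simps)
        hence p: "\<bar>x - y\<bar> powr (1 + 2 * s) \<le> h powr (1 + 2 * s)" using s by (intro powr_mono2) auto
        have "(u x - u y)\<^sup>2 = \<bar>x - y\<bar> powr (1 + 2 * s) * slob_integrand s u (x, y)"
          unfolding slob_integrand_def using True by simp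
        also have "\<dots> \<le> h powr (1 + 2 * s) * slob_integrand s u (x, y)"
          using p nonneg by (intro mult_right_mono) auto
        finally show ?thesis using True by simp
      next
        case False
        hence eq: "(u x - u y)\<^sup>2 * ind i y = 0" by (auto split: split_indicator)
        show ?thesis unfolding eq using nonneg by (intro mult_nonneg_nonneg) auto
      qed
      show "0 \<le> h powr (1 + 2 * s) * slob_integrand s u (x, y)"
        using nonneg by (intro mult_nonneg_nonneg) auto
    qed (use h_pos in simp)
    also have "\<dots> = h\<^sup>2 * (h powr (2 * s) * S x)"
      unfolding S_def using h_pos by (simp add: powr_add power2_eq_square)
    finally show ?case using h_pos by (simp add: power_mult_distrib)
  qed
  have "(\<integral>x. h powr (2 * s) * S x \<partial>leb T) = h powr (2 * s) * (\<integral>p. slob_integrand s u p \<partial>(leb T \<Otimes>\<^sub>M leb T))"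
    unfolding S_def using integral_fst'[OF int] by simp
  also have "\<dots> = (h powr s * sqrt (\<integral>p. slob_integrand s u p \<partial>(leb T \<Otimes>\<^sub>M leb T)))\<^sup>2"
    unfolding hp power_mult_distrib
    by (subst real_sqrt_pow2) (auto intro!: Bochner_Integration.integral_nonneg nonneg)
  finally show "(\<integral>x. h powr (2 * s) * S x \<partial>leb T) \<le> (h powr s * sqrt (\<integral>p. slob_integrand s u p \<partial>(leb T \<Otimes>\<^sub>M leb T)))\<^sup>2"
    by simp
  show "0 \<le> h powr s * sqrt (\<integral>p. slob_integrand s u p \<partial>(leb T \<Otimes>\<^sub>M leb T))"
    by (intro mult_nonneg_nonneg real_sqrt_ge_zero Bochner_Integration.integral_nonneg nonneg) auto
qed

text \<open>The cases follow the shape of the norm: no seminorm at s = 0, the double integral for 0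
  < s < 1, and the weak derivative at s = 1, where \<open>frac s\<close> is 0 again.\<close>

lemma projection_error_sobolev:
  assumes u: "u \<in> sobolev T s" and s: "s \<in> {0..1}"
  shows "L2_norm T (\<lambda>t. u t - Q u t) \<le> h powr s * sobolev_norm T s u"
proof -
  have uL: "u \<in> L2 T" using u unfolding sobolev_def by simp
  consider "s = 0" | "0 < s" "s < 1" | "s = 1" using s by fastforce
  thus ?thesis
  proof cases
    case 1
    have "L2_norm T (\<lambda>t. u t - Q u t) \<le> L2_norm T (\<lambda>t. u t - pw_step (\<lambda>_. 0) t)"
      using uL by (intro Q_proj_best) auto
    also have "\<dots> = L2_norm T u" unfolding pw_step_def by simp
    finally show ?thesis using 1 h_pos by (simp add: sobolev_norm_def)
  next
    case 2
    hence fl: "\<lfloor>s\<rfloor> = 0" "frac s = s" by (auto simp: floor_eq_iff frac_eq)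
    have int: "integrable (leb T \<Otimes>\<^sub>M leb T) (slob_integrand s u)"
      using u 2 fl unfolding sobolev_def by simp
    have "L2_norm T (\<lambda>t. u t - Q u t)
      \<le> h powr s * sqrt (\<integral>p. slob_integrand s u p \<partial>(leb T \<Otimes>\<^sub>M leb T))"
      by (rule projection_error_slobodeckij[OF uL _ int]) (use 2 in simp)
    also have "\<dots> \<le> h powr s * sobolev_norm T s u"
      unfolding sobolev_norm_def using 2 fl by (intro mult_left_mono real_sqrt_le_mono) auto
    finally show ?thesis .
  next
    case 3
    hence "\<exists>g\<in>L2 T. has_weak_deriv T u g" using u unfolding sobolev_def by auto
    note wd = weak_deriv_some[OF this]
    obtain C where C: "AE t in leb T. u t = C + prim T (weak_deriv T u) t"
      using weak_deriv_primitive[OF T_pos uL wd] by blast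
    have "L2_norm T (\<lambda>t. u t - Q u t) \<le> h * L2_norm T (weak_deriv T u)"
      by (rule projection_error_H1[OF uL wd(1) C])
    also have "\<dots> \<le> h * sobolev_norm T 1 u"
      using h_pos unfolding sobolev_norm_def by (intro mult_left_mono real_le_rsqrt) auto
    finally show ?thesis using 3 h_pos by simp
  qed
qed

end

section \<open>Completeness of the cosine modes\<close>

text \<open>At l = 0 truncated subtraction gives the right term: the mode of index -1 would be cos
  (- pi t / (2 T)), which is mode 0.\<close>

lemma cos_mode_shift:
  assumes "T \<noteq> 0"
  shows "cos (pi * t / T) * cos_mode T l t = 1/2 * cos_mode T (Suc l) t + 1/2 * cos_mode T (l - 1) t"
proof (cases l)
  case 0
  have "cos (pi * t / T) * cos (pi * t / T / 2) = (cos (pi * t / T / 2) + cos (3 * (pi * t / T / 2))) / 2"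
    by (subst cos_times_cos) (simp add: field_simps)
  moreover have "cos_mode T 0 t = cos (pi * t / T / 2)" "cos_mode T (Suc 0) t = cos (3 * (pi * t / T / 2))"
    using assms unfolding cos_mode_def by (auto intro!: arg_cong[where f = cos] simp: field_simps)
  ultimately show ?thesis using 0 by simp
next
  case (Suc m)
  define y where "y = (pi / 2 + real l * pi) * (t / T)"
  have "cos (pi * t / T) * cos y = (cos (y - pi * t / T) + cos (y + pi * t / T)) / 2"
    by (subst mult.commute, subst cos_times_cos) simp
  moreover have "y - pi * t / T = (pi / 2 + real m * pi) * (t / T)"
    "y + pi * t / T = (pi / 2 + real (Suc l) * pi) * (t / T)"
    using Suc unfolding y_def by (simp_all add: algebra_simps add_divide_distrib)
  ultimately show ?thesis using Suc unfolding cos_mode_def y_def by simp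
qed

text \<open>The span of the cosine modes is \<open>cos (\<theta> / 2)\<close> times the polynomials in \<open>cos \<theta>\<close>, where
  \<open>\<theta> = \<pi> t / T\<close>; the approximation theorem of Weierstrass applies after the substitution
  \<open>c = cos \<theta>\<close>.\<close>

lemma cos_modes_complete:
  assumes T: "T > 0" and f: "continuous_on {0..T} f" and 0: "\<And>l. L2_inner T f (cos_mode T l) = 0"
  shows "AE t in leb T. f t = 0"
proof -
  have fL: "f \<in> L2 T" using f by (rule L2_continuous)
  have pL: "(\<lambda>t. cos (pi * t / T) ^ m * cos_mode T l t) \<in> L2 T" for m l
    unfolding cos_mode_fun using T by (intro L2_continuous continuous_intros) auto
  \<comment> \<open>Multiplication by cos \<theta> maps the span of the modes into itself, so
    orthogonality passes to all powers of cos \<theta>.\<close>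
  have mono: "L2_inner T f (\<lambda>t. cos (pi * t / T) ^ m * cos_mode T l t) = 0" for m l
  proof (induction m arbitrary: l)
    case (Suc m)
    have "(\<lambda>t. cos (pi * t / T) ^ Suc m * cos_mode T l t)
       = (\<lambda>t. 1/2 * (cos (pi * t / T) ^ m * cos_mode T (Suc l) t) + 1/2 * (cos (pi * t / T) ^ m * cos_mode T (l - 1) t))"
    proof
      fix t
      have "cos (pi * t / T) ^ Suc m * cos_mode T l t = cos (pi * t / T) ^ m * (cos (pi * t / T) * cos_mode T l t)"
        by (simp add: mult_ac)
      also have "\<dots> = 1/2 * (cos (pi * t / T) ^ m * cos_mode T (Suc l) t) + 1/2 * (cos (pi * t / T) ^ m * cos_mode T (l - 1) t)"
        using T by (subst cos_mode_shift) (auto simp: algebra_simps)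
      finally show "cos (pi * t / T) ^ Suc m * cos_mode T l t
        = 1/2 * (cos (pi * t / T) ^ m * cos_mode T (Suc l) t) + 1/2 * (cos (pi * t / T) ^ m * cos_mode T (l - 1) t)" .
    qed
    thus ?case
      by (simp only: L2_inner_add_right[OF L2_cmult[OF pL] L2_cmult[OF pL] fL] L2_inner_cmult_right Suc)
  qed (use 0 in simp)
  \<comment> \<open>The factor cos (\<theta> / 2) is put into w, which is then orthogonal to every
    polynomial in cos \<theta>.\<close>
  define w where "w t = f t * cos_mode T 0 t" for t
  have w: "continuous_on {0..T} w" unfolding w_def cos_mode_fun by (intro continuous_intros f)
  hence wL: "w \<in> L2 T" by (rule L2_continuous)
  define F where "F c = w (T * arccos c / pi)" for c
  have F: "continuous_on {-1..1} F"
    unfolding F_def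
  proof (rule continuous_on_compose2[OF w])
    show "continuous_on {-1..1} (\<lambda>c. T * arccos c / pi)" by (intro continuous_intros) auto
    show "(\<lambda>c. T * arccos c / pi) ` {-1..1} \<subseteq> {0..T}"
    proof safe
      fix c :: real assume "c \<in> {-1..1}"
      hence a: "0 \<le> arccos c" "arccos c \<le> pi" using arccos[of c] by auto
      have "T * arccos c \<le> T * pi" using a T by (intro mult_left_mono) auto
      thus "T * arccos c / pi \<in> {0..T}" using a T by (auto simp: pos_divide_le_eq)
    qed
  qed
  \<comment> \<open>For such a polynomial q, ||w||^2 = <w, w - q>, so the norm of w is bounded by
    the uniform error.\<close>
  have small: "L2_norm T w \<le> e * L2_norm T (\<lambda>_. 1)" if e: "e > 0" for e
  proof -
    obtain p where p: "real_polynomial_function p" "\<And>c. c \<in> {-1..1} \<Longrightarrow> \<bar>F c - p c\<bar> < e"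
      using Stone_Weierstrass_real_polynomial_function[OF _ F e] by auto
    obtain a m where a: "p = (\<lambda>x. \<Sum>i\<le>m. a i * x ^ i)"
      using p(1) unfolding real_polynomial_function_iff_sum by blast
    define q where "q t = p (cos (pi * t / T))" for t
    have qL: "q \<in> L2 T"
      unfolding q_def a using T by (intro L2_continuous continuous_intros) auto
    have "L2_inner T w q = L2_inner T f (\<lambda>t. \<Sum>i\<le>m. a i * (cos (pi * t / T) ^ i * cos_mode T 0 t))"
      unfolding L2_inner_def w_def q_def a by (simp add: sum_distrib_left sum_distrib_right mult_ac)
    also have "\<dots> = 0"
      using pL fL by (simp add: L2_inner_sum_right mono)
    finally have "L2_inner T w w = L2_inner T w (\<lambda>t. w t - q t)"
      using wL qL by (simp add: L2_inner_diff_right)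
    also have "\<dots> \<le> L2_norm T w * L2_norm T (\<lambda>t. w t - q t)"
      using L2_Cauchy_Schwarz[OF wL L2_diff[OF wL qL]] by simp
    also have "L2_norm T (\<lambda>t. w t - q t) \<le> L2_norm T (\<lambda>t. e * 1)"
      unfolding L2_norm_def
    proof (intro real_sqrt_le_mono L2_inner_self_mono)
      show "AE t in leb T. (w t - q t)\<^sup>2 \<le> (e * 1)\<^sup>2"
      proof (rule AE_I2)
        fix t assume "t \<in> space (leb T)"
        hence t: "0 < t" "t < T" by auto
        have "pi * t / T \<le> pi" using t T by (simp add: field_simps)
        hence "arccos (cos (pi * t / T)) = pi * t / T" using t T by (intro arccos_cos) auto
        hence "F (cos (pi * t / T)) = w t" unfolding F_def using T by simp
        hence "\<bar>w t - q t\<bar> \<le> e" using p(2)[of "cos (pi * t / T)"] unfolding q_def by simp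
        hence "\<bar>w t - q t\<bar>\<^sup>2 \<le> e\<^sup>2" by (intro power_mono) auto
        thus "(w t - q t)\<^sup>2 \<le> (e * 1)\<^sup>2" by simp
      qed
    qed (use wL qL in auto)
    also have "L2_norm T (\<lambda>t. e * 1) = e * L2_norm T (\<lambda>_. 1)"
      unfolding L2_norm_cmult using e by simp
    finally have "L2_norm T w * L2_norm T w \<le> L2_norm T w * (e * L2_norm T (\<lambda>_. 1))"
      using mult_left_mono[OF _ L2_norm_nonneg] by (simp add: L2_norm_power2[symmetric] power2_eq_square)
    thus ?thesis using e
      by (cases "L2_norm T w = 0") (auto simp: mult_le_cancel_left order.strict_iff_order[of 0 "L2_norm T w"])
  qed
  have "L2_norm T w \<le> 0"
  proof (rule field_le_epsilon)
    fix e :: real assume e: "e > 0"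
    define N where "N = L2_norm T (\<lambda>_. 1) + 1"
    have N: "N > 0" "L2_norm T (\<lambda>_. 1) \<le> N" unfolding N_def using L2_norm_nonneg[of T "\<lambda>_. 1"] by linarith+
    have "L2_norm T w \<le> (e / N) * L2_norm T (\<lambda>_. 1)" using e N by (intro small) auto
    also have "\<dots> \<le> (e / N) * N" using e N by (intro mult_left_mono) auto
    finally show "L2_norm T w \<le> 0 + e" using N by simp
  qed
  hence "(L2_norm T w)\<^sup>2 = 0" using L2_norm_nonneg[of T w] by simp
  hence "(\<integral>t. (w t)\<^sup>2 \<partial>leb T) = 0" by (simp add: L2_norm_power2_integral)
  moreover have "integrable (leb T) (\<lambda>t. (w t)\<^sup>2)" using wL by (simp add: L2_def)
  ultimately have "AE t in leb T. (w t)\<^sup>2 = 0"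
    by (subst (asm) integral_nonneg_eq_0_iff_AE) auto
  moreover have "AE t in leb T. t \<in> {0<..<T}" using AE_space[of "leb T"] by simp
  ultimately show ?thesis
  proof eventually_elim
    case (elim t)
    \<comment> \<open>Mode 0 is positive on (0, T), so zeros of w are zeros of f.\<close>
    have "0 < pi / 2 * (t / T)" using elim(2) T by (intro mult_pos_pos divide_pos_pos) auto
    moreover have "pi / 2 * (t / T) < pi / 2 * 1" using elim(2) T by (intro mult_strict_left_mono) auto
    ultimately have "cos (pi / 2 * (t / T)) > 0" by (intro cos_gt_zero_pi) linarith+
    hence "cos_mode T 0 t > 0" unfolding cos_mode_def by simp
    thus ?case using elim(1) unfolding w_def by auto
  qed
qed

section \<open>Cosine series of continuous functions and of double primitives\<close>

text \<open>Absolute summability makes the series converge uniformly to a continuous U with the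
  coefficients of u, so completeness for continuous functions applies to U - u.\<close>

lemma cos_series_inner:
  assumes T: "T > 0" and u: "continuous_on {0..T} u" and G: "G \<in> L2 T"
    and sm: "summable (\<lambda>l. \<bar>fourier_cos T u l\<bar>)"
  shows "(\<lambda>l. fourier_cos T u l * L2_inner T (cos_mode T l) G) sums L2_inner T u G"
proof -
  define c where "c = fourier_cos T u"
  define S where "S N t = (\<Sum>l<N. c l * cos_mode T l t)" for N t
  define U where "U t = (\<Sum>l. c l * cos_mode T l t)" for t
  have ul: "uniform_limit {0..T} S U sequentially"
    unfolding S_def U_def
  proof (rule Weierstrass_m_test)
    show "norm (c l * cos_mode T l t) \<le> \<bar>c l\<bar>" for l t
      unfolding cos_mode_def by (simp add: abs_mult mult_left_le)
    show "summable (\<lambda>l. \<bar>c l\<bar>)" using sm unfolding c_def .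
  qed
  have Sc: "continuous_on {0..T} (S N)" for N
    unfolding S_def cos_mode_fun by (intro continuous_intros)
  have U: "continuous_on {0..T} U"
    by (rule uniform_limit_theorem[OF always_eventually ul]) (use Sc in auto)
  have uL: "u \<in> L2 T" and UL: "U \<in> L2 T" and SL: "S N \<in> L2 T" for N
    using u U Sc by (auto intro: L2_continuous)
  have lim: "(\<lambda>N. L2_norm T (\<lambda>t. U t - S N t)) \<longlonglongrightarrow> 0"
  proof (rule LIMSEQ_I)
    fix e :: real assume e: "e > 0"
    define N1 where "N1 = L2_norm T (\<lambda>_. 1) + 1"
    have N1: "N1 > 0" "L2_norm T (\<lambda>_. 1) < N1" unfolding N1_def using L2_norm_nonneg[of T "\<lambda>_. 1"] by linarith+
    have "e / N1 > 0" using e N1 by simp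
    then obtain N0 where N0: "\<And>N t. N \<ge> N0 \<Longrightarrow> t \<in> {0..T} \<Longrightarrow> dist (S N t) (U t) < e / N1"
      using uniform_limitD[OF ul] unfolding eventually_sequentially by blast
    have "norm (L2_norm T (\<lambda>t. U t - S N t) - 0) < e" if "N \<ge> N0" for N
    proof -
      have "L2_norm T (\<lambda>t. U t - S N t) \<le> L2_norm T (\<lambda>t. e / N1 * 1)"
        unfolding L2_norm_def
      proof (intro real_sqrt_le_mono L2_inner_self_mono AE_I2)
        fix t assume "t \<in> space (leb T)"
        hence "\<bar>U t - S N t\<bar> \<le> e / N1" using N0[OF that, of t] by (auto simp: dist_real_def abs_minus_commute)
        hence "\<bar>U t - S N t\<bar>\<^sup>2 \<le> (e / N1)\<^sup>2" by (intro power_mono) auto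
        thus "(U t - S N t)\<^sup>2 \<le> (e / N1 * 1)\<^sup>2" by simp
      qed (use UL SL in auto)
      also have "\<dots> = e / N1 * L2_norm T (\<lambda>_. 1)" unfolding L2_norm_cmult using e N1 by simp
      also have "\<dots> < e / N1 * N1" using e N1 by (intro mult_strict_left_mono) auto
      finally show ?thesis using N1 by simp
    qed
    thus "\<exists>no. \<forall>n\<ge>no. norm (L2_norm T (\<lambda>t. U t - S n t) - 0) < e" by blast
  qed
  have sums: "(\<lambda>l. c l * L2_inner T (cos_mode T l) G) sums L2_inner T U G" if G: "G \<in> L2 T" for G
  proof -
    have "(\<lambda>N. L2_inner T (S N) G) \<longlonglongrightarrow> L2_inner T U G" by (rule L2_inner_tendsto[OF SL UL G lim])
    thus ?thesis unfolding sums_def S_def using G by (simp add: L2_inner_sum_left)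
  qed
  have "AE t in leb T. U t - u t = 0"
  proof (rule cos_modes_complete[OF T])
    show "continuous_on {0..T} (\<lambda>t. U t - u t)" by (intro continuous_intros U u)
    fix l
    have "(\<lambda>k. c k * L2_inner T (cos_mode T k) (cos_mode T l)) sums L2_inner T U (cos_mode T l)"
      by (rule sums) simp
    moreover have "(\<lambda>k. c k * L2_inner T (cos_mode T k) (cos_mode T l)) = (\<lambda>k. if k = l then c l * (T / 2) else 0)"
      using orthogonal_systemD(2)[OF orthogonal_cos_mode[OF T]] by auto
    ultimately have "L2_inner T U (cos_mode T l) = c l * (T / 2)"
      using sums_single[of l "\<lambda>_. c l * (T / 2)"] sums_unique2 by fastforce
    also have "\<dots> = L2_inner T u (cos_mode T l)" using T unfolding c_def fourier_cos_eq by simp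
    finally show "L2_inner T (\<lambda>t. U t - u t) (cos_mode T l) = 0" using UL uL by (simp add: L2_inner_diff_left)
  qed
  hence "L2_inner T U G = L2_inner T u G"
    using UL uL G by (intro L2_inner_cong_AE) auto
  thus ?thesis using sums[OF G] unfolding c_def by simp
qed

lemma freq_T:
  assumes "T > 0" shows "cos (freq T l * T) = 0"
proof -
  have "freq T l * T = pi * real (Suc (2 * l)) / 2" using assms unfolding freq_def by (simp add: field_simps)
  thus ?thesis by (simp only: cos_pi_eq_zero)
qed

text \<open>Two integrations by parts. Subtracting the value at T removes the first boundary term,
  which carries sin (omega T); the second one vanishes because cos (omega T) = 0 and the inner
  primitive starts at 0.\<close>

lemma fourier_cos_second_primitive:
  assumes T: "T > 0" and g: "g \<in> L2 T"
  defines "W \<equiv> prim T g"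
  shows "fourier_cos T (\<lambda>t. prim T W t - prim T W T) l = - (fourier_cos T g l / (freq T l)\<^sup>2)"
proof -
  define w where "w = freq T l"
  have w: "w > 0" unfolding w_def using T by (rule freq_pos)
  have W: "W \<in> L2 T" unfolding W_def using g by simp
  define \<phi> where "\<phi> t = sin (w * t) / w" for t
  have \<phi>L: "\<phi> \<in> L2 T" unfolding \<phi>_def using L2_cmult[OF L2_sin[of w T], of "1 / w"] by simp
  have cm: "cos_mode T l = (\<lambda>t. cos (w * t))" unfolding cos_mode_fun w_def ..
  have "L2_inner T (prim T W) (cos_mode T l) = L2_inner T W (\<lambda>s. \<phi> T - \<phi> s)"
    unfolding cm \<phi>_def using w
    by (intro inner_prim_parts T W) (auto intro!: derivative_eq_intros continuous_intros)
  also have "\<dots> = \<phi> T * L2_inner T W (\<lambda>_. 1) - L2_inner T W \<phi>"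
    using L2_inner_diff_right[OF L2_const[of "\<phi> T"] \<phi>L W] L2_inner_cmult_right[of T W "\<phi> T" "\<lambda>_. 1"] by simp
  finally have 1: "L2_inner T (prim T W) (cos_mode T l) = \<phi> T * L2_inner T W (\<lambda>_. 1) - L2_inner T W \<phi>" .
  have "prim T W T = L2_inner T W (\<lambda>_. 1)"
    unfolding prim_def L2_inner_def by (intro leb_integral_cong) auto
  moreover have "L2_inner T (\<lambda>_. prim T W T) (cos_mode T l) = prim T W T * \<phi> T"
    unfolding L2_inner_def cm \<phi>_def using integral_leb_cos[OF T, of w] w by simp
  ultimately have "L2_inner T (\<lambda>t. prim T W t - prim T W T) (cos_mode T l) = - L2_inner T W \<phi>"
    using 1 W by (simp add: L2_inner_diff_left)
  also have "L2_inner T W \<phi> = 1 / w * L2_inner T W (\<lambda>t. sin (w * t))"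
    unfolding \<phi>_def using L2_inner_cmult_right[of T W "1 / w" "\<lambda>t. sin (w * t)"] by simp
  also have "L2_inner T W (\<lambda>t. sin (w * t)) = L2_inner T g (\<lambda>s. - cos (w * T) / w - (- cos (w * s) / w))"
    unfolding W_def using w
    by (intro inner_prim_parts T g) (auto intro!: derivative_eq_intros continuous_intros)
  also have "\<dots> = 1 / w * L2_inner T g (cos_mode T l)"
    unfolding cm using freq_T[OF T, of l] L2_inner_cmult_right[of T g "1 / w" "\<lambda>t. cos (w * t)"]
    by (simp add: w_def)
  finally show ?thesis unfolding fourier_cos_eq w_def[symmetric] by (simp add: power2_eq_square)
qed

section \<open>Superconvergence of the consistency error\<close>

context mesh
begin

text \<open>Since \<open>Q\<^sub>h\<close> is symmetric, the consistency error is the pairing of \<open>u\<close> with the projection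
  defect of \<open>H\<^sub>T v\<close>.\<close>

definition defect :: "(real \<Rightarrow> real) \<Rightarrow> real \<Rightarrow> real" where
  "defect v t = modHilbert T v t - Q (modHilbert T v) t"

lemma defect_L2 [simp]: "v \<in> L2 T \<Longrightarrow> defect v \<in> L2 T"
  unfolding defect_def[abs_def] using T_pos by (simp add: modHilbert_L2)

lemma inner_defect:
  assumes u: "u \<in> L2 T" and v: "v \<in> L2 T"
  shows "L2_inner T u (defect v) = L2_inner T u (modHilbert T v) - L2_inner T (Q u) (modHilbert T v)"
proof -
  note H = modHilbert_L2[OF T_pos v]
  have "L2_inner T u (Q (modHilbert T v)) = L2_inner T (Q u) (Q (modHilbert T v))"
    using Q_proj_inner[OF u Q_proj(1)[OF H]] by simp
  also have "\<dots> = L2_inner T (Q u) (modHilbert T v)"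
    using Q_proj_inner[OF H Q_proj(1)[OF u]] by (simp add: L2_inner_commute)
  finally show ?thesis unfolding defect_def using u H by (simp add: L2_inner_diff_right)
qed

text \<open>Constants are piecewise constant, so the additive constants in representations of u
  never reach the consistency error.\<close>

lemma inner_const_defect:
  assumes v: "v \<in> L2 T" shows "L2_inner T (\<lambda>_. c) (defect v) = 0"
proof -
  note H = modHilbert_L2[OF T_pos v]
  have "(\<lambda>_. c) \<in> pw_const T n" unfolding pw_const_iff by simp
  from Q_proj(2)[OF H this] show ?thesis unfolding defect_def[abs_def] by (simp add: L2_inner_commute)
qed

section \<open>The defect on single cosine modes\<close>

lemma fourier_cos_cos_mode: "fourier_cos T (cos_mode T l) k = (if k = l then 1 else 0)"
  unfolding fourier_cos_eq using orthogonal_systemD(2)[OF orthogonal_cos_mode[OF T_pos], of l k] T_pos by auto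

lemma inner_cos_mode_modHilbert:
  "L2_inner T (cos_mode T l) (modHilbert T (pw_step b)) = T / 2 * (sinc (halfang n l) * dst n b l)"
proof -
  have "(\<lambda>k. T / 2 * (fourier_cos T (cos_mode T l) k * fourier_sin T (pw_step b) k))
      sums L2_inner T (cos_mode T l) (modHilbert T (pw_step b))"
    using T_pos by (intro inner_modHilbert_sums) auto
  moreover have "(\<lambda>k. T / 2 * (fourier_cos T (cos_mode T l) k * fourier_sin T (pw_step b) k))
      = (\<lambda>k. if k = l then T / 2 * fourier_sin T (pw_step b) l else 0)"
    unfolding fourier_cos_cos_mode by auto
  ultimately have "L2_inner T (cos_mode T l) (modHilbert T (pw_step b)) = T / 2 * fourier_sin T (pw_step b) l"
    using sums_single[of l "\<lambda>_. T / 2 * fourier_sin T (pw_step b) l"] sums_unique2 by fastforce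
  thus ?thesis unfolding fourier_pw_step .
qed

text \<open>Averaging mode l over the cells gives sinc times \<epsilon> times the midpoint samples
  of mode k, so the cosine transform of the projected mode sits at the single index k. Here
  \<epsilon> is the sign of the alias.\<close>

lemma inner_Q_cos_mode_modHilbert:
  assumes k: "k < n"
    and \<epsilon>: "\<And>i. cos (halfang n l * real (2 * i + 1)) = \<epsilon> * cos (halfang n k * real (2 * i + 1))"
  shows "L2_inner T (Q (cos_mode T l)) (modHilbert T (pw_step b))
    = T / 2 * (sinc (halfang n l) * (\<epsilon> * alias_symbol (halfang n k) * dst n b k))"
proof -
  have Q: "Q (cos_mode T l) \<in> pw_const T n" by (rule Q_proj(1)) simp
  then obtain a where a: "AE t in leb T. Q (cos_mode T l) t = pw_step a t" by (rule pw_const_AE_pw_step)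
  have ind: "ind i \<in> pw_const T n" for i
    unfolding pw_const_iff
  proof (intro conjI allI impI exI)
    fix i'
    show "\<forall>t\<in>cell i'. ind i t = (if i' = i then 1 else 0 :: real)"
      using cell_disjoint[of _ i' i] by (auto split: split_indicator)
  qed simp
  have ai: "a i = sinc (halfang n l) * (\<epsilon> * cos (halfang n k * real (2 * i + 1)))" if i: "i < n" for i
  proof -
    have "h * a i = L2_inner T (ind i) (pw_step a)"
      unfolding inner_pw_step_right[OF ind_L2] using i
      by (simp add: inner_indicator_cell if_distrib cong: if_cong)
    also have "\<dots> = L2_inner T (Q (cos_mode T l)) (ind i)"
      unfolding L2_inner_commute[of T "ind i"] using a
      by (intro L2_inner_cong_AE) (auto elim: eventually_mono)
    also have "\<dots> = L2_inner T (cos_mode T l) (ind i)" by (intro Q_proj_inner ind) simp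
    also have "\<dots> = h * (sinc (halfang n l) * (\<epsilon> * cos (halfang n k * real (2 * i + 1))))"
      unfolding inner_cos_mode_cell[OF i] \<epsilon> ..
    finally show ?thesis using h_pos by simp
  qed
  have da: "dct n a k' = (if k' = k then sinc (halfang n l) * \<epsilon> else 0)" if k': "k' < n" for k'
  proof -
    have "dct n a k' = 2 / real n * (\<Sum>i<n. sinc (halfang n l) * \<epsilon> * (cos (halfang n k * real (2 * i + 1)) * cos (halfang n k' * real (2 * i + 1))))"
      unfolding dtrans_def by (intro arg_cong[where f = "(*) (2 / real n)"] sum.cong refl) (simp add: ai mult_ac)
    also have "\<dots> = 2 / real n * (sinc (halfang n l) * \<epsilon> * (if k = k' then real n / 2 else 0))"
      unfolding sum_distrib_left[symmetric] dtrans_orthogonal[OF n_pos k k' disjI1[OF refl]] ..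
    finally show ?thesis using n_pos by simp
  qed
  have "L2_inner T (Q (cos_mode T l)) (modHilbert T (pw_step b)) = L2_inner T (pw_step a) (modHilbert T (pw_step b))"
    using a T_pos by (intro L2_inner_cong_AE) (auto simp: modHilbert_L2)
  also have "\<dots> = T / 2 * (\<Sum>k'<n. if k' = k then alias_symbol (halfang n k) * (sinc (halfang n l) * \<epsilon> * dst n b k) else 0)"
    unfolding inner_pw_step_modHilbert
    by (intro arg_cong[where f = "(*) (T / 2)"] sum.cong refl) (simp add: da)
  finally show ?thesis using k by (simp add: mult_ac)
qed

lemma alias_cases:
  obtains j k where "k < n" "l = 2 * n * j + k" "j = l div (2 * n)"
  | j k where "k < n" "l = 2 * n * j + (2 * n - 1 - k)" "j = l div (2 * n)"
proof -
  define j m where "j = l div (2 * n)" and "m = l mod (2 * n)"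
  have l: "l = 2 * n * j + m" unfolding j_def m_def by simp
  have m: "m < 2 * n" unfolding m_def using n_pos by simp
  show ?thesis
  proof (cases "m < n")
    case True
    show ?thesis by (rule that(1)[OF True l j_def])
  next
    case False
    hence k: "2 * n - 1 - m < n" and mm: "m = 2 * n - 1 - (2 * n - 1 - m)" using m n_pos by auto
    have "l = 2 * n * j + (2 * n - 1 - (2 * n - 1 - m))" using l unfolding mm[symmetric] .
    thus ?thesis by (rule that(2)[OF k _ j_def])
  qed
qed

text \<open>Serves to trade 1 / x for x^2 / J^2, with J the block number counted from 1. The rough
  bound pi > 3 suffices: l \<ge> n settles the first block and l \<ge> 2 n j the others.\<close>

lemma halfang_ge_block:
  assumes "l \<ge> n" shows "real (Suc (l div (2 * n))) \<le> halfang n l"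
proof -
  define j where "j = l div (2 * n)"
  have "3 * real (2 * l + 1) \<le> pi * real (2 * l + 1)" using pi_gt3 by (intro mult_right_mono) auto
  moreover have "4 * real n * real (Suc j) \<le> 3 * real (2 * l + 1)"
  proof (cases "j = 0")
    case True
    thus ?thesis using assms by simp
  next
    case False
    have "j * (2 * n) \<le> l" unfolding j_def by (rule div_times_less_eq_dividend)
    hence "real (j * (2 * n)) \<le> real l" by (rule of_nat_mono)
    hence "4 * real n * real j \<le> 2 * real l" by (simp add: mult_ac)
    moreover have "4 * real n * 1 \<le> 4 * real n * real j" using False by (intro mult_left_mono) auto
    ultimately show ?thesis by (simp add: algebra_simps)
  qed
  ultimately have "4 * real n * real (Suc j) \<le> real (2 * l + 1) * pi" by (simp add: mult.commute)
  thus ?thesis unfolding halfang_def j_def using n_pos by (simp add: pos_le_divide_eq mult.commute)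
qed

text \<open>The factor x^2 is shaped to cancel 1 / omega^2 in the coefficients of u, the weight 3 /
  J^2 to be square summable over blocks. For l < n the bound comes from the symbol being near 1; for
  l \<ge> n nothing cancels, but |sinc x| \<le> 1 / x \<le> x^2 / J^2.\<close>

lemma inner_cos_mode_defect_bound:
  "\<bar>L2_inner T (cos_mode T l) (defect (pw_step b))\<bar>
    \<le> T / 2 * ((halfang n l)\<^sup>2 * (3 / (real (Suc (l div (2 * n))))\<^sup>2) * \<bar>dst n b l\<bar>)"
proof -
  define x where "x = halfang n l"
  define D where "D = dst n b l"
  define B where "B = x\<^sup>2 * (3 / (real (Suc (l div (2 * n))))\<^sup>2) * \<bar>D\<bar>"
  have x0: "x > 0" unfolding x_def using n_pos by (rule halfang_pos)
  \<comment> \<open>k is the base index of the alias l and \<epsilon> its cosine sign; for l < n the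
    alias is l itself.\<close>
  obtain k \<epsilon> where k: "k < n" "\<bar>\<epsilon>\<bar> = 1" "l < n \<Longrightarrow> k = l \<and> \<epsilon> = 1"
    and \<epsilon>: "\<And>i. cos (x * real (2 * i + 1)) = \<epsilon> * cos (halfang n k * real (2 * i + 1))"
    and Dk: "\<bar>dst n b k\<bar> = \<bar>D\<bar>"
  proof (rule alias_cases[of l])
    fix j k assume jk: "k < n" "l = 2 * n * j + k" "j = l div (2 * n)"
    have a: "x = halfang n k + pi * real j" "D = (-1) ^ j * dst n b k"
      unfolding x_def D_def jk(2) by (rule halfang_alias(1)[OF n_pos], rule dct_dst_alias(2)[OF n_pos])
    show thesis
    proof (rule that[of k "(-1) ^ j"])
      show "k = l \<and> (- 1 :: real) ^ j = 1" if "l < n"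
      proof -
        have "j = 0" using jk(2) that by (cases j) auto
        thus ?thesis using jk(2) by simp
      qed
      show "cos (x * real (2 * i + 1)) = (-1) ^ j * cos (halfang n k * real (2 * i + 1))" for i
        unfolding a by (rule cos_sin_alias(1))
    qed (use jk(1) a in \<open>simp_all add: abs_mult\<close>)
  next
    fix j k assume jk: "k < n" "l = 2 * n * j + (2 * n - 1 - k)" "j = l div (2 * n)"
    have a: "x = pi * real (Suc j) - halfang n k" "D = (-1) ^ j * dst n b k"
      unfolding x_def D_def jk(2) by (rule halfang_alias(2)[OF n_pos jk(1)], rule dct_dst_alias(4)[OF n_pos jk(1)])
    show thesis
    proof (rule that[of k "(-1) ^ Suc j"])
      \<comment> \<open>A reflected alias has index at least n, so this case is
        contradictory.\<close>
      show "k = l \<and> (- 1 :: real) ^ Suc j = 1" if "l < n" using jk(1,2) that by linarith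
      show "cos (x * real (2 * i + 1)) = (-1) ^ Suc j * cos (halfang n k * real (2 * i + 1))" for i
        unfolding a by (rule cos_sin_alias(3))
    qed (use jk(1) a in \<open>simp_all add: abs_mult\<close>)
  qed
  define \<sigma> where "\<sigma> = alias_symbol (halfang n k)"
  note hb = halfang_bounds[OF k(1)]
  have \<sigma>: "0 \<le> \<sigma>" "\<sigma> \<le> 2"
  proof -
    have "0 \<le> (sinc (halfang n k))\<^sup>2 * damp k" using damp_pos[OF k(1)] by simp
    also have "\<dots> \<le> \<sigma>" unfolding \<sigma>_def by (rule alias_symbol_halfang_ge[OF k(1)])
    finally show "0 \<le> \<sigma>" .
    have s0: "0 \<le> sinc (halfang n k)" using hb by (simp add: sinc_def sin_ge_zero)
    have s1: "(sinc (halfang n k))\<^sup>2 \<le> 1" using s0 sinc_le_1[of "halfang n k"] hb by (simp add: power_le_one)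
    have "(sin (halfang n k))\<^sup>2 / pi\<^sup>2 \<le> 1 / 1"
    proof (rule frac_le)
      show "(sin (halfang n k))\<^sup>2 \<le> 1" by (simp add: abs_square_le_1)
      show "1 \<le> pi\<^sup>2" using pi_gt3 by (intro one_le_power) auto
    qed auto
    with s1 alias_symbol_le[OF hb] show "\<sigma> \<le> 2" unfolding \<sigma>_def by linarith
  qed
  have "L2_inner T (cos_mode T l) (defect (pw_step b))
      = T / 2 * (sinc x * D) - T / 2 * (sinc x * (\<epsilon> * \<sigma> * dst n b k))"
    unfolding x_def D_def \<sigma>_def
    using inner_defect[OF cos_mode_L2 pw_step_L2] inner_cos_mode_modHilbert
      inner_Q_cos_mode_modHilbert[OF k(1) \<epsilon>[unfolded x_def]] by simp
  also have "\<dots> = T / 2 * (sinc x * (D - \<epsilon> * \<sigma> * dst n b k))" by (simp add: algebra_simps)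
  finally have e1: "L2_inner T (cos_mode T l) (defect (pw_step b)) = T / 2 * (sinc x * (D - \<epsilon> * \<sigma> * dst n b k))" .
  have eq: "\<bar>L2_inner T (cos_mode T l) (defect (pw_step b))\<bar>
      = T / 2 * (\<bar>sinc x\<bar> * \<bar>D - \<epsilon> * \<sigma> * dst n b k\<bar>)"
    unfolding e1 abs_mult using T_pos by simp
  have "\<bar>sinc x\<bar> * \<bar>D - \<epsilon> * \<sigma> * dst n b k\<bar> \<le> B"
  proof (cases "l < n")
    case True
    hence [simp]: "k = l" "\<epsilon> = 1" using k by auto
    have "l div (2 * n) = 0" using True by simp
    hence B: "B = x\<^sup>2 * 3 * \<bar>D\<bar>" unfolding B_def by simp
    have "\<bar>sinc x\<bar> \<le> 1" using sinc_le_1[OF x0] hb by (simp add: x_def sinc_def sin_ge_zero)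
    moreover have "\<bar>D - \<epsilon> * \<sigma> * dst n b k\<bar> = \<bar>1 - \<sigma>\<bar> * \<bar>D\<bar>"
      unfolding abs_mult[symmetric] D_def by (simp add: algebra_simps)
    moreover have "\<bar>1 - \<sigma>\<bar> \<le> x\<^sup>2" unfolding \<sigma>_def x_def using alias_symbol_near_1[OF hb] by simp
    ultimately have "\<bar>sinc x\<bar> * \<bar>D - \<epsilon> * \<sigma> * dst n b k\<bar> \<le> 1 * (x\<^sup>2 * \<bar>D\<bar>)"
      by (intro mult_mono) (auto intro: mult_right_mono)
    also have "\<dots> \<le> B" unfolding B by (simp add: mult_right_mono)
    finally show ?thesis .
  next
    case False
    define J where "J = real (Suc (l div (2 * n)))"
    have J: "1 \<le> J" "J \<le> x" unfolding J_def x_def using halfang_ge_block[of l] False by auto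
    have "\<bar>sin x\<bar> \<le> 1" by simp
    hence s: "\<bar>sinc x\<bar> \<le> 1 / x" unfolding sinc_def using x0 by (simp add: field_simps)
    \<comment> \<open>With \<sigma> \<le> 2 the triangle inequality produces the constant 3.\<close>
    have "\<bar>D - \<epsilon> * \<sigma> * dst n b k\<bar> \<le> \<bar>D\<bar> + \<bar>\<epsilon> * \<sigma> * dst n b k\<bar>" by (rule abs_triangle_ineq4)
    also have "\<bar>\<epsilon> * \<sigma> * dst n b k\<bar> = \<sigma> * \<bar>D\<bar>" using \<sigma> k(2) Dk by (simp add: abs_mult)
    also have "\<bar>D\<bar> + \<sigma> * \<bar>D\<bar> \<le> \<bar>D\<bar> + 2 * \<bar>D\<bar>" using \<sigma> by (intro add_left_mono mult_right_mono) auto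
    finally have "\<bar>sinc x\<bar> * \<bar>D - \<epsilon> * \<sigma> * dst n b k\<bar> \<le> 1 / x * (3 * \<bar>D\<bar>)"
      using s x0 by (intro mult_mono) auto
    also have "1 / x \<le> x\<^sup>2 / J\<^sup>2"
    proof -
      have "1 * J\<^sup>2 \<le> x * x\<^sup>2" using J by (intro mult_mono power_mono) auto
      thus ?thesis using x0 J by (simp add: field_simps)
    qed
    hence "1 / x * (3 * \<bar>D\<bar>) \<le> x\<^sup>2 / J\<^sup>2 * (3 * \<bar>D\<bar>)" by (rule mult_right_mono) simp
    also have "\<dots> = B" unfolding B_def J_def by simp
    finally show ?thesis .
  qed
  thus ?thesis unfolding eq B_def x_def D_def using T_pos by (intro mult_left_mono) auto
qed

text \<open>In each block every \<open>dst\<close> value occurs twice in modulus, which gives 18 /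
  J^4 times the sum of their squares. The sum of 1 / J^4 is bounded by that of 1 / J^2, at most pi^2
  / 6 < 3, and 54 is 18 times 3.\<close>

lemma sum_block_weights_le:
  "(\<Sum>l<m * (2 * n). (3 / (real (Suc (l div (2 * n))))\<^sup>2 * \<bar>dst n b l\<bar>)\<^sup>2)
    \<le> 54 * (2 / T * (L2_norm T (pw_step b))\<^sup>2)"
proof -
  define f where "f l = (3 / (real (Suc (l div (2 * n))))\<^sup>2 * \<bar>dst n b l\<bar>)\<^sup>2" for l
  define V where "V = (\<Sum>k<n. (dst n b k)\<^sup>2)"
  have V0: "V \<ge> 0" unfolding V_def by (intro sum_nonneg) auto
  have V: "V = 2 / T * (L2_norm T (pw_step b))\<^sup>2"
    unfolding V_def pw_step_norm_dst[of b] using T_pos by simp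
  have blk: "sum f {j * (2 * n)..<j * (2 * n) + 2 * n} \<le> 18 * V * (1 / (real j + 1)\<^sup>2)" for j
  proof -
    have "sum f {j * (2 * n)..<j * (2 * n) + 2 * n} = (\<Sum>k<n. 18 / (real (Suc j)) ^ 4 * (dst n b k)\<^sup>2)"
      unfolding sum_alias_block
    proof (intro sum.cong refl)
      fix k assume "k \<in> {..<n}"
      hence k: "k < n" by simp
      have d: "(2 * n * j + k) div (2 * n) = j" "(2 * n * j + (2 * n - 1 - k)) div (2 * n) = j"
        using k n_pos by (auto intro!: div_nat_eqI)
      have a: "\<bar>dst n b (2 * n * j + k)\<bar> = \<bar>dst n b k\<bar>"
        "\<bar>dst n b (2 * n * j + (2 * n - 1 - k))\<bar> = \<bar>dst n b k\<bar>"
        by (simp only: dct_dst_alias(2)[OF n_pos, of b j k], simp add: abs_mult)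
           (simp only: dct_dst_alias(4)[OF n_pos k, of b j], simp add: abs_mult)
      have "f (2 * n * j + k) = 9 / (real (Suc j)) ^ 4 * (dst n b k)\<^sup>2"
        "f (2 * n * j + (2 * n - 1 - k)) = 9 / (real (Suc j)) ^ 4 * (dst n b k)\<^sup>2"
        unfolding f_def d a by (simp_all add: power_mult_distrib power_divide flip: power_mult)
      thus "f (2 * n * j + k) + f (2 * n * j + (2 * n - 1 - k)) = 18 / (real (Suc j)) ^ 4 * (dst n b k)\<^sup>2"
        by simp
    qed
    also have "\<dots> = 18 * V * (1 / (real j + 1) ^ 4)" unfolding V_def by (simp add: sum_distrib_left sum_distrib_right add.commute mult_ac)
    also have "\<dots> \<le> 18 * V * (1 / (real j + 1)\<^sup>2)"
      using V0 by (intro mult_left_mono divide_left_mono power_increasing) auto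
    finally show ?thesis .
  qed
  have "sum f {..<m * (2 * n)} = (\<Sum>j<m. sum f {j * (2 * n)..<j * (2 * n) + 2 * n})"
    by (rule sum.nat_group[symmetric])
  also have "\<dots> \<le> (\<Sum>j<m. 18 * V * (1 / (real j + 1)\<^sup>2))" by (intro sum_mono blk)
  also have "\<dots> = 18 * V * (\<Sum>j<m. 1 / (real j + 1)\<^sup>2)" by (simp only: sum_distrib_left)
  also have "\<dots> \<le> 18 * V * 3"
  proof (rule mult_left_mono)
    have "(\<Sum>j<m. 1 / (real j + 1)\<^sup>2) \<le> pi\<^sup>2 / 6"
      using sum_le_suminf[OF sums_summable[OF inverse_squares_sums], of "{..<m}"] sums_unique[OF inverse_squares_sums]
      by (simp add: add.commute)
    also have "\<dots> \<le> 4\<^sup>2 / 6" using pi_less_4 by (intro divide_right_mono power_mono) auto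
    finally show "(\<Sum>j<m. 1 / (real j + 1)\<^sup>2) \<le> 3" by simp
  qed (use V0 in simp)
  finally show ?thesis unfolding f_def V by simp
qed

section \<open>Summation over the modes and the discrete error\<close>

text \<open>Mode by mode, 1 / omega^2 = h^2 / (4 x^2) cancels the x^2 of the defect. What remains is
  h^2 times the coefficients of g against square summable weights, to which Cauchy-Schwarz and
  Bessel's inequality apply.\<close>

lemma consistency_error:
  assumes g: "g \<in> L2 T"
  shows "\<bar>L2_inner T (prim T (prim T g)) (defect (pw_step b))\<bar> \<le> 2 * h\<^sup>2 * L2_norm T g * L2_norm T (pw_step b)"
proof -
  define W where "W = prim T g"
  define U where "U t = prim T W t - prim T W T" for t
  define G where "G = defect (pw_step b)"
  define d where "d = fourier_cos T g"
  define \<kappa> where "\<kappa> l = 3 / (real (Suc (l div (2 * n))))\<^sup>2 * \<bar>dst n b l\<bar>" for l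
  have W: "W \<in> L2 T" unfolding W_def using g by simp
  have GL: "G \<in> L2 T" unfolding G_def by simp
  have Uc: "continuous_on {0..T} U" unfolding U_def by (intro continuous_intros prim_continuous W)
  have cU: "fourier_cos T U l = - (d l / (freq T l)\<^sup>2)" for l
    unfolding U_def[abs_def] W_def d_def by (rule fourier_cos_second_primitive[OF T_pos g])
  have w2: "(freq T l)\<^sup>2 = 4 * (halfang n l)\<^sup>2 / h\<^sup>2" for l
  proof -
    have "freq T l = 2 * halfang n l / h" using freq_h[of l] h_pos by (simp add: field_simps)
    thus ?thesis by (simp add: power_divide power_mult_distrib)
  qed
  have dB: "(\<Sum>l\<in>A. (d l)\<^sup>2) \<le> 2 / T * (L2_norm T g)\<^sup>2" if "finite A" for A
    unfolding d_def fourier_cos_eq by (rule Bessel[OF orthogonal_cos_mode[OF T_pos] that g T_pos])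
  define D where "D = sqrt (2 / T * (L2_norm T g)\<^sup>2)"
  have d1: "\<bar>d l\<bar> \<le> D" for l
    unfolding D_def using dB[of "{l}"] by (intro real_le_rsqrt) simp
  \<comment> \<open>The coefficients of g are bounded by Bessel on singletons and omega \<ge> (l +
    1) / T, so inverse squares dominate.\<close>
  have "summable (\<lambda>l. \<bar>fourier_cos T U l\<bar>)"
  proof (rule summable_comparison_test'[of "\<lambda>l. D * (T\<^sup>2 * (1 / (real l + 1)\<^sup>2))" 0])
    show "summable (\<lambda>l. D * (T\<^sup>2 * (1 / (real l + 1)\<^sup>2)))"
      using sums_summable[OF inverse_squares_sums] by (intro summable_mult) (simp add: add.commute)
    fix l
    have "real l + 1 \<le> pi / 2 + real l * pi"
    proof -
      have "real l * 1 \<le> real l * pi" using pi_gt3 by (intro mult_left_mono) auto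
      thus ?thesis using pi_gt3 by linarith
    qed
    hence "(real l + 1) / T \<le> freq T l" unfolding freq_def using T_pos by (intro divide_right_mono) auto
    hence le: "((real l + 1) / T)\<^sup>2 \<le> (freq T l)\<^sup>2" using T_pos by (intro power_mono) auto
    have "\<bar>d l\<bar> / (freq T l)\<^sup>2 \<le> D / ((real l + 1) / T)\<^sup>2"
      using d1[of l] le T_pos by (intro frac_le zero_less_power divide_pos_pos) auto
    also have "\<dots> = D * (T\<^sup>2 * (1 / (real l + 1)\<^sup>2))" by (simp add: power_divide)
    finally show "norm \<bar>fourier_cos T U l\<bar> \<le> D * (T\<^sup>2 * (1 / (real l + 1)\<^sup>2))"
      unfolding cU by simp
  qed
  hence S: "(\<lambda>l. fourier_cos T U l * L2_inner T (cos_mode T l) G) sums L2_inner T U G"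
    by (intro cos_series_inner T_pos Uc GL)
  define C where "C = h\<^sup>2 * T / 8 * (D * sqrt (54 * (2 / T * (L2_norm T (pw_step b))\<^sup>2)))"
  \<comment> \<open>Bounding whole blocks suffices, as their partial sums are a subsequence of those
    of the series.\<close>
  have part: "\<bar>\<Sum>l<m * (2 * n). fourier_cos T U l * L2_inner T (cos_mode T l) G\<bar> \<le> C" for m
  proof -
    let ?A = "{..<m * (2 * n)}"
    have "\<bar>\<Sum>l\<in>?A. fourier_cos T U l * L2_inner T (cos_mode T l) G\<bar>
        \<le> (\<Sum>l\<in>?A. \<bar>fourier_cos T U l * L2_inner T (cos_mode T l) G\<bar>)" by (rule sum_abs)
    also have "\<dots> \<le> (\<Sum>l\<in>?A. h\<^sup>2 * T / 8 * (\<bar>d l\<bar> * \<kappa> l))"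
    proof (rule sum_mono)
      fix l
      have xp: "(halfang n l)\<^sup>2 > 0" using halfang_pos[OF n_pos, of l] by simp
      have "\<bar>fourier_cos T U l * L2_inner T (cos_mode T l) G\<bar>
          = \<bar>d l\<bar> / (freq T l)\<^sup>2 * \<bar>L2_inner T (cos_mode T l) G\<bar>" unfolding cU by (simp add: abs_mult)
      also have "\<dots> \<le> \<bar>d l\<bar> / (freq T l)\<^sup>2 * (T / 2 * ((halfang n l)\<^sup>2 * \<kappa> l))"
        using inner_cos_mode_defect_bound[of l b] unfolding G_def \<kappa>_def
        by (intro mult_left_mono) (auto simp: mult.assoc)
      also have "\<dots> = h\<^sup>2 * T / 8 * (\<bar>d l\<bar> * \<kappa> l)"
        unfolding w2 using xp h_pos by (simp add: field_simps)
      finally show "\<bar>fourier_cos T U l * L2_inner T (cos_mode T l) G\<bar> \<le> h\<^sup>2 * T / 8 * (\<bar>d l\<bar> * \<kappa> l)" .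
    qed
    also have "\<dots> = h\<^sup>2 * T / 8 * (\<Sum>l\<in>?A. \<bar>d l\<bar> * \<kappa> l)" by (rule sum_distrib_left[symmetric])
    also have "\<dots> \<le> C"
      unfolding C_def
    proof (rule mult_left_mono)
      have "(\<Sum>l\<in>?A. \<bar>d l\<bar> * \<kappa> l)\<^sup>2 \<le> (\<Sum>l\<in>?A. \<bar>d l\<bar>\<^sup>2) * (\<Sum>l\<in>?A. (\<kappa> l)\<^sup>2)" by (rule Cauchy_Schwarz_ineq_sum)
      also have "\<dots> \<le> (2 / T * (L2_norm T g)\<^sup>2) * (54 * (2 / T * (L2_norm T (pw_step b))\<^sup>2))"
        using dB[of ?A] sum_block_weights_le[of b m] T_pos unfolding \<kappa>_def
        by (intro mult_mono) (auto intro!: sum_nonneg)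
      finally have "(\<Sum>l\<in>?A. \<bar>d l\<bar> * \<kappa> l) \<le> sqrt ((2 / T * (L2_norm T g)\<^sup>2) * (54 * (2 / T * (L2_norm T (pw_step b))\<^sup>2)))"
        by (rule real_le_rsqrt)
      thus "(\<Sum>l\<in>?A. \<bar>d l\<bar> * \<kappa> l) \<le> D * sqrt (54 * (2 / T * (L2_norm T (pw_step b))\<^sup>2))"
        unfolding D_def real_sqrt_mult[symmetric] .
    qed (use T_pos in simp)
    finally show ?thesis .
  qed
  have "(\<lambda>m. \<Sum>l<m * (2 * n). fourier_cos T U l * L2_inner T (cos_mode T l) G) \<longlonglongrightarrow> L2_inner T U G"
  proof -
    have "(\<lambda>j. sum (\<lambda>l. fourier_cos T U l * L2_inner T (cos_mode T l) G) {j * (2 * n)..<j * (2 * n) + 2 * n}) sums L2_inner T U G"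
      by (rule sums_group[OF S]) (use n_pos in simp)
    thus ?thesis unfolding sums_def sum.nat_group .
  qed
  hence "\<bar>L2_inner T U G\<bar> \<le> C"
    by (intro LIMSEQ_le_const2[OF tendsto_rabs]) (use part in auto)
  also have "C \<le> 2 * h\<^sup>2 * L2_norm T g * L2_norm T (pw_step b)"
  proof -
    \<comment> \<open>The constants combine to T / 8 times 2 / T times sqrt 54, that is sqrt 54 / 4,
      and 54 \<le> 64.\<close>
    have "sqrt 54 \<le> 8" by (rule real_le_lsqrt) auto
    hence "h\<^sup>2 / 4 * (L2_norm T g * L2_norm T (pw_step b)) * sqrt 54 \<le> h\<^sup>2 / 4 * (L2_norm T g * L2_norm T (pw_step b)) * 8"
      by (intro mult_left_mono) auto
    moreover have "C = h\<^sup>2 / 4 * (L2_norm T g * L2_norm T (pw_step b)) * sqrt 54"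
    proof -
      define r where "r = sqrt (2 / T)"
      have rr: "r * r = 2 / T" unfolding r_def using T_pos by simp
      have "D = r * L2_norm T g"
        unfolding D_def r_def by (simp only: real_sqrt_mult real_sqrt_abs abs_of_nonneg[OF L2_norm_nonneg])
      moreover have "sqrt (54 * (2 / T * (L2_norm T (pw_step b))\<^sup>2)) = sqrt 54 * (r * L2_norm T (pw_step b))"
        unfolding r_def by (simp only: real_sqrt_mult real_sqrt_abs abs_of_nonneg[OF L2_norm_nonneg])
      ultimately have "C = h\<^sup>2 * T / 8 * ((r * r) * (L2_norm T g * L2_norm T (pw_step b))) * sqrt 54"
        unfolding C_def by (simp only: mult_ac)
      thus ?thesis unfolding rr using T_pos by simp
    qed
    ultimately have "C \<le> h\<^sup>2 / 4 * (L2_norm T g * L2_norm T (pw_step b)) * 8" by (simp only:)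
    thus ?thesis by (simp add: mult_ac)
  qed
  finally have "\<bar>L2_inner T U G\<bar> \<le> 2 * h\<^sup>2 * L2_norm T g * L2_norm T (pw_step b)" .
  moreover have "L2_inner T U G = L2_inner T (prim T (prim T g)) G"
    unfolding U_def[abs_def] W_def[symmetric] using W GL inner_const_defect[OF pw_step_L2, of "prim T W T" b]
    by (simp add: L2_inner_diff_left G_def)
  ultimately show ?thesis unfolding G_def by simp
qed

lemma galerkin_superconvergence:
  assumes u: "u \<in> L2 T" and gs: "galerkin_solution T n u uh" and g: "g \<in> L2 T"
    and rep: "AE t in leb T. u t = C + prim T (prim T g) t"
  shows "L2_norm T (\<lambda>t. uh t - Q u t) \<le> pi\<^sup>2 * T * h * L2_norm T g"
proof -
  define z where "z t = uh t - Q u t" for t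
  have z: "z \<in> pw_const T n" unfolding z_def[abs_def] by (rule galerkin_difference[OF u gs])
  hence zL: "z \<in> L2 T" by (rule pw_const_L2)
  obtain a where a: "AE t in leb T. z t = pw_step a t" using pw_const_AE_pw_step[OF z] .
  define Z where "Z = L2_norm T (pw_step a)"
  have Zz: "L2_norm T z = Z" unfolding Z_def by (rule L2_norm_cong_AE[OF a zL pw_step_L2])
  obtain b where b: "L2_norm T (pw_step b) = Z"
    "2 / (pi\<^sup>2 * real n) * Z\<^sup>2 \<le> L2_inner T (pw_step a) (modHilbert T (pw_step b))"
    unfolding Z_def by (rule coercivity[of a])
  have Hb: "modHilbert T (pw_step b) \<in> L2 T" using T_pos by (intro modHilbert_L2) auto
  have P: "prim T (prim T g) \<in> L2 T" using g by simp
  note b(2)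
  also have "L2_inner T (pw_step a) (modHilbert T (pw_step b)) = L2_inner T z (modHilbert T (pw_step b))"
    using a zL Hb by (intro L2_inner_cong_AE) auto
  also have "\<dots> = L2_inner T (\<lambda>t. u t - Q u t) (modHilbert T (pw_step b))"
    unfolding z_def[abs_def] by (rule galerkin_difference(2)[OF u gs]) simp
  also have "\<dots> = L2_inner T u (defect (pw_step b))"
    unfolding inner_defect[OF u pw_step_L2] using u Hb by (simp add: L2_inner_diff_left)
  also have "\<dots> = L2_inner T (\<lambda>t. C + prim T (prim T g) t) (defect (pw_step b))"
    using rep u P by (intro L2_inner_cong_AE) auto
  also have "\<dots> = L2_inner T (prim T (prim T g)) (defect (pw_step b))"
    using P inner_const_defect[OF pw_step_L2] by (simp add: L2_inner_add_left)
  also have "\<dots> \<le> 2 * h\<^sup>2 * L2_norm T g * Z"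
    using consistency_error[OF g, of b] b(1) by simp
  finally have main: "2 / (pi\<^sup>2 * real n) * Z\<^sup>2 \<le> 2 * h\<^sup>2 * L2_norm T g * Z" .
  have "Z \<le> pi\<^sup>2 * T * h * L2_norm T g"
  proof (cases "Z = 0")
    case True
    thus ?thesis using T_pos h_pos by simp
  next
    case False
    have "0 \<le> Z" unfolding Z_def by (rule L2_norm_nonneg)
    with False have Zp: "Z > 0" by simp
    have "2 / (pi\<^sup>2 * real n) * Z * Z \<le> 2 * h\<^sup>2 * L2_norm T g * Z"
      using main by (simp add: power2_eq_square mult_ac)
    hence "2 / (pi\<^sup>2 * real n) * Z \<le> 2 * h\<^sup>2 * L2_norm T g" using Zp by (rule mult_right_le_imp_le)
    hence "pi\<^sup>2 * real n / 2 * (2 / (pi\<^sup>2 * real n) * Z) \<le> pi\<^sup>2 * real n / 2 * (2 * h\<^sup>2 * L2_norm T g)"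
      by (intro mult_left_mono) auto
    \<comment> \<open>Grouping n with one factor h exposes T; this is the origin of the constant
      pi^2 T.\<close>
    hence "Z \<le> pi\<^sup>2 * (real n * h) * h * L2_norm T g" using n_pos by (simp add: power2_eq_square mult_ac)
    thus ?thesis unfolding n_times_h .
  qed
  thus ?thesis using Zz unfolding z_def[abs_def] by simp
qed

end

section \<open>The initial condition and the final estimates\<close>

text \<open>The end point 0 lies outside (0, T), so its value is reached by continuity: a difference
  at 0 would persist on an interval of positive measure.\<close>

lemma AE_eq_continuous_imp_eq:
  assumes T: "T > 0" and f: "continuous_on {0..T} f" and g: "continuous_on {0..T} g"
    and AE: "AE t in leb T. f t = g t"
  shows "f 0 = (g 0 :: real)"
proof (rule ccontr)
  assume ne: "f 0 \<noteq> g 0"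
  define d where "d t = f t - g t" for t
  have "continuous_on {0..T} d" unfolding d_def by (intro continuous_intros f g)
  moreover have "0 \<in> {0..T}" "0 < \<bar>d 0\<bar>" using T ne unfolding d_def by auto
  ultimately have "\<exists>\<delta>>0. \<forall>t\<in>{0..T}. dist t 0 < \<delta> \<longrightarrow> dist (d t) (d 0) < \<bar>d 0\<bar>"
    unfolding continuous_on_iff by blast
  then obtain \<delta> where \<delta>: "\<delta> > 0" "\<And>t. t \<in> {0..T} \<Longrightarrow> dist t 0 < \<delta> \<Longrightarrow> dist (d t) (d 0) < \<bar>d 0\<bar>" by blast
  have ne0: "f t \<noteq> g t" if "t \<in> {0<..<min \<delta> T}" for t
    using \<delta>(2)[of t] that unfolding d_def dist_real_def by auto
  have "AE t in leb T. t \<notin> {0<..<min \<delta> T}"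
    using AE by eventually_elim (use ne0 in blast)
  hence "AE t in leb T. indicator {0<..<min \<delta> T} t = (0 :: real)"
    by eventually_elim auto
  hence "(\<integral>t. 1 * indicator {0<..<min \<delta> T} t \<partial>leb T) = (\<integral>t. (0 :: real) \<partial>leb T)"
    by (intro integral_cong_AE) (auto simp: indicator_borel_leb)
  moreover have "(\<integral>t. 1 * indicator {0<..<min \<delta> T} t \<partial>leb T) = min \<delta> T - 0"
    by (rule integral_leb_FTC(1)[where F = "\<lambda>t. t"]) (use T \<delta>(1) in auto)
  ultimately show False using T \<delta>(1) by simp
qed

text \<open>The initial value forces C = 0 in w = C + \<open>prim T g\<close>, so u is a constant
  plus a double primitive with no linear term. The last identity holds everywhere because
  \<open>prim\<close> does not see null sets.\<close>

lemma sobolev_2_representation: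
  assumes T: "T > 0" and u: "u \<in> sobolev T 2" and init: "has_initial_value T (weak_deriv T u) 0"
  defines "w \<equiv> weak_deriv T u"
  defines "g \<equiv> weak_deriv T w"
  shows "u \<in> L2 T" "w \<in> L2 T" "g \<in> L2 T" "\<exists>C. AE t in leb T. u t = C + prim T w t"
    "AE t in leb T. w t = prim T g t" "prim T w = prim T (prim T g)"
proof -
  have ex: "\<exists>g\<in>L2 T. has_weak_deriv T ((weak_deriv T ^^ j) u) g" if "j < 2" for j
    using u that unfolding sobolev_def by simp
  show uL: "u \<in> L2 T" using u unfolding sobolev_def by simp
  have wd: "w \<in> L2 T" "has_weak_deriv T u w"
    unfolding w_def using ex[of 0] by (auto intro!: weak_deriv_some)
  have gd: "g \<in> L2 T" "has_weak_deriv T w g"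
    unfolding g_def w_def using ex[of 1] by (auto intro!: weak_deriv_some)
  show "w \<in> L2 T" "g \<in> L2 T" by (fact wd(1), fact gd(1))
  show "\<exists>C. AE t in leb T. u t = C + prim T w t" by (rule weak_deriv_primitive[OF T uL wd])
  obtain C where C: "AE t in leb T. w t = C + prim T g t"
    using weak_deriv_primitive[OF T wd(1) gd] by blast
  obtain f where f: "continuous_on {0..T} f" "AE t in leb T. f t = w t" "f 0 = 0"
    using init unfolding has_initial_value_def w_def by blast
  have "AE t in leb T. f t = C + prim T g t" using f(2) C by eventually_elim simp
  moreover have "continuous_on {0..T} (\<lambda>t. C + prim T g t)"
    by (intro continuous_on_add continuous_on_const prim_continuous gd(1))
  ultimately have "f 0 = C + prim T g 0" by (intro AE_eq_continuous_imp_eq[OF T f(1)])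
  hence "C = 0" using f(3) prim_0[of T g] by simp
  thus w_eq: "AE t in leb T. w t = prim T g t" using C by simp
  show "prim T w = prim T (prim T g)"
  proof
    fix t
    show "prim T w t = prim T (prim T g) t"
      unfolding prim_def[of T w] prim_def[of T "prim T g"]
      using w_eq wd(1) gd(1) by (intro L2_inner_cong_AE) (auto simp: indicator_L2)
  qed
qed

theorem theorem5p7:
  fixes T :: real
  assumes "T > 0"
  shows "\<exists>c>0. \<forall>n::nat. \<forall>u uh. n \<ge> 1 \<longrightarrow> u \<in> L2 T \<longrightarrow> galerkin_solution T n u uh \<longrightarrow>
    (\<forall>s\<in>{0..1}. u \<in> sobolev T s \<longrightarrow>
      L2_norm T (\<lambda>t. u t - uh t) \<le>
        c * ((T / real n) powr s * sobolev_norm T s u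
             + L2_norm T (Q_proj T n (modHilbert_inv T (\<lambda>t. u t - Q_proj T n u t)))
               / cS T n (\<lambda>t. uh t - Q_proj T n u t))) \<and>
    (u \<in> sobolev T 2 \<and> has_initial_value T (weak_deriv T u) 0 \<longrightarrow>
      L2_norm T (\<lambda>t. u t - uh t) \<le> c * (T / real n) * sobolev_norm T 2 u)"
proof (intro exI conjI allI impI ballI)
  \<comment> \<open>The summand 1 pays for the projection error and pi^2 T for the discrete error of
    the second estimate; one constant serves both claims.\<close>
  define c where "c = 1 + pi\<^sup>2 * T"
  have c1: "c \<ge> 1" unfolding c_def using assms by simp
  show "0 < 1 + pi\<^sup>2 * T" using c1 unfolding c_def by simp
  fix n :: nat and u uh :: "real \<Rightarrow> real"
  assume "n \<ge> 1" and u: "u \<in> L2 T" and gs: "galerkin_solution T n u uh"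
  then interpret mesh T n using assms by unfold_locales auto
  have uh: "uh \<in> L2 T" using gs pw_const_L2 unfolding galerkin_solution_def by blast
  have tri: "L2_norm T (\<lambda>t. u t - uh t)
    \<le> L2_norm T (\<lambda>t. u t - Q_proj T n u t) + L2_norm T (\<lambda>t. uh t - Q_proj T n u t)"
    using L2_norm_triangle_diff[OF u Q_proj_L2[OF u] uh] L2_norm_minus_commute[of T "Q_proj T n u" uh] by simp
  {
    fix s assume s: "s \<in> {0..1}" and us: "u \<in> sobolev T s"
    define R where "R = L2_norm T (Q_proj T n (modHilbert_inv T (\<lambda>t. u t - Q_proj T n u t)))
       / cS T n (\<lambda>t. uh t - Q_proj T n u t)"
    have "L2_norm T (\<lambda>t. u t - uh t) \<le> h powr s * sobolev_norm T s u + R"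
      using tri projection_error_sobolev[OF us s] galerkin_projection_error(1)[OF u gs] unfolding R_def by linarith
    also have "\<dots> \<le> c * (h powr s * sobolev_norm T s u + R)"
    proof -
      \<comment> \<open>The bracket has just been shown to dominate a norm, hence it is nonnegative
        and may be multiplied by c \<ge> 1.\<close>
      have "0 \<le> h powr s * sobolev_norm T s u + R"
        using calculation L2_norm_nonneg order.trans by blast
      thus ?thesis using mult_right_mono[OF c1] by simp
    qed
    finally show "L2_norm T (\<lambda>t. u t - uh t) \<le>
        (1 + pi\<^sup>2 * T) * ((T / real n) powr s * sobolev_norm T s u
             + L2_norm T (Q_proj T n (modHilbert_inv T (\<lambda>t. u t - Q_proj T n u t)))
               / cS T n (\<lambda>t. uh t - Q_proj T n u t))"
      unfolding R_def h_def c_def .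
  }
  assume "u \<in> sobolev T 2 \<and> has_initial_value T (weak_deriv T u) 0"
  note rep = sobolev_2_representation[OF assms conjunct1[OF this] conjunct2[OF this]]
  define w g where "w = weak_deriv T u" and "g = weak_deriv T w"
  note rep = rep[folded w_def, folded g_def]
  obtain C where C: "AE t in leb T. u t = C + prim T w t" using rep(4) by blast
  have "L2_norm T (\<lambda>t. u t - Q_proj T n u t) \<le> h * L2_norm T w"
    by (rule projection_error_H1[OF u rep(2) C])
  moreover have "L2_norm T (\<lambda>t. uh t - Q_proj T n u t) \<le> pi\<^sup>2 * T * h * L2_norm T g"
    by (rule galerkin_superconvergence[OF u gs rep(3) C[unfolded rep(6)]])
  moreover have nrm: "sobolev_norm T 2 u = sqrt ((L2_norm T u)\<^sup>2 + (L2_norm T w)\<^sup>2 + (L2_norm T g)\<^sup>2)"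
    unfolding sobolev_norm_def w_def g_def by (simp add: numeral_2_eq_2)
  have "L2_norm T w \<le> sobolev_norm T 2 u" "L2_norm T g \<le> sobolev_norm T 2 u"
    unfolding nrm by (auto intro!: real_le_rsqrt)
  hence "h * L2_norm T w \<le> h * sobolev_norm T 2 u"
    "pi\<^sup>2 * T * h * L2_norm T g \<le> pi\<^sup>2 * T * h * sobolev_norm T 2 u"
    using h_pos assms by (auto intro!: mult_left_mono)
  ultimately have "L2_norm T (\<lambda>t. u t - uh t) \<le> h * sobolev_norm T 2 u + pi\<^sup>2 * T * h * sobolev_norm T 2 u"
    using tri by linarith
  also have "\<dots> = (1 + pi\<^sup>2 * T) * h * sobolev_norm T 2 u" by (simp add: algebra_simps)
  finally show "L2_norm T (\<lambda>t. u t - uh t) \<le> (1 + pi\<^sup>2 * T) * (T / real n) * sobolev_norm T 2 u"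
    unfolding h_def .
qed

end
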